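(* The set $\{C_{r^+(\mathcal{D})}\}_{\mathcal{D}\in W_J\backslash W/W_J}$ is a basis of the parabolic Hecke algebra $H^J(W)$ over $A$, and for every $\mathcal{D}\in W_J\backslash W/W_J$ we have $$C_{r^+(\mathcal{D})}=\sum_{\mathcal{D}'\leq\mathcal{D}}p_{r^+(\mathcal{D}'),r^+(\mathcal{D})}\,T_{\mathcal{D}'}\ .$$ Moreover, $C_{r^+(\mathcal{D})}$ is the unique element $B_{\mathcal{D}}$ of $H^J(W)$ satisfying $$\overline{B_{\mathcal{D}}}=B_{\mathcal{D}}\quad\text{and}\quad B_{\mathcal{D}}=T_{\mathcal{D}}+\sum_{\mathcal{D}'<\mathcal{D}}a_{\mathcal{D}'\mathcal{D}}\,T_{\mathcal{D}'}\ \ \text{with } a_{\mathcal{D}'\mathcal{D}}\in q^{-1}\mathbb{Z}[q^{-1}].$$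
   Context: $(W,S)$ is a Coxeter system with length function $\ell$ and strong Bruhat order $\leq$; $J\subseteq S$ is non-empty and the parabolic subgroup $W_J$ generated by $J$ is assumed finite. Each double coset $\mathcal{D}\in W_J\backslash W/W_J$ has a unique element $r^-(\mathcal{D})$ of minimal length and a unique element $r^+(\mathcal{D})$ of maximal length. Double cosets are ordered by $\mathcal{D}\leq\mathcal{D}'$ iff $r^-(\mathcal{D})\leq r^-(\mathcal{D}')$ in the Bruhat order. Let $q$ be an indeterminate, $W_J(q^2)=\sum_{w\in W_J}q^{2\ell(w)}$ and $A=\mathbb{Z}[q,q^{-1},W_J(q^2)^{-1}]$. The Hecke algebra $H(W)$ is the $A$-algebra with basis $\{T_w\}_{w\in W}$ and multiplication, for $s\in S$: $T_sT_w=T_{sw}$ if $\ell(sw)>\ell(w)$, and $T_sT_w=(q-q^{-1})T_w+T_{sw}$ if $\ell(sw)<\ell(w)$. The bar involution is the ring automorphism of $H(W)$ with $\overline{q}=q^{-1}$, $\overline{T_s}=T_s^{-1}$. The Kazhdan--Lusztig basis $\{C_w\}_{w\in W}$ is the unique basis with $\overline{C_w}=C_w$ and $C_w=T_w+\sum_{x<w}p_{x,w}T_x$ with $p_{x,w}\in q^{-1}\mathbb{Z}[q^{-1}]$; set $p_{w,w}=1$ and $p_{x,w}=0$ if $x\not\leq w$. Let $e_J=\frac{1}{W_J(q^2)}\sum_{w\in W_J}q^{\ell(w)}T_w$ (an idempotent). The parabolic Hecke algebra is $H^J(W)=e_JH(W)e_J$, with unit $e_J$. Its standard basis is $\{T_{\mathcal{D}}\}_{\mathcal{D}\in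 W_J\backslash W/W_J}$ where $T_{\mathcal{D}}=\sum_{w\in\mathcal{D}}q^{\ell(w)-\ell(r^+(\mathcal{D}))}T_w$. *)

theory Defs
  imports "HOL-Algebra.Algebra" "HOL-Algebra.Algebraic_Closure_Type"
begin

section \<open>Coxeter systems\<close>

definition word_prod :: "('w, 'b) monoid_scheme \<Rightarrow> 'w list \<Rightarrow> 'w" where
  "word_prod G ws = foldr (\<lambda>s x. s \<otimes>\<^bsub>G\<^esub> x) ws \<one>\<^bsub>G\<^esub>"

text \<open>Deletion of a factor \<open>(s t)\<^sup>m\<close>, with \<open>m = m(s,t)\<close>, from a word in the generators. The value
  \<open>m s t = 0\<close> encodes \<open>m(s,t) = \<infinity>\<close>: the relation is then trivial.\<close>

inductive coxeter_step :: "('w \<Rightarrow> 'w \<Rightarrow> nat) \<Rightarrow> 'w set \<Rightarrow> 'w list \<Rightarrow> 'w list \<Rightarrow> bool"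
  for m S where
  "\<lbrakk>s \<in> S; t \<in> S; us \<in> lists S; vs \<in> lists S\<rbrakk> \<Longrightarrow>
    coxeter_step m S (us @ concat (replicate (m s t) [s, t]) @ vs) (us @ vs)"

definition coxeter_matrix :: "('w \<Rightarrow> 'w \<Rightarrow> nat) \<Rightarrow> 'w set \<Rightarrow> bool" where
  "coxeter_matrix m S \<longleftrightarrow>
    (\<forall>s\<in>S. m s s = 1) \<and> (\<forall>s\<in>S. \<forall>t\<in>S. s \<noteq> t \<longrightarrow> m s t = m t s \<and> m s t \<noteq> 1)"

text \<open>\<open>(G, S)\<close> is a Coxeter system if \<open>G\<close> has the presentation
  \<open>\<langle>S | (s t)\<^bsup>m(s,t)\<^esup> = 1\<rangle>\<close> for some Coxeter matrix \<open>m\<close>. Since the relations \<open>s s = 1\<close>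
  make the monoid with this presentation a group, words without inverse letters suffice.
  \<open>S\<close> is not required to be finite.\<close>

locale coxeter_system = group G for G (structure) +
  fixes S
  assumes gens_closed: "S \<subseteq> carrier G"
    and gens_generate: "generate G S = carrier G"
    and presentation: "\<exists>m. coxeter_matrix m S \<and>
      (\<forall>us\<in>lists S. \<forall>vs\<in>lists S.
        word_prod G us = word_prod G vs \<longleftrightarrow> equivclp (coxeter_step m S) us vs)"

definition cox_len :: "('w, 'b) monoid_scheme \<Rightarrow> 'w set \<Rightarrow> 'w \<Rightarrow> nat" where
  "cox_len G S w = (LEAST n. \<exists>ws\<in>lists S. length ws = n \<and> word_prod G ws = w)"

definition reflections :: "('w, 'b) monoid_scheme \<Rightarrow> 'w set \<Rightarrow> 'w set" where
  "reflections G S = {g \<otimes>\<^bsub>G\<^esub> s \<otimes>\<^bsub>G\<^esub> inv\<^bsub>G\<^esub> g | g s. g \<in> carrier G \<and> s \<in> S}"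

definition bruhat_step :: "('w, 'b) monoid_scheme \<Rightarrow> 'w set \<Rightarrow> 'w \<Rightarrow> 'w \<Rightarrow> bool" where
  "bruhat_step G S x y \<longleftrightarrow> x \<in> carrier G \<and> cox_len G S x < cox_len G S y \<and>
    (\<exists>t\<in>reflections G S. y = x \<otimes>\<^bsub>G\<^esub> t)"

definition bruhat_le :: "('w, 'b) monoid_scheme \<Rightarrow> 'w set \<Rightarrow> 'w \<Rightarrow> 'w \<Rightarrow> bool" where
  "bruhat_le G S x y \<longleftrightarrow> x \<in> carrier G \<and> y \<in> carrier G \<and> (bruhat_step G S)\<^sup>*\<^sup>* x y"

definition bruhat_less :: "('w, 'b) monoid_scheme \<Rightarrow> 'w set \<Rightarrow> 'w \<Rightarrow> 'w \<Rightarrow> bool" where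
  "bruhat_less G S x y \<longleftrightarrow> bruhat_le G S x y \<and> x \<noteq> y"


section \<open>Parabolic double cosets\<close>

abbreviation parabolic :: "('w, 'b) monoid_scheme \<Rightarrow> 'w set \<Rightarrow> 'w set" where
  "parabolic G J \<equiv> generate G J"

definition double_cosets :: "('w, 'b) monoid_scheme \<Rightarrow> 'w set \<Rightarrow> 'w set set" where
  "double_cosets G J = (\<lambda>w. (parabolic G J #>\<^bsub>G\<^esub> w) <#>\<^bsub>G\<^esub> parabolic G J) ` carrier G"

definition rminus :: "('w, 'b) monoid_scheme \<Rightarrow> 'w set \<Rightarrow> 'w set \<Rightarrow> 'w" where
  "rminus G S D = (THE w. w \<in> D \<and> (\<forall>v\<in>D. cox_len G S w \<le> cox_len G S v))"

definition rplus :: "('w, 'b) monoid_scheme \<Rightarrow> 'w set \<Rightarrow> 'w set \<Rightarrow> 'w" where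
  "rplus G S D = (THE w. w \<in> D \<and> (\<forall>v\<in>D. cox_len G S v \<le> cox_len G S w))"

definition dcoset_le :: "('w, 'b) monoid_scheme \<Rightarrow> 'w set \<Rightarrow> 'w set \<Rightarrow> 'w set \<Rightarrow> bool" where
  "dcoset_le G S D D' \<longleftrightarrow> bruhat_le G S (rminus G S D) (rminus G S D')"

definition dcoset_less :: "('w, 'b) monoid_scheme \<Rightarrow> 'w set \<Rightarrow> 'w set \<Rightarrow> 'w set \<Rightarrow> bool" where
  "dcoset_less G S D D' \<longleftrightarrow> dcoset_le G S D D' \<and> D \<noteq> D'"


section \<open>The coefficient ring\<close>

text \<open>Coefficients live in the fraction field of \<open>\<int>[q]\<close>.\<close>

type_synonym coeff = "int poly fract"

definition qv :: coeff where
  "qv = to_fract [:0, 1:]"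

definition parabolic_poincare :: "('w, 'b) monoid_scheme \<Rightarrow> 'w set \<Rightarrow> 'w set \<Rightarrow> coeff" where
  "parabolic_poincare G S J = (\<Sum>w\<in>parabolic G J. qv ^ (2 * cox_len G S w))"

definition coeff_ring :: "('w, 'b) monoid_scheme \<Rightarrow> 'w set \<Rightarrow> 'w set \<Rightarrow> coeff ring" where
  "coeff_ring G S J = ring_of_type_algebra
    \<lparr>carrier := generate_ring ring_of_type_algebra
       {qv, inverse qv, inverse (parabolic_poincare G S J)}\<rparr>"

text \<open>The subset \<open>q\<^sup>-\<^sup>1 \<int>[q\<^sup>-\<^sup>1]\<close>.\<close>

definition qinv_ideal :: "coeff set" where
  "qinv_ideal = (\<lambda>a. inverse qv * a) ` generate_ring ring_of_type_algebra {inverse qv}"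


section \<open>Hecke algebras\<close>

text \<open>The family \<open>(b i)\<^bsub>i \<in> I\<^esub>\<close> is an \<open>R\<close>-basis of \<open>M\<close>: every element is a unique finite
  \<open>R\<close>-linear combination. A family is automatically injective unless \<open>R\<close> is trivial, so this is
  the same as the set \<open>b ` I\<close>, indexed by \<open>I\<close>, being a basis.\<close>

definition is_basis ::
  "('r, 'x) ring_scheme \<Rightarrow> ('r, 'h, 'c) module_scheme \<Rightarrow> ('i \<Rightarrow> 'h) \<Rightarrow> 'i set \<Rightarrow> bool" where
  "is_basis R M b I \<longleftrightarrow> b \<in> I \<rightarrow> carrier M \<and>
    (\<forall>x\<in>carrier M. \<exists>!c. c \<in> I \<rightarrow>\<^sub>E carrier R \<and> finite {i \<in> I. c i \<noteq> \<zero>\<^bsub>R\<^esub>} \<and>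
      x = (\<Oplus>\<^bsub>M\<^esub>i\<in>{i \<in> I. c i \<noteq> \<zero>\<^bsub>R\<^esub>}. c i \<odot>\<^bsub>M\<^esub> b i))"

text \<open>The library locale \<open>algebra\<close> is restricted to commutative algebras.\<close>

locale assoc_algebra = module R M + ring M for R (structure) and M (structure) +
  assumes smult_mult_left:
      "\<lbrakk>a \<in> carrier R; x \<in> carrier M; y \<in> carrier M\<rbrakk> \<Longrightarrow>
        (a \<odot>\<^bsub>M\<^esub> x) \<otimes>\<^bsub>M\<^esub> y = a \<odot>\<^bsub>M\<^esub> (x \<otimes>\<^bsub>M\<^esub> y)"
    and smult_mult_right:
      "\<lbrakk>a \<in> carrier R; x \<in> carrier M; y \<in> carrier M\<rbrakk> \<Longrightarrow>
        x \<otimes>\<^bsub>M\<^esub> (a \<odot>\<^bsub>M\<^esub> y) = a \<odot>\<^bsub>M\<^esub> (x \<otimes>\<^bsub>M\<^esub> y)"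

locale hecke_algebra = assoc_algebra A H
  for A :: "coeff ring" and G :: "('w, 'b) monoid_scheme" and S :: "'w set"
    and H :: "(coeff, 'h, 'c) module_scheme" and T :: "'w \<Rightarrow> 'h" +
  assumes T_basis: "is_basis A H T (carrier G)"
    and T_mult_up: "\<lbrakk>s \<in> S; w \<in> carrier G; cox_len G S w < cox_len G S (s \<otimes>\<^bsub>G\<^esub> w)\<rbrakk> \<Longrightarrow>
      T s \<otimes>\<^bsub>H\<^esub> T w = T (s \<otimes>\<^bsub>G\<^esub> w)"
    and T_mult_down: "\<lbrakk>s \<in> S; w \<in> carrier G; cox_len G S (s \<otimes>\<^bsub>G\<^esub> w) < cox_len G S w\<rbrakk> \<Longrightarrow>
      T s \<otimes>\<^bsub>H\<^esub> T w = ((qv - inverse qv) \<odot>\<^bsub>H\<^esub> T w) \<oplus>\<^bsub>H\<^esub> T (s \<otimes>\<^bsub>G\<^esub> w)"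

definition bar_involution ::
  "'w set \<Rightarrow> (coeff, 'h, 'c) module_scheme \<Rightarrow> ('w \<Rightarrow> 'h) \<Rightarrow> ('h \<Rightarrow> 'h) \<Rightarrow> bool" where
  "bar_involution S H T bar \<longleftrightarrow> bar \<in> ring_iso H H \<and>
    bar (qv \<odot>\<^bsub>H\<^esub> \<one>\<^bsub>H\<^esub>) = inverse qv \<odot>\<^bsub>H\<^esub> \<one>\<^bsub>H\<^esub> \<and>
    (\<forall>s\<in>S. bar (T s) = inv\<^bsub>H\<^esub> (T s))"

text \<open>\<open>C\<close> is the Kazhdan--Lusztig basis, and \<open>p x w\<close> is the coefficient of \<open>T x\<close> in \<open>C w\<close>.\<close>

definition kazhdan_lusztig ::
  "coeff ring \<Rightarrow> ('w, 'b) monoid_scheme \<Rightarrow> 'w set \<Rightarrow> (coeff, 'h, 'c) module_scheme \<Rightarrow>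
   ('w \<Rightarrow> 'h) \<Rightarrow> ('h \<Rightarrow> 'h) \<Rightarrow> ('w \<Rightarrow> 'h) \<Rightarrow> ('w \<Rightarrow> 'w \<Rightarrow> coeff) \<Rightarrow> bool" where
  "kazhdan_lusztig A G S H T bar C p \<longleftrightarrow>
    is_basis A H C (carrier G) \<and>
    (\<forall>w\<in>carrier G. bar (C w) = C w \<and>
      C w = T w \<oplus>\<^bsub>H\<^esub> (\<Oplus>\<^bsub>H\<^esub>x\<in>{x. bruhat_less G S x w}. p x w \<odot>\<^bsub>H\<^esub> T x) \<and>
      (\<forall>x. bruhat_less G S x w \<longrightarrow> p x w \<in> qinv_ideal) \<and>
      p w w = 1 \<and>
      (\<forall>x\<in>carrier G. \<not> bruhat_le G S x w \<longrightarrow> p x w = 0))"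


section \<open>The parabolic Hecke algebra\<close>

definition parabolic_idem ::
  "('w, 'b) monoid_scheme \<Rightarrow> 'w set \<Rightarrow> 'w set \<Rightarrow> (coeff, 'h, 'c) module_scheme \<Rightarrow>
   ('w \<Rightarrow> 'h) \<Rightarrow> 'h" where
  "parabolic_idem G S J H T = inverse (parabolic_poincare G S J) \<odot>\<^bsub>H\<^esub>
    (\<Oplus>\<^bsub>H\<^esub>w\<in>parabolic G J. (qv ^ cox_len G S w) \<odot>\<^bsub>H\<^esub> T w)"

definition parabolic_hecke ::
  "('w, 'b) monoid_scheme \<Rightarrow> 'w set \<Rightarrow> 'w set \<Rightarrow> (coeff, 'h, 'c) module_scheme \<Rightarrow>
   ('w \<Rightarrow> 'h) \<Rightarrow> (coeff, 'h, 'c) module_scheme" where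
  "parabolic_hecke G S J H T = (let e = parabolic_idem G S J H T in
    H\<lparr>carrier := {e \<otimes>\<^bsub>H\<^esub> h \<otimes>\<^bsub>H\<^esub> e | h. h \<in> carrier H}, one := e\<rparr>)"

definition T_dcoset ::
  "('w, 'b) monoid_scheme \<Rightarrow> 'w set \<Rightarrow> (coeff, 'h, 'c) module_scheme \<Rightarrow> ('w \<Rightarrow> 'h) \<Rightarrow>
   'w set \<Rightarrow> 'h" where
  "T_dcoset G S H T D =
    (\<Oplus>\<^bsub>H\<^esub>w\<in>D. (qv powi (int (cox_len G S w) - int (cox_len G S (rplus G S D)))) \<odot>\<^bsub>H\<^esub> T w)"

end

theory Submission
  imports Defs
begin

text \<open>An element \<open>h\<close> fixed by the bar involution, with coefficients in \<open>\<int>[q, q\<^sup>-\<^sup>1]\<close>, has a bar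
  invariant coefficient at every longest element of its support, since \<open>bar (T\<^sub>w)\<close> is \<open>T\<^sub>w\<close> plus
  shorter terms; a bar invariant element of \<open>q\<^sup>-\<^sup>1 \<int>[q\<^sup>-\<^sup>1]\<close> vanishes. This gives the uniqueness
  statement and, applied to \<open>(T\<^sub>s - q) C\<^sub>w\<close> and \<open>C\<^sub>w (T\<^sub>s - q)\<close>, shows that these elements vanish
  when \<open>s\<close> is a left, respectively right, descent of \<open>w\<close>. The elements \<open>r\<^sup>+(D)\<close> are those
  with all of \<open>J\<close> as left and right descents, so \<open>C\<close> at \<open>r\<^sup>+(D)\<close> is a \<open>q\<close>-eigenvector of all
  \<open>T\<^sub>s\<close> with \<open>s \<in> J\<close> on both sides. These common eigenvectors form the parabolic Hecke algebra,
  and the eigenvector equations say that the coefficients on a double coset are proportional to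
  \<open>q\<close> to the power of the length.\<close>

section \<open>Reflections and the Bruhat order\<close>

text \<open>The only input about \<open>G\<close> is its presentation, so lengths and the Bruhat
  order have to be controlled from words: the parity with which a reflection occurs along a word is
  unchanged by relators, and this yields strong exchange and then the lifting property. Two orders
  must be reconciled. Double cosets are compared through their shortest elements, while the
  coefficients of \<open>C\<close> at a longest element are supported on the Bruhat interval below
  it. Lifting moves inequalities inside a coset and so connects the two. The map \<open>bar\<close>
  is given only as a ring automorphism of \<open>H\<close>, and the coefficient ring contains the
  inverse of \<open>parabolic_poincare\<close>. Semilinearity is therefore established for Laurent
  polynomials, through a relation between a coefficient and its image; that this relation is
  single-valued is read off from \<open>bar\<close> itself. The inverse of
  \<open>parabolic_poincare\<close> is what makes the idempotent act as the identity on the common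
  eigenvectors.\<close>

context coxeter_system
begin

abbreviation len :: "'a \<Rightarrow> nat" where "len \<equiv> cox_len G S"
abbreviation wprod :: "'a list \<Rightarrow> 'a" where "wprod \<equiv> word_prod G"

section \<open>Words in the generators and the length function\<close>

lemma S_carrier [simp]: "s \<in> S \<Longrightarrow> s \<in> carrier G"
  using gens_closed by blast

lemma lists_S_carrier: "ws \<in> lists S \<Longrightarrow> ws \<in> lists (carrier G)"
  using gens_closed by (meson lists_mono subsetD)

lemma wprod_Nil [simp]: "wprod [] = \<one>"
  and wprod_Cons [simp]: "wprod (s # ws) = s \<otimes> wprod ws"
  by (simp_all add: word_prod_def)

lemma wprod_carrier: "ws \<in> lists (carrier G) \<Longrightarrow> wprod ws \<in> carrier G"
  by (induction ws) auto

lemma wprod_closed [simp]: "ws \<in> lists S \<Longrightarrow> wprod ws \<in> carrier G"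
  by (simp add: lists_S_carrier wprod_carrier del: in_lists_conv_set)

lemma wprod_append:
  "us \<in> lists (carrier G) \<Longrightarrow> vs \<in> lists (carrier G) \<Longrightarrow> wprod (us @ vs) = wprod us \<otimes> wprod vs"
  by (induction us) (auto simp: wprod_carrier m_assoc simp del: in_lists_conv_set)

lemma wprod_append_S:
  "us \<in> lists S \<Longrightarrow> vs \<in> lists S \<Longrightarrow> wprod (us @ vs) = wprod us \<otimes> wprod vs"
  by (intro wprod_append lists_S_carrier)

text \<open>The locale asserts only that some Coxeter matrix presents the group; one choice is fixed
  so that the relators can be named.\<close>

definition cox_matrix :: "'a \<Rightarrow> 'a \<Rightarrow> nat" where
  "cox_matrix = (SOME m. coxeter_matrix m S \<and>
      (\<forall>us\<in>lists S. \<forall>vs\<in>lists S. wprod us = wprod vs \<longleftrightarrow> equivclp (coxeter_step m S) us vs))"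

lemma cox_matrix_coxeter: "coxeter_matrix cox_matrix S"
  and wprod_eq_iff: "us \<in> lists S \<Longrightarrow> vs \<in> lists S \<Longrightarrow>
    wprod us = wprod vs \<longleftrightarrow> equivclp (coxeter_step cox_matrix S) us vs"
  using someI_ex[OF presentation] unfolding cox_matrix_def by blast+

lemma step_lists:
  assumes "coxeter_step m S us vs" shows "us \<in> lists S \<and> vs \<in> lists S"
  using assms by cases (auto split: if_splits)

lemma wprod_braid:
  assumes "s \<in> S" "t \<in> S"
  shows "wprod (concat (replicate (cox_matrix s t) [s, t])) = \<one>"
proof -
  have "coxeter_step cox_matrix S ([] @ concat (replicate (cox_matrix s t) [s, t]) @ []) ([] @ [])"
    by (rule coxeter_step.intros) (use assms in auto)
  then have st: "coxeter_step cox_matrix S (concat (replicate (cox_matrix s t) [s, t])) []" by simp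
  then have "equivclp (coxeter_step cox_matrix S) (concat (replicate (cox_matrix s t) [s, t])) []"
    by (rule r_into_equivclp)
  with step_lists[OF st] show ?thesis
    using wprod_eq_iff by (metis wprod_Nil)
qed

lemma S_square [simp]: assumes "s \<in> S" shows "s \<otimes> s = \<one>"
proof -
  have "cox_matrix s s = 1" using cox_matrix_coxeter assms by (auto simp: coxeter_matrix_def)
  with wprod_braid[OF assms assms] assms show ?thesis by simp
qed

lemma S_inv [simp]: "s \<in> S \<Longrightarrow> inv s = s"
  by (simp add: inv_equality)

lemma S_cancel [simp]: "s \<in> S \<Longrightarrow> w \<in> carrier G \<Longrightarrow> s \<otimes> (s \<otimes> w) = w"
  by (simp flip: m_assoc)

lemma S_cancel_right [simp]: "s \<in> S \<Longrightarrow> w \<in> carrier G \<Longrightarrow> w \<otimes> s \<otimes> s = w"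
  by (simp add: m_assoc)

text \<open>Equality of products is the equivalence closure of deleting a relator, so a function on
  words that survives each deletion descends to the group. Length parity and the parity of
  reflections both descend this way.\<close>

lemma wprod_invariant:
  assumes step: "\<And>us vs. coxeter_step cox_matrix S us vs \<Longrightarrow> f us = f vs"
    and "us \<in> lists S" "vs \<in> lists S" "wprod us = wprod vs"
  shows "f us = f vs"
proof -
  have "equivclp (coxeter_step cox_matrix S) us vs" using assms wprod_eq_iff by blast
  then show ?thesis
    by (induction rule: equivclp_induct) (use step in metis)+
qed

lemma word_exists_sub:
  assumes "J \<subseteq> S" "w \<in> generate G J" shows "\<exists>ws\<in>lists J. wprod ws = w"
  using assms(2)
proof (induction rule: generate.induct)
  case one
  show ?case by (rule bexI[of _ "[]"]) auto
next
  case (incl h)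
  then show ?case using assms(1) by (intro bexI[of _ "[h]"]) (auto dest!: subsetD)
next
  case (inv h)
  then show ?case using assms(1) by (intro bexI[of _ "[h]"]) (auto dest!: subsetD)
next
  case (eng h1 h2)
  then obtain us vs where "us \<in> lists J" "vs \<in> lists J" "wprod us = h1" "wprod vs = h2" by blast
  moreover from this have "us \<in> lists S" "vs \<in> lists S" using assms(1) lists_mono by blast+
  ultimately show ?case
    by (intro bexI[of _ "us @ vs"]) (simp_all add: wprod_append_S del: in_lists_conv_set)
qed

lemma word_exists: "w \<in> carrier G \<Longrightarrow> \<exists>ws\<in>lists S. wprod ws = w"
  using word_exists_sub[of S] gens_generate by auto

lemma wprod_generate: "ws \<in> lists J \<Longrightarrow> J \<subseteq> S \<Longrightarrow> wprod ws \<in> generate G J"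
  by (induction ws) (auto intro: generate.intros)

lemma len_le: "ws \<in> lists S \<Longrightarrow> len (wprod ws) \<le> length ws"
  unfolding cox_len_def by (rule Least_le) blast

lemma reduced_word:
  assumes "w \<in> carrier G"
  obtains ws where "ws \<in> lists S" "wprod ws = w" "length ws = len w"
proof -
  have "\<exists>n. \<exists>ws\<in>lists S. length ws = n \<and> wprod ws = w" using word_exists[OF assms] by blast
  then have "\<exists>ws\<in>lists S. length ws = len w \<and> wprod ws = w"
    unfolding cox_len_def by (rule LeastI_ex)
  with that show ?thesis by blast
qed

text \<open>A relator consists of \<open>m s t\<close> copies of a two-letter word, so its length is
  even; this is the sign character of the group.\<close>

lemma len_parity: assumes "ws \<in> lists S" shows "even (len (wprod ws)) = even (length ws)"
proof -
  obtain vs where vs: "vs \<in> lists S" "wprod vs = wprod ws" "length vs = len (wprod ws)"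
    using reduced_word assms wprod_closed by blast
  have "even (length vs) = even (length ws)"
  proof (rule wprod_invariant[OF _ vs(1) assms vs(2)])
    fix us vs assume "coxeter_step cox_matrix S us vs"
    then show "even (length us) = even (length vs)"
      by cases (simp add: length_concat sum_list_replicate)
  qed
  with vs show ?thesis by simp
qed

text \<open>Length changes by at most one in either direction because \<open>s\<close> is an
  involution, and parity excludes that it stays the same.\<close>

lemma len_mult_left:
  assumes "s \<in> S" "w \<in> carrier G"
  shows "len (s \<otimes> w) = Suc (len w) \<or> Suc (len (s \<otimes> w)) = len w"
proof -
  have le: "len (s \<otimes> v) \<le> Suc (len v)" if v: "v \<in> carrier G" for v
  proof -
    obtain ws where "ws \<in> lists S" "wprod ws = v" "length ws = len v"
      using reduced_word[OF v] by blast
    with len_le[of "s # ws"] assms show ?thesis by auto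
  qed
  obtain ws where ws: "ws \<in> lists S" "wprod ws = w" using word_exists assms by blast
  then have "even (len (s \<otimes> w)) \<noteq> even (len w)"
    using len_parity[of ws] len_parity[of "s # ws"] assms by auto
  moreover have "len (s \<otimes> w) \<le> Suc (len w)" "len w \<le> Suc (len (s \<otimes> w))"
    using le[of w] le[of "s \<otimes> w"] assms by auto
  ultimately show ?thesis by (metis le_SucE le_antisym)
qed

lemma wprod_rev: "ws \<in> lists S \<Longrightarrow> wprod (rev ws) = inv (wprod ws)"
proof (induction ws)
  case (Cons s ws)
  then have "s \<in> S" "ws \<in> lists S" "rev ws \<in> lists S" "[s] \<in> lists S" by auto
  then show ?case
    using Cons.IH wprod_append_S[of "rev ws" "[s]"]
    by (simp add: inv_mult_group del: in_lists_conv_set)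
qed simp

lemma len_inv [simp]: assumes "w \<in> carrier G" shows "len (inv w) = len w"
proof -
  have "len (inv v) \<le> len v" if v: "v \<in> carrier G" for v
  proof -
    obtain ws where "ws \<in> lists S" "wprod ws = v" "length ws = len v"
      using reduced_word[OF v] by blast
    moreover from this have "rev ws \<in> lists S" by auto
    ultimately show ?thesis using len_le[of "rev ws"] wprod_rev[of ws] by simp
  qed
  from this[OF assms] this[of "inv w"] assms show ?thesis by simp
qed

lemma len_mult_right:
  assumes "s \<in> S" "w \<in> carrier G"
  shows "len (w \<otimes> s) = Suc (len w) \<or> Suc (len (w \<otimes> s)) = len w"
proof -
  have "inv (w \<otimes> s) = s \<otimes> inv w" using assms by (simp add: inv_mult_group)
  then have "len (w \<otimes> s) = len (s \<otimes> inv w)"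
    using len_inv[of "w \<otimes> s"] assms by simp
  then show ?thesis using len_mult_left[of s "inv w"] assms by simp
qed

lemma len_one [simp]: "len \<one> = 0"
  using len_le[of "[]"] by simp

lemma len_gen [simp]: assumes "s \<in> S" shows "len s = 1"
  using len_mult_left[of s \<one>] assms by simp

lemma len_mult_le:
  assumes "v \<in> carrier G" "w \<in> carrier G" shows "len (v \<otimes> w) \<le> len v + len w"
proof -
  obtain us where us: "us \<in> lists S" "wprod us = v" "length us = len v"
    using reduced_word[OF assms(1)] by blast
  obtain vs where vs: "vs \<in> lists S" "wprod vs = w" "length vs = len w"
    using reduced_word[OF assms(2)] by blast
  have "us @ vs \<in> lists S" using us vs by auto
  from len_le[OF this] show ?thesis using us vs wprod_append_S[OF us(1) vs(1)] by simp
qed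

lemma len_zero: "w \<in> carrier G \<Longrightarrow> len w = 0 \<Longrightarrow> w = \<one>"
  using reduced_word[of w] by (metis length_0_conv wprod_Nil)

lemma left_descent_exists:
  assumes "w \<in> carrier G" "w \<noteq> \<one>"
  obtains s v where "s \<in> S" "v \<in> carrier G" "w = s \<otimes> v" "len w = Suc (len v)"
proof -
  obtain ws where ws: "ws \<in> lists S" "wprod ws = w" "length ws = len w"
    using reduced_word[OF assms(1)] by blast
  with assms(2) obtain s vs where "ws = s # vs" by (cases ws) auto
  with ws have "s \<in> S" "wprod vs \<in> carrier G" "w = s \<otimes> wprod vs" "len (wprod vs) < len w"
    using len_le[of vs] by auto
  with len_mult_left[of s "wprod vs"] that show ?thesis by auto
qed

text \<open>The reflections \<open>t\<close> such that \<open>wprod ws \<otimes> t\<close> arises by deleting a letter of \<open>ws\<close>.\<close>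

primrec refl_list :: "'a list \<Rightarrow> 'a list" where
  "refl_list [] = []"
| "refl_list (s # ws) = (inv (wprod ws) \<otimes> s \<otimes> wprod ws) # refl_list ws"

lemma refl_list_closed: "ws \<in> lists S \<Longrightarrow> set (refl_list ws) \<subseteq> carrier G"
  by (induction ws) auto

lemma refl_list_append:
  assumes "us \<in> lists S" "vs \<in> lists S"
  shows "refl_list (us @ vs) =
    map (\<lambda>t. inv (wprod vs) \<otimes> t \<otimes> wprod vs) (refl_list us) @ refl_list vs"
  using assms
  by (induction us) (auto simp: wprod_append_S inv_mult_group m_assoc simp del: in_lists_conv_set)

lemma wprod_refl_list:
  assumes "ws \<in> lists S" "t \<in> set (refl_list ws)"
  shows "\<exists>vs\<in>lists (set ws). length vs < length ws \<and> wprod vs = wprod ws \<otimes> t"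
  using assms
proof (induction ws)
  case (Cons s ws)
  then have s: "s \<in> S" and ws: "ws \<in> lists S" by auto
  show ?case
  proof (cases "t = inv (wprod ws) \<otimes> s \<otimes> wprod ws")
    case True
    then have "wprod (s # ws) \<otimes> t = wprod ws"
      using s ws by (simp add: m_assoc flip: m_assoc[of "wprod ws" "inv (wprod ws)"])
    then show ?thesis by (intro bexI[of _ ws]) auto
  next
    case False
    then have t: "t \<in> set (refl_list ws)" using Cons.prems by auto
    then obtain vs where
      "vs \<in> lists (set ws)" "length vs < length ws" "wprod vs = wprod ws \<otimes> t"
      using Cons.IH ws by blast
    moreover have "t \<in> carrier G" using t refl_list_closed[OF ws] by blast
    ultimately show ?thesis using s ws by (intro bexI[of _ "s # vs"]) (auto simp: m_assoc)
  qed
qed simp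

section \<open>Reflections along braid words, inversion sets and strong exchange\<close>

lemma alt_shift:
  assumes "s \<in> carrier G" "t \<in> carrier G"
  shows "t \<otimes> (s \<otimes> t) [^] (n::nat) = (t \<otimes> s) [^] n \<otimes> t"
proof (induction n)
  case (Suc n)
  have "t \<otimes> (s \<otimes> t) [^] Suc n = t \<otimes> (s \<otimes> t) [^] n \<otimes> (s \<otimes> t)"
    using assms by (simp add: m_assoc)
  also have "\<dots> = (t \<otimes> s) [^] Suc n \<otimes> t"
    using assms unfolding Suc.IH by (simp add: m_assoc)
  finally show ?case .
qed (use assms in simp)

lemma wprod_alt:
  assumes "s \<in> S" "t \<in> S"
  shows "wprod (concat (replicate n [s, t])) = (s \<otimes> t) [^] n"
proof (induction n)
  case (Suc n)
  then show ?case
    using assms nat_pow_Suc2[of "s \<otimes> t" n] by (simp add: m_assoc)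
qed simp

lemma inv_alt:
  assumes "s \<in> S" "t \<in> S" shows "inv ((s \<otimes> t) [^] (n::nat)) = (t \<otimes> s) [^] n"
proof -
  have "inv ((s \<otimes> t) [^] n) = inv (s \<otimes> t) [^] n" using assms by (simp add: nat_pow_inv)
  then show ?thesis using assms by (simp add: inv_mult_group)
qed

text \<open>The suffixes of an alternating word and their inverses are alternating, so each
  conjugate collapses to an alternating word of odd length. The order is reversed because later
  letters have shorter suffixes.\<close>

lemma refl_list_alt:
  assumes s: "s \<in> S" and t: "t \<in> S"
  shows "refl_list (concat (replicate n [s, t])) = rev (map (\<lambda>k. (t \<otimes> s) [^] k \<otimes> t) [0..<2*n])"
proof (induction n)
  case (Suc n)
  define u where "u = (s \<otimes> t) [^] n"
  have c: "u \<in> carrier G" using s t by (simp add: u_def)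
  have iu: "inv u = (t \<otimes> s) [^] n"
    using s t by (simp add: u_def inv_alt)
  have tu: "t \<otimes> u = (t \<otimes> s) [^] n \<otimes> t" using alt_shift s t by (simp add: u_def)
  have A: "inv u \<otimes> t \<otimes> u = (t \<otimes> s) [^] (2*n) \<otimes> t"
  proof -
    have "inv u \<otimes> t \<otimes> u = (t \<otimes> s) [^] n \<otimes> ((t \<otimes> s) [^] n \<otimes> t)"
      using s t c by (simp add: iu tu m_assoc)
    then show ?thesis using s t by (simp add: mult_2 nat_pow_mult flip: m_assoc)
  qed
  have B: "inv (t \<otimes> u) \<otimes> s \<otimes> (t \<otimes> u) = (t \<otimes> s) [^] Suc (2*n) \<otimes> t"
  proof -
    have "inv (t \<otimes> u) = (t \<otimes> s) [^] n \<otimes> t"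
      using s t c by (simp add: inv_mult_group iu)
    then have "inv (t \<otimes> u) \<otimes> s \<otimes> (t \<otimes> u) = ((t \<otimes> s) [^] n \<otimes> (t \<otimes> s)) \<otimes> ((t \<otimes> s) [^] n \<otimes> t)"
      using s t c by (simp add: tu m_assoc)
    also have "\<dots> = (t \<otimes> s) [^] Suc n \<otimes> (t \<otimes> s) [^] n \<otimes> t"
      using s t by (simp add: m_assoc)
    also have "\<dots> = (t \<otimes> s) [^] (Suc n + n) \<otimes> t"
      using s t nat_pow_mult[of "t \<otimes> s" "Suc n" n] by (simp del: nat_pow_Suc)
    finally show ?thesis by (simp add: mult_2)
  qed
  have "refl_list (concat (replicate (Suc n) [s, t]))
      = (inv (t \<otimes> u) \<otimes> s \<otimes> (t \<otimes> u)) # (inv u \<otimes> t \<otimes> u) # refl_list (concat (replicate n [s, t]))"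
    using wprod_alt[OF s t, of n] by (simp add: u_def)
  then show ?case unfolding A B Suc.IH by simp
qed simp

text \<open>With \<open>m = cox_matrix s t\<close> and \<open>(t s)^m = 1\<close>, the
  \<open>2 m\<close> reflections \<open>(t s)^k t\<close> have period \<open>m\<close>. Hence each
  reflection occurs an even number of times along a relator.\<close>

lemma refl_list_braid:
  assumes s: "s \<in> S" and t: "t \<in> S"
  shows "\<exists>L. refl_list (concat (replicate (cox_matrix s t) [s, t])) = L @ L"
proof -
  define n where "n = cox_matrix s t"
  have "(s \<otimes> t) [^] n = \<one>" using wprod_braid[OF s t] wprod_alt[OF s t] by (simp add: n_def)
  then have one: "(t \<otimes> s) [^] n = \<one>" using inv_alt[OF s t, of n] by simp
  let ?f = "\<lambda>k. (t \<otimes> s) [^] k \<otimes> t"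
  have per: "?f (k + n) = ?f k" for k
    using s t one by (simp flip: nat_pow_mult)
  have "map ?f [0..<2*n] = map ?f [0..<n] @ map ?f [n..<n+n]"
    by (metis map_append upt_add_eq_append mult_2 le0)
  also have "[n..<n+n] = map (\<lambda>k. k + n) [0..<n]" by (simp add: map_add_upt)
  also have "map ?f \<dots> = map ?f [0..<n]" by (simp only: map_map o_def per)
  finally show ?thesis using refl_list_alt[OF s t, of n] by (auto simp: n_def)
qed

text \<open>The indicator of the right inversion set \<open>N(w)\<close>. Counting modulo two,
  rather than asking for membership in the list, is what makes the value independent of the chosen
  word.\<close>

definition odd_refl :: "'a \<Rightarrow> 'a \<Rightarrow> bool" where
  "odd_refl w t = odd (count_list (refl_list (SOME ws. ws \<in> lists S \<and> wprod ws = w)) t)"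

text \<open>A relator has product one, so the reflections of the letters before it are conjugated in
  the same way with or without it. Its own reflections form a conjugate of a list
  \<open>L @ L\<close> and contribute an even count.\<close>

lemma odd_refl_eq:
  assumes ws: "ws \<in> lists S"
  shows "odd_refl (wprod ws) t = odd (count_list (refl_list ws) t)"
proof -
  let ?v = "SOME vs. vs \<in> lists S \<and> wprod vs = wprod ws"
  have v: "?v \<in> lists S \<and> wprod ?v = wprod ws" by (rule someI[of _ ws]) (use ws in auto)
  have "odd (count_list (refl_list ?v) t) = odd (count_list (refl_list ws) t)"
  proof (rule wprod_invariant[where us = ?v and vs = ws])
    fix us vs assume "coxeter_step cox_matrix S us vs"
    then show "odd (count_list (refl_list us) t) = odd (count_list (refl_list vs) t)"
    proof cases
      case (1 a b us' vs')
      let ?R = "concat (replicate (cox_matrix a b) [a, b])"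
      have R: "?R \<in> lists S" using 1 by (auto split: if_splits)
      obtain L where L: "refl_list ?R = L @ L" using refl_list_braid 1 by blast
      have w: "wprod (?R @ vs') = wprod vs'"
        using wprod_append_S[OF R] wprod_braid 1 by simp
      have "?R @ vs' \<in> lists S" using R 1 by (simp del: in_lists_conv_set)
      then have "refl_list us = map (\<lambda>t. inv (wprod vs') \<otimes> t \<otimes> wprod vs') (refl_list us')
          @ map (\<lambda>t. inv (wprod vs') \<otimes> t \<otimes> wprod vs') (L @ L) @ refl_list vs'"
        using 1 R by (simp add: refl_list_append w L del: in_lists_conv_set)
      then show ?thesis using 1 
        by (auto simp: refl_list_append count_list_append simp del: in_lists_conv_set)
    qed
  qed (use v ws in auto)
  then show ?thesis by (simp add: odd_refl_def)
qed

text \<open>The cocycle rule: \<open>N(u v)\<close> is the symmetric difference of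
  \<open>inv v N(u) v\<close> and \<open>N(v)\<close>. On words, appending a second word conjugates
  the reflections of the first one.\<close>

lemma odd_refl_mult:
  assumes u: "u \<in> carrier G" and v: "v \<in> carrier G" and t: "t \<in> carrier G"
  shows "odd_refl (u \<otimes> v) t \<longleftrightarrow> (odd_refl u (v \<otimes> t \<otimes> inv v) \<noteq> odd_refl v t)"
proof -
  obtain us vs where us: "us \<in> lists S" "wprod us = u" and vs: "vs \<in> lists S" "wprod vs = v"
    using word_exists u v by metis
  have *: "count_list (map (\<lambda>t. inv v \<otimes> t \<otimes> v) xs) t = count_list xs (v \<otimes> t \<otimes> inv v)"
    if "set xs \<subseteq> carrier G" for xs
    using that
  proof (induction xs)
    case (Cons x xs)
    have "inv v \<otimes> x \<otimes> v = t \<longleftrightarrow> x = v \<otimes> t \<otimes> inv v"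
    proof
      assume "inv v \<otimes> x \<otimes> v = t"
      then have "v \<otimes> (inv v \<otimes> x \<otimes> v) \<otimes> inv v = v \<otimes> t \<otimes> inv v" by simp
      then show "x = v \<otimes> t \<otimes> inv v" using Cons.prems v by (simp add: m_assoc flip: m_assoc[of v "inv v"])
    next
      assume "x = v \<otimes> t \<otimes> inv v"
      then show "inv v \<otimes> x \<otimes> v = t" using v t by (simp add: m_assoc flip: m_assoc[of "inv v" v])
    qed
    with Cons show ?case by simp
  qed simp
  have "odd_refl (u \<otimes> v) t = odd (count_list (refl_list (us @ vs)) t)"
    using odd_refl_eq[of "us @ vs" t] us vs by (simp add: wprod_append_S del: in_lists_conv_set)
  also have "\<dots> = odd (count_list (refl_list us) (v \<otimes> t \<otimes> inv v) + count_list (refl_list vs) t)"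
    using us vs refl_list_closed[OF us(1)]
    by (simp add: refl_list_append count_list_append * del: in_lists_conv_set)
  finally show ?thesis using us vs odd_refl_eq by auto
qed

lemma reflectionE:
  assumes "t \<in> reflections G S"
  obtains g s where "g \<in> carrier G" "s \<in> S" "t = g \<otimes> s \<otimes> inv g"
  using assms by (auto simp: reflections_def)

lemma reflection_closed: "t \<in> reflections G S \<Longrightarrow> t \<in> carrier G"
  by (auto simp: reflections_def)

lemma reflection_conj:
  assumes "t \<in> reflections G S" "x \<in> carrier G"
  shows "x \<otimes> t \<otimes> inv x \<in> reflections G S"
proof -
  obtain g s where "g \<in> carrier G" "s \<in> S" "t = g \<otimes> s \<otimes> inv g" using assms reflectionE by blast
  then have "x \<otimes> t \<otimes> inv x = (x \<otimes> g) \<otimes> s \<otimes> inv (x \<otimes> g)" "x \<otimes> g \<in> carrier G"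
    using assms by (simp_all add: m_assoc inv_mult_group)
  with \<open>s \<in> S\<close> show ?thesis by (auto simp: reflections_def)
qed

lemma S_reflection: "s \<in> S \<Longrightarrow> s \<in> reflections G S"
  unfolding reflections_def by (rule CollectI, rule exI[of _ \<one>], rule exI[of _ s]) simp

lemma reflection_square:
  assumes "t \<in> reflections G S" shows "t \<otimes> t = \<one>"
proof -
  obtain g s where gs: "g \<in> carrier G" "s \<in> S" "t = g \<otimes> s \<otimes> inv g" using assms reflectionE by blast
  then have "t \<otimes> t = g \<otimes> (s \<otimes> (inv g \<otimes> g) \<otimes> (s \<otimes> inv g))"
    by (simp only: m_assoc m_closed inv_closed S_carrier)
  with gs show ?thesis by simp
qed

lemma odd_refl_one: "\<not> odd_refl \<one> t"
  using odd_refl_eq[of "[]"] by simp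

lemma odd_refl_gen: "s \<in> S \<Longrightarrow> odd_refl s t \<longleftrightarrow> t = s"
  using odd_refl_eq[of "[s]" t] by auto

text \<open>For \<open>t = g s (inv g)\<close> the cocycle rule gives three contributions. Those of
  \<open>g\<close> and \<open>inv g\<close> cancel because \<open>g (inv g) = 1\<close> has no
  inversions, and the middle letter \<open>s\<close> contributes one.\<close>

lemma odd_refl_self:
  assumes "t \<in> reflections G S" shows "odd_refl t t"
proof -
  obtain g s where gs: "g \<in> carrier G" "s \<in> S" "t = g \<otimes> s \<otimes> inv g" using assms reflectionE by blast
  have t: "t \<in> carrier G" using assms reflection_closed by blast
  have c: "inv g \<otimes> t \<otimes> inv (inv g) = s"
    using gs by (simp add: m_assoc flip: m_assoc[of "inv g" g])
  have "odd_refl t t \<longleftrightarrow> (odd_refl (g \<otimes> s) s \<noteq> odd_refl (inv g) t)"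
    using odd_refl_mult[of "g \<otimes> s" "inv g" t] gs t c by simp
  moreover have "odd_refl (g \<otimes> s) s \<longleftrightarrow> \<not> odd_refl g s"
    using odd_refl_mult[of g s s] gs by (simp add: odd_refl_gen)
  moreover have "\<not> (odd_refl g s \<noteq> odd_refl (inv g) t)"
    using odd_refl_mult[of g "inv g" t] gs(1) t c odd_refl_one[of t] by simp
  ultimately show ?thesis by blast
qed

text \<open>An odd count is positive, so \<open>t\<close> belongs to some letter, which can be
  deleted. The statement covers arbitrary words, reduced or not, and keeps track of the letters; the
  bound on lower Bruhat intervals relies on both.\<close>

lemma strong_exchange:
  assumes "ws \<in> lists S" "odd_refl (wprod ws) t"
  shows "\<exists>vs\<in>lists (set ws). length vs < length ws \<and> wprod vs = wprod ws \<otimes> t"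
proof -
  have "count_list (refl_list ws) t \<noteq> 0"
    using assms odd_refl_eq by (metis even_zero)
  then have "t \<in> set (refl_list ws)" by (simp add: count_list_0_iff)
  with assms(1) show ?thesis by (rule wprod_refl_list)
qed

lemma odd_refl_less:
  assumes "w \<in> carrier G" "odd_refl w t" shows "len (w \<otimes> t) < len w"
proof -
  obtain ws where ws: "ws \<in> lists S" "wprod ws = w" "length ws = len w"
    using reduced_word[OF assms(1)] by blast
  then obtain vs where "vs \<in> lists (set ws)" "length vs < length ws" "wprod vs = w \<otimes> t"
    using strong_exchange[OF ws(1)] assms by blast
  moreover from this ws have "vs \<in> lists S" by auto
  ultimately show ?thesis using len_le[of vs] ws by simp
qed

text \<open>If \<open>t\<close> is no inversion of \<open>w\<close>, then by the cocycle rule and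
  \<open>odd_refl_self\<close> it is one of \<open>w t\<close>, so multiplying \<open>w t\<close> by
  \<open>t\<close> again shortens it to \<open>w\<close>.\<close>

lemma odd_refl_iff:
  assumes w: "w \<in> carrier G" and t: "t \<in> reflections G S"
  shows "len (w \<otimes> t) < len w \<longleftrightarrow> odd_refl w t"
proof -
  have tc: "t \<in> carrier G" using t reflection_closed by blast
  have tt: "t \<otimes> t = \<one>" using reflection_square t by blast
  then have ti: "inv t = t" using tc by (simp add: inv_equality)
  have "len w < len (w \<otimes> t)" if "\<not> odd_refl w t"
  proof -
    have "t \<otimes> t \<otimes> inv t = t" using tc by (simp add: ti tt)
    then have "odd_refl (w \<otimes> t) t"
      using odd_refl_mult[OF w tc tc] odd_refl_self[OF t] that by simp
    then have "len (w \<otimes> t \<otimes> t) < len (w \<otimes> t)" using w tc odd_refl_less by simp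
    then show ?thesis using w tc tt by (simp add: m_assoc)
  qed
  with odd_refl_less[OF w] show ?thesis by fastforce
qed

text \<open>The cocycle rule makes \<open>t\<close> an inversion of exactly one of \<open>w\<close>
  and \<open>w t\<close>; equal lengths would make it an inversion of neither.\<close>

lemma len_refl_neq:
  assumes w: "w \<in> carrier G" and t: "t \<in> reflections G S"
  shows "len (w \<otimes> t) \<noteq> len w"
proof
  assume eq: "len (w \<otimes> t) = len w"
  have tc: "t \<in> carrier G" using t reflection_closed by blast
  have tt: "t \<otimes> t = \<one>" using reflection_square t by blast
  have "\<not> odd_refl w t" using eq odd_refl_iff[OF w t] by simp
  moreover have "\<not> odd_refl (w \<otimes> t) t"
    using eq odd_refl_iff[of "w \<otimes> t" t] w t tc tt by (simp add: m_assoc)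
  moreover have "inv t = t" using tc tt by (simp add: inv_equality)
  ultimately show False using odd_refl_mult[OF w tc tc] odd_refl_self[OF t] tc by (simp add: tt)
qed

section \<open>The Bruhat order: lifting and finite lower intervals\<close>

abbreviation bstep where "bstep \<equiv> bruhat_step G S"
abbreviation ble where "ble \<equiv> bruhat_le G S"

lemma bstep_closed: "bstep x y \<Longrightarrow> x \<in> carrier G \<and> y \<in> carrier G"
  by (auto simp: bruhat_step_def reflection_closed)

text \<open>Left multiplication by \<open>s\<close> changes the inversion set of \<open>x\<close>
  only at \<open>inv x s x\<close>. If \<open>t\<close> is this reflection, the step degenerates to
  \<open>y = s x\<close>; otherwise \<open>t\<close> still lengthens \<open>s x\<close>.\<close>

lemma bstep_left:
  assumes "bstep x y" "s \<in> S" shows "s \<otimes> x = y \<or> bstep (s \<otimes> x) (s \<otimes> y)"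
proof -
  obtain t where x: "x \<in> carrier G" and lt: "len x < len y"
    and t: "t \<in> reflections G S" and y: "y = x \<otimes> t"
    using assms by (auto simp: bruhat_step_def)
  have tc: "t \<in> carrier G" using t reflection_closed by blast
  have n: "\<not> odd_refl x t" using lt odd_refl_iff[OF x t] y by simp
  show ?thesis
  proof (cases "x \<otimes> t \<otimes> inv x = s")
    case True
    then have "s \<otimes> x = x \<otimes> t \<otimes> inv x \<otimes> x" by simp
    also have "\<dots> = y" using x tc y by (simp add: m_assoc)
    finally show ?thesis by simp
  next
    case False
    then have "\<not> odd_refl (s \<otimes> x) t"
      using odd_refl_mult[of s x t] n x tc assms(2) by (simp add: odd_refl_gen)
    then have "\<not> len (s \<otimes> x \<otimes> t) < len (s \<otimes> x)"
      using odd_refl_iff[of "s \<otimes> x" t] x assms t by simp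
    with len_refl_neq[of "s \<otimes> x" t] have "len (s \<otimes> x) < len (s \<otimes> x \<otimes> t)"
      using x t assms by fastforce
    moreover have "s \<otimes> x \<otimes> t = s \<otimes> y" using x tc assms y by (simp add: m_assoc)
    ultimately have "bstep (s \<otimes> x) (s \<otimes> y)"
      using x t assms unfolding bruhat_step_def by (metis m_closed S_carrier)
    then show ?thesis ..
  qed
qed

lemma bstep_gen:
  assumes "x \<in> carrier G" "s \<in> S" "len x < len (s \<otimes> x)" shows "bstep x (s \<otimes> x)"
proof -
  have "inv x \<otimes> s \<otimes> inv (inv x) \<in> reflections G S"
    using S_reflection reflection_conj assms inv_closed by blast
  moreover have "s \<otimes> x = x \<otimes> (inv x \<otimes> s \<otimes> inv (inv x))"
    using assms by (simp add: m_assoc flip: m_assoc[of x "inv x"])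
  ultimately show ?thesis using assms unfolding bruhat_step_def by blast
qed

lemma bstep_inv: assumes "bstep x y" shows "bstep (inv x) (inv y)"
proof -
  obtain t where x: "x \<in> carrier G" and lt: "len x < len y"
    and t: "t \<in> reflections G S" and y: "y = x \<otimes> t"
    using assms by (auto simp: bruhat_step_def)
  have tc: "t \<in> carrier G" using t reflection_closed by blast
  have "inv t = t" using tc reflection_square[OF t] by (simp add: inv_equality)
  then have "inv y = inv x \<otimes> (x \<otimes> t \<otimes> inv x)"
    using x tc y by (simp add: inv_mult_group m_assoc flip: m_assoc[of "inv x" x])
  moreover have "len (inv x) < len (inv y)" using lt x y tc by simp
  ultimately show ?thesis using x t reflection_conj unfolding bruhat_step_def by blast
qed

lemma ble_refl: "x \<in> carrier G \<Longrightarrow> ble x x"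
  by (simp add: bruhat_le_def)

lemma ble_trans: "ble x y \<Longrightarrow> ble y z \<Longrightarrow> ble x z"
  by (auto simp: bruhat_le_def)

lemma ble_closed: "ble x y \<Longrightarrow> x \<in> carrier G \<and> y \<in> carrier G"
  by (simp add: bruhat_le_def)

lemma bstep_ble: "bstep x y \<Longrightarrow> ble x y"
  using bstep_closed by (auto simp: bruhat_le_def)

lemma ble_inv: assumes "ble x y" shows "ble (inv x) (inv y)"
proof -
  have "(bstep)\<^sup>*\<^sup>* x y" using assms by (simp add: bruhat_le_def)
  then have "(bstep)\<^sup>*\<^sup>* (inv x) (inv y)"
    by (induction) (auto dest: bstep_inv)
  with assms show ?thesis by (simp add: bruhat_le_def)
qed

lemma ble_len: assumes "ble x y" shows "x = y \<or> len x < len y"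
proof -
  have "(bstep)\<^sup>*\<^sup>* x y" using assms by (simp add: bruhat_le_def)
  then show ?thesis by induction (auto simp: bruhat_step_def)
qed

lemma ble_antisym: "ble x y \<Longrightarrow> ble y x \<Longrightarrow> x = y"
  using ble_len[of x y] ble_len[of y x] by auto

text \<open>Multiply a chain from \<open>x\<close> to \<open>y\<close> by \<open>s\<close>. Either
  every step survives, or at a collapsing step the multiplied chain meets the original one and
  follows it to \<open>y\<close>.\<close>

lemma ble_lift_up:
  assumes "ble x y" "s \<in> S" shows "ble (s \<otimes> x) (s \<otimes> y) \<or> ble (s \<otimes> x) y"
proof -
  have x: "x \<in> carrier G" using assms ble_closed by blast
  have "(bstep)\<^sup>*\<^sup>* x y" using assms by (simp add: bruhat_le_def)
  then show ?thesis
  proof induction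
    case base
    then show ?case using x assms by (simp add: ble_refl)
  next
    case (step y z)
    then show ?case using bstep_left[OF step.hyps(2) assms(2)] bstep_ble ble_trans by metis
  qed
qed

text \<open>Here a collapsing step lets the original chain starting at \<open>x\<close> pass over to
  the multiplied one, which ends in \<open>s y\<close>.\<close>

lemma ble_lift_down:
  assumes "ble x y" "s \<in> S" shows "ble x (s \<otimes> y) \<or> ble (s \<otimes> x) (s \<otimes> y)"
proof -
  have y: "y \<in> carrier G" using assms ble_closed by blast
  have "(bstep)\<^sup>*\<^sup>* x y" using assms by (simp add: bruhat_le_def)
  then show ?thesis
  proof (induction rule: converse_rtranclp_induct)
    case base
    then show ?case using y assms by (simp add: ble_refl)
  next
    case (step x z)
    have "x = s \<otimes> z" if "s \<otimes> x = z" using that bstep_closed[OF step.hyps(1)] assms(2) by auto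
    then show ?case
      using step bstep_left[OF step.hyps(1) assms(2)] bstep_ble ble_trans by metis
  qed
qed

text \<open>Both outcomes of \<open>ble_lift_up\<close> end below \<open>w\<close> since
  \<open>s w\<close> lies below \<open>w\<close>. Thus the lower interval of \<open>w\<close> is
  stable under its left descents.\<close>

lemma ble_left_max:
  assumes "ble x w" "s \<in> S" "len (s \<otimes> w) < len w" shows "ble (s \<otimes> x) w"
proof -
  have "bstep (s \<otimes> w) w" using bstep_gen[of "s \<otimes> w" s] assms ble_closed by auto
  then show ?thesis using ble_lift_up[OF assms(1,2)] bstep_ble ble_trans by blast
qed

lemma ble_left_min:
  assumes "ble x w" "s \<in> S" "len x < len (s \<otimes> x)" shows "ble x (s \<otimes> w)"
proof -
  have "bstep x (s \<otimes> x)" using bstep_gen assms ble_closed by blast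
  then show ?thesis using ble_lift_down[OF assms(1,2)] bstep_ble ble_trans by blast
qed

lemma ble_right_max:
  assumes "ble x w" "s \<in> S" "len (w \<otimes> s) < len w" shows "ble (x \<otimes> s) w"
proof -
  have c: "x \<in> carrier G" "w \<in> carrier G" using assms ble_closed by auto
  have i: "inv (v \<otimes> s) = s \<otimes> inv v" if "v \<in> carrier G" for v
    using that assms by (simp add: inv_mult_group)
  have "len (s \<otimes> inv w) < len (inv w)" using assms c by (metis i len_inv m_closed S_carrier)
  then have "ble (s \<otimes> inv x) (inv w)" using ble_left_max ble_inv assms by blast
  then show ?thesis using ble_inv c assms(2) by (metis i inv_inv m_closed S_carrier)
qed

lemma ble_right_min:
  assumes "ble x w" "s \<in> S" "len x < len (x \<otimes> s)" shows "ble x (w \<otimes> s)"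
proof -
  have c: "x \<in> carrier G" "w \<in> carrier G" using assms ble_closed by auto
  have i: "inv (v \<otimes> s) = s \<otimes> inv v" if "v \<in> carrier G" for v
    using that assms by (simp add: inv_mult_group)
  have "len (inv x) < len (s \<otimes> inv x)" using assms c by (metis i len_inv m_closed S_carrier)
  then have "ble (inv x) (s \<otimes> inv w)" using ble_left_min ble_inv assms by blast
  then show ?thesis using ble_inv c assms(2) by (metis i inv_inv m_closed S_carrier)
qed

text \<open>Since \<open>S\<close> may be infinite, bounded length alone does not give finiteness.
  Instead, strong exchange is applied down a chain starting from one fixed word for
  \<open>w\<close>: every element below \<open>w\<close> is a product of at most as many letters,
  all taken from that word.\<close>

lemma finite_ble: assumes "w \<in> carrier G" shows "finite {x. ble x w}"
proof -
  obtain ws where ws: "ws \<in> lists S" "wprod ws = w" using word_exists assms by blast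
  let ?L = "{vs. set vs \<subseteq> set ws \<and> length vs \<le> length ws}"
  have "\<exists>vs\<in>?L. wprod vs = x" if "ble x w" for x
  proof -
    have "(bstep)\<^sup>*\<^sup>* x w" using that by (simp add: bruhat_le_def)
    then show ?thesis
    proof (induction rule: converse_rtranclp_induct)
      case base
      then show ?case using ws by auto
    next
      case (step x y)
      then obtain vs where vs: "set vs \<subseteq> set ws" "length vs \<le> length ws" "wprod vs = y" by auto
      from step.hyps(1) obtain t where x: "x \<in> carrier G" and lt: "len x < len y"
        and t: "t \<in> reflections G S" and y: "y = x \<otimes> t"
        by (auto simp: bruhat_step_def)
      have tc: "t \<in> carrier G" using t reflection_closed by blast
      have yt: "y \<otimes> t = x" using y x tc reflection_square[OF t] by (simp add: m_assoc)
      have "vs \<in> lists S" using vs ws by auto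
      moreover have "odd_refl (wprod vs) t"
        using odd_refl_iff[of y t] x tc t y yt lt vs(3) by simp
      ultimately obtain us where "us \<in> lists (set vs)" "length us < length vs" "wprod us = x"
        using strong_exchange[of vs t] vs yt by auto
      then show ?case using vs by (intro bexI[of _ us]) auto
    qed
  qed
  then have "{x. ble x w} \<subseteq> wprod ` ?L" by blast
  moreover have "finite ?L" using finite_lists_length_le[of "set ws" "length ws"] by simp
  ultimately show ?thesis by (meson finite_surj)
qed

end


section \<open>Parabolic double cosets\<close>

locale parabolic_coxeter = coxeter_system +
  fixes J
  assumes J_sub: "J \<subseteq> S" and J_nonempty: "J \<noteq> {}" and finite_parabolic: "finite (parabolic G J)"
begin

abbreviation WJ where "WJ \<equiv> parabolic G J"
abbreviation DC where "DC \<equiv> double_cosets G J"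
abbreviation rm where "rm \<equiv> rminus G S"
abbreviation rp where "rp \<equiv> rplus G S"

lemma J_S [simp]: "s \<in> J \<Longrightarrow> s \<in> S"
  using J_sub by blast

lemma subgroup_WJ: "subgroup WJ G"
  by (rule generate_is_subgroup) (rule subset_trans[OF J_sub gens_closed])

lemma J_WJ: "s \<in> J \<Longrightarrow> s \<in> WJ"
  by (rule generate.incl)

lemma WJ_carrier: "a \<in> WJ \<Longrightarrow> a \<in> carrier G"
  by (rule subgroup.mem_carrier[OF subgroup_WJ])

definition dcos :: "'a \<Rightarrow> 'a set" where
  "dcos w = (WJ #> w) <#> WJ"

lemma mem_dcos: "y \<in> dcos w \<longleftrightarrow> (\<exists>a\<in>WJ. \<exists>b\<in>WJ. y = a \<otimes> w \<otimes> b)"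
  unfolding dcos_def set_mult_def r_coset_def by auto

lemma DC_eq: "DC = dcos ` carrier G"
  by (simp add: double_cosets_def dcos_def)

lemma mem_dcos_self: "w \<in> carrier G \<Longrightarrow> w \<in> dcos w"
  unfolding mem_dcos using subgroup.one_closed[OF subgroup_WJ] by force

lemma dcos_eqI:
  assumes w: "w \<in> carrier G" and x: "x \<in> dcos w" shows "dcos x = dcos w"
proof -
  obtain a b where ab: "a \<in> WJ" "b \<in> WJ" "x = a \<otimes> w \<otimes> b" using x mem_dcos by blast
  note cl = subgroup.m_closed[OF subgroup_WJ] subgroup.m_inv_closed[OF subgroup_WJ]
  note c = ab(1,2)[THEN WJ_carrier] w
  have "y \<in> dcos w" if "y \<in> dcos x" for y
  proof -
    obtain a' b' where "a' \<in> WJ" "b' \<in> WJ" "y = a' \<otimes> x \<otimes> b'" using \<open>y \<in> dcos x\<close> mem_dcos by blast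
    then have "y = (a' \<otimes> a) \<otimes> w \<otimes> (b \<otimes> b')" "a' \<otimes> a \<in> WJ" "b \<otimes> b' \<in> WJ"
      using ab c by (auto simp: m_assoc WJ_carrier cl)
    then show ?thesis using mem_dcos by blast
  qed
  moreover have "y \<in> dcos x" if "y \<in> dcos w" for y
  proof -
    obtain a' b' where y: "a' \<in> WJ" "b' \<in> WJ" "y = a' \<otimes> w \<otimes> b'" using \<open>y \<in> dcos w\<close> mem_dcos by blast
    have "inv a \<otimes> x \<otimes> inv b = w"
      using ab c by (simp add: m_assoc flip: m_assoc[of "inv a" a])
    moreover have "x \<in> carrier G" using ab c by simp
    ultimately have "y = (a' \<otimes> inv a) \<otimes> x \<otimes> (inv b \<otimes> b')"
      using y c WJ_carrier[of a'] WJ_carrier[of b']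
      by (metis inv_closed m_assoc m_closed)
    moreover have "a' \<otimes> inv a \<in> WJ" "inv b \<otimes> b' \<in> WJ" using y ab by (auto simp: cl)
    ultimately show ?thesis using mem_dcos by blast
  qed
  ultimately show ?thesis by blast
qed

lemma DC_mem_eq: "D \<in> DC \<Longrightarrow> x \<in> D \<Longrightarrow> D = dcos x"
  using dcos_eqI unfolding DC_eq by blast

lemma DC_carrier: "D \<in> DC \<Longrightarrow> x \<in> D \<Longrightarrow> x \<in> carrier G"
  unfolding DC_eq by (auto simp: mem_dcos WJ_carrier)

lemma DC_disjoint: "D \<in> DC \<Longrightarrow> D' \<in> DC \<Longrightarrow> x \<in> D \<Longrightarrow> x \<in> D' \<Longrightarrow> D = D'"
  by (metis DC_mem_eq[of D x] DC_mem_eq[of D' x])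

lemma DC_nonempty: "D \<in> DC \<Longrightarrow> D \<noteq> {}"
  using mem_dcos_self unfolding DC_eq by blast

lemma dcos_DC: "w \<in> carrier G \<Longrightarrow> dcos w \<in> DC"
  unfolding DC_eq by blast

lemma DC_finite: assumes "D \<in> DC" shows "finite D"
proof -
  obtain w where "D = dcos w" using assms DC_eq by blast
  then have "D \<subseteq> (\<lambda>(a, b). a \<otimes> w \<otimes> b) ` (WJ \<times> WJ)" by (auto simp: mem_dcos)
  moreover have "finite (WJ \<times> WJ)" using finite_parabolic by simp
  ultimately show ?thesis by (rule finite_surj[rotated])
qed

lemma DC_left: assumes "D \<in> DC" "x \<in> D" "s \<in> J" shows "s \<otimes> x \<in> D"
proof -
  have "s \<otimes> x = s \<otimes> x \<otimes> \<one>" using assms DC_carrier by simp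
  then have "s \<otimes> x \<in> dcos x"
    unfolding mem_dcos using J_WJ assms subgroup.one_closed[OF subgroup_WJ] by blast
  then show ?thesis using DC_mem_eq assms by simp
qed

lemma DC_right: assumes "D \<in> DC" "x \<in> D" "s \<in> J" shows "x \<otimes> s \<in> D"
proof -
  have "x \<otimes> s = \<one> \<otimes> x \<otimes> s" using assms DC_carrier by simp
  then have "x \<otimes> s \<in> dcos x"
    unfolding mem_dcos using J_WJ assms subgroup.one_closed[OF subgroup_WJ] by blast
  then show ?thesis using DC_mem_eq assms by simp
qed

text \<open>Elements of one double coset differ by words in \<open>J\<close> on the two sides, so a
  property can be propagated one letter at a time.\<close>

lemma DC_induct [consumes 3, case_names base left right]:
  assumes D: "D \<in> DC" and x: "x \<in> D" and y: "y \<in> D" and base: "P x"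
    and left: "\<And>z s. z \<in> D \<Longrightarrow> s \<in> J \<Longrightarrow> P z \<Longrightarrow> P (s \<otimes> z)"
    and right: "\<And>z s. z \<in> D \<Longrightarrow> s \<in> J \<Longrightarrow> P z \<Longrightarrow> P (z \<otimes> s)"
  shows "P y"
proof -
  obtain a b where ab: "a \<in> WJ" "b \<in> WJ" "y = a \<otimes> x \<otimes> b"
    using y DC_mem_eq[OF D x] mem_dcos by blast
  obtain us vs where us: "us \<in> lists J" "wprod us = a" and vs: "vs \<in> lists J" "wprod vs = b"
    using word_exists_sub[OF J_sub] ab by metis
  have xc: "x \<in> carrier G" using DC_carrier D x by blast
  have J_lists: "ws \<in> lists J \<Longrightarrow> wprod ws \<in> carrier G" for ws
    using wprod_generate[OF _ J_sub] WJ_carrier by blast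
  have 1: "wprod us \<otimes> x \<in> D \<and> P (wprod us \<otimes> x)"
    using us(1)
  proof (induction us)
    case (Cons s us)
    then have "s \<in> J" "us \<in> lists J" by auto
    then have "wprod (s # us) \<otimes> x = s \<otimes> (wprod us \<otimes> x)" using xc J_lists by (simp add: m_assoc)
    with Cons \<open>s \<in> J\<close> \<open>us \<in> lists J\<close> show ?case using left DC_left[OF D] by simp
  qed (use xc x base in simp)
  have "z \<otimes> wprod vs \<in> D \<and> P (z \<otimes> wprod vs)" if "z \<in> D" "P z" for z
    using vs(1) that
  proof (induction vs arbitrary: z)
    case Nil
    then show ?case using DC_carrier[OF D] by simp
  next
    case (Cons s vs)
    then have s: "s \<in> J" "vs \<in> lists J" by auto
    then have "z \<otimes> wprod (s # vs) = (z \<otimes> s) \<otimes> wprod vs"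
      using DC_carrier[OF D] Cons.prems J_lists by (simp add: m_assoc)
    with Cons s show ?case using right DC_right[OF D] by simp
  qed
  with 1 us vs ab show ?thesis by blast
qed

text \<open>Extremality is required only against neighbours by a single letter of \<open>J\<close>;
  lifting turns it into extremality in the Bruhat order over a whole double coset.\<close>

definition J_min :: "'a \<Rightarrow> bool" where
  "J_min x \<longleftrightarrow> (\<forall>s\<in>J. len x < len (s \<otimes> x) \<and> len x < len (x \<otimes> s))"

definition J_max :: "'a \<Rightarrow> bool" where
  "J_max x \<longleftrightarrow> (\<forall>s\<in>J. len (s \<otimes> x) < len x \<and> len (x \<otimes> s) < len x)"

text \<open>By lifting, the elements above \<open>x\<close> are closed under multiplication by
  \<open>J\<close> on either side. That \<open>x\<close> may lie outside \<open>D\<close> is what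
  permits comparing different double cosets.\<close>

lemma J_min_ble:
  assumes "J_min x" "ble x y" "D \<in> DC" "y \<in> D" "z \<in> D" shows "ble x z"
  using assms(3-5)
proof (induction rule: DC_induct)
  case base
  then show ?case by (rule assms(2))
next
  case (left z s)
  then show ?case using ble_left_min assms(1) by (simp add: J_min_def)
next
  case (right z s)
  then show ?case using ble_right_min assms(1) by (simp add: J_min_def)
qed

text \<open>Every letter of \<open>J\<close> is a descent of \<open>w\<close> on both sides, so the
  lower interval of \<open>w\<close> is closed under multiplication by \<open>J\<close>.\<close>

lemma J_max_ble:
  assumes "J_max w" "D \<in> DC" "w \<in> D" "x \<in> D" shows "ble x w"
  using assms(2-4)
proof (induction rule: DC_induct)
  case base
  then show ?case using assms DC_carrier ble_refl by blast
next
  case (left z s)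
  then show ?case using ble_left_max assms(1) by (simp add: J_max_def)
next
  case (right z s)
  then show ?case using ble_right_max assms(1) by (simp add: J_max_def)
qed

lemma shortest_J_min:
  assumes D: "D \<in> DC" and x: "x \<in> D" and min: "\<forall>v\<in>D. len x \<le> len v"
  shows "J_min x"
  unfolding J_min_def
proof
  fix s assume s: "s \<in> J"
  have xc: "x \<in> carrier G" using D x DC_carrier by blast
  have "len x \<le> len (s \<otimes> x)" "len x \<le> len (x \<otimes> s)"
    using min DC_left[OF D x s] DC_right[OF D x s] by auto
  then show "len x < len (s \<otimes> x) \<and> len x < len (x \<otimes> s)"
    using len_mult_left[of s x] len_mult_right[of s x] s xc by fastforce
qed

lemma longest_J_max:
  assumes D: "D \<in> DC" and x: "x \<in> D" and max: "\<forall>v\<in>D. len v \<le> len x"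
  shows "J_max x"
  unfolding J_max_def
proof
  fix s assume s: "s \<in> J"
  have xc: "x \<in> carrier G" using D x DC_carrier by blast
  have "len (s \<otimes> x) \<le> len x" "len (x \<otimes> s) \<le> len x"
    using max DC_left[OF D x s] DC_right[OF D x s] by auto
  then show "len (s \<otimes> x) < len x \<and> len (x \<otimes> s) < len x"
    using len_mult_left[of s x] len_mult_right[of s x] s xc by fastforce
qed

text \<open>The definite description in \<open>rminus\<close> requires uniqueness: a shortest
  element lies below every element of \<open>D\<close>, and Bruhat comparable elements of equal
  length coincide.\<close>

lemma rminus_J_min:
  assumes D: "D \<in> DC" shows "rm D \<in> D" and "J_min (rm D)"
proof -
  let ?P = "\<lambda>w. w \<in> D \<and> (\<forall>v\<in>D. len w \<le> len v)"
  have "\<exists>w. ?P w"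
    using ex_has_least_nat[of "\<lambda>w. w \<in> D" _ len] DC_nonempty[OF D] by blast
  then obtain w where w: "?P w" by blast
  have "x = w" if "?P x" for x
  proof -
    have "ble x w"
      using J_min_ble[of x x D w] shortest_J_min[OF D] that w D DC_carrier ble_refl by blast
    moreover have "len w \<le> len x" using w that by blast
    ultimately show ?thesis using ble_len by fastforce
  qed
  with w have "?P (rm D)" unfolding rminus_def by (rule theI)
  with shortest_J_min[OF D] show "rm D \<in> D" "J_min (rm D)" by blast+
qed

lemma rplus_J_max:
  assumes D: "D \<in> DC" shows "rp D \<in> D" and "J_max (rp D)"
proof -
  let ?P = "\<lambda>w. w \<in> D \<and> (\<forall>v\<in>D. len v \<le> len w)"
  have "Max (len ` D) \<in> len ` D" by (rule Max_in) (use DC_finite[OF D] DC_nonempty[OF D] in auto)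
  then obtain w where "w \<in> D" "len w = Max (len ` D)" by auto
  then have w: "?P w" using DC_finite[OF D] by simp
  have "x = w" if "?P x" for x
  proof -
    have "ble x w" using J_max_ble[OF longest_J_max[OF D] D] w that by blast
    moreover have "len w \<le> len x" using w that by blast
    ultimately show ?thesis using ble_len by fastforce
  qed
  with w have "?P (rp D)" unfolding rplus_def by (rule theI)
  with longest_J_max[OF D] show "rp D \<in> D" "J_max (rp D)" by blast+
qed

lemma rp_carrier: "D \<in> DC \<Longrightarrow> rp D \<in> carrier G"
  using rplus_J_max(1) DC_carrier by blast

lemma ble_rp: "D \<in> DC \<Longrightarrow> x \<in> D \<Longrightarrow> ble x (rp D)"
  using J_max_ble rplus_J_max by blast

lemma J_max_eq_rp: "D \<in> DC \<Longrightarrow> w \<in> D \<Longrightarrow> J_max w \<Longrightarrow> w = rp D"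
  using ble_antisym[OF J_max_ble[of w D "rp D"] ble_rp[of D w]] rplus_J_max(1)[of D] by simp

lemma rp_inj: "D \<in> DC \<Longrightarrow> D' \<in> DC \<Longrightarrow> rp D = rp D' \<Longrightarrow> D = D'"
  using DC_disjoint[of D D' "rp D"] rplus_J_max(1)[of D] rplus_J_max(1)[of D'] by simp

text \<open>The bridge between the two orders: \<open>rm D'\<close> lies below \<open>x\<close>,
  hence below \<open>rp D\<close>, and being \<open>J_min\<close> it stays below when
  \<open>rp D\<close> is replaced by \<open>rm D\<close> in the same coset.\<close>

lemma ble_rp_dcoset_le:
  assumes "D \<in> DC" "D' \<in> DC" "x \<in> D'" "ble x (rp D)"
  shows "dcoset_le G S D' D"
proof -
  have r: "rm D' \<in> D'" "J_min (rm D')" "rm D \<in> D" "rp D \<in> D" using rminus_J_min rplus_J_max assms by auto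
  then have "ble (rm D') (rm D')" using assms(2) DC_carrier ble_refl by blast
  then have "ble (rm D') x" using J_min_ble r assms by blast
  then have "ble (rm D') (rp D)" using assms(4) ble_trans by blast
  then show ?thesis unfolding dcoset_le_def using J_min_ble r assms(1) by blast
qed

lemma dcoset_le_refl: "D \<in> DC \<Longrightarrow> dcoset_le G S D D"
  using ble_rp_dcoset_le rplus_J_max ble_refl rp_carrier by blast

lemma finite_dcoset_le:
  assumes "D \<in> DC" shows "finite {D' \<in> DC. dcoset_le G S D' D}"
proof (rule inj_on_finite[where f = rm])
  show "inj_on rm {D' \<in> DC. dcoset_le G S D' D}"
  proof (rule inj_onI)
    fix D1 D2 assume "D1 \<in> {D' \<in> DC. dcoset_le G S D' D}" "D2 \<in> {D' \<in> DC. dcoset_le G S D' D}"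
      and "rm D1 = rm D2"
    then show "D1 = D2" using DC_disjoint[of D1 D2 "rm D1"] rminus_J_min(1)[of D1] rminus_J_min(1)[of D2] by simp
  qed
  show "rm ` {D' \<in> DC. dcoset_le G S D' D} \<subseteq> {x. ble x (rm D)}"
    by (auto simp: dcoset_le_def)
  show "finite {x. ble x (rm D)}" using finite_ble rminus_J_min DC_carrier assms by blast
qed

end


section \<open>Coordinates with respect to a basis\<close>

text \<open>The coefficient family is extensional, hence \<open>undefined\<close> outside
  \<open>I\<close>; this makes it unique, and coordinates are meaningful only at indices in
  \<open>I\<close>.\<close>

definition basis_coord ::
  "('r, 'x) ring_scheme \<Rightarrow> ('r, 'h, 'c) module_scheme \<Rightarrow> ('i \<Rightarrow> 'h) \<Rightarrow> 'i set \<Rightarrow> 'h \<Rightarrow> 'i \<Rightarrow> 'r" where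
  "basis_coord R M b I x = (THE c. c \<in> I \<rightarrow>\<^sub>E carrier R \<and> finite {i \<in> I. c i \<noteq> \<zero>\<^bsub>R\<^esub>} \<and>
      x = (\<Oplus>\<^bsub>M\<^esub>i\<in>{i \<in> I. c i \<noteq> \<zero>\<^bsub>R\<^esub>}. c i \<odot>\<^bsub>M\<^esub> b i))"

lemma is_basis_closed: "is_basis R M b I \<Longrightarrow> i \<in> I \<Longrightarrow> b i \<in> carrier M"
  by (auto simp: is_basis_def)

lemma basis_coord:
  assumes "is_basis R M b I" "x \<in> carrier M"
  shows "basis_coord R M b I x \<in> I \<rightarrow>\<^sub>E carrier R"
    and "finite {i \<in> I. basis_coord R M b I x i \<noteq> \<zero>\<^bsub>R\<^esub>}"
    and "x = (\<Oplus>\<^bsub>M\<^esub>i\<in>{i \<in> I. basis_coord R M b I x i \<noteq> \<zero>\<^bsub>R\<^esub>}. basis_coord R M b I x i \<odot>\<^bsub>M\<^esub> b i)"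
proof -
  let ?P = "\<lambda>c. c \<in> I \<rightarrow>\<^sub>E carrier R \<and> finite {i \<in> I. c i \<noteq> \<zero>\<^bsub>R\<^esub>} \<and>
      x = (\<Oplus>\<^bsub>M\<^esub>i\<in>{i \<in> I. c i \<noteq> \<zero>\<^bsub>R\<^esub>}. c i \<odot>\<^bsub>M\<^esub> b i)"
  have "\<exists>!c. ?P c" using assms by (auto simp: is_basis_def)
  then have "?P (basis_coord R M b I x)" unfolding basis_coord_def by (rule theI')
  then show "basis_coord R M b I x \<in> I \<rightarrow>\<^sub>E carrier R"
    and "finite {i \<in> I. basis_coord R M b I x i \<noteq> \<zero>\<^bsub>R\<^esub>}"
    and "x = (\<Oplus>\<^bsub>M\<^esub>i\<in>{i \<in> I. basis_coord R M b I x i \<noteq> \<zero>\<^bsub>R\<^esub>}. basis_coord R M b I x i \<odot>\<^bsub>M\<^esub> b i)"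
    by simp_all
qed

context module
begin

text \<open>Allows elements with different supports to be expanded over a common finite index
  set.\<close>

lemma finsum_superset:
  assumes "finite F" "F' \<subseteq> F" "c \<in> F \<rightarrow> carrier R" "b \<in> F \<rightarrow> carrier M" "\<And>i. i \<in> F - F' \<Longrightarrow> c i = \<zero>"
  shows "(\<Oplus>\<^bsub>M\<^esub>i\<in>F'. c i \<odot>\<^bsub>M\<^esub> b i) = (\<Oplus>\<^bsub>M\<^esub>i\<in>F. c i \<odot>\<^bsub>M\<^esub> b i)"
  using assms by (intro M.add.finprod_mono_neutral_cong_left) (auto simp: Pi_def)

text \<open>This is the uniqueness half of the basis property: a finite combination displays its own
  coordinates, once its coefficients are extended by zero to all of \<open>I\<close>.\<close>

lemma basis_coord_finsum:
  assumes bas: "is_basis R M b I" and F: "finite F" "F \<subseteq> I" and c: "c \<in> F \<rightarrow> carrier R" and i: "i \<in> I"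
  shows "basis_coord R M b I (\<Oplus>\<^bsub>M\<^esub>i\<in>F. c i \<odot>\<^bsub>M\<^esub> b i) i = (if i \<in> F then c i else \<zero>)"
proof -
  let ?x = "\<Oplus>\<^bsub>M\<^esub>i\<in>F. c i \<odot>\<^bsub>M\<^esub> b i"
  let ?c = "\<lambda>i\<in>I. if i \<in> F then c i else \<zero>"
  have bF: "b \<in> F \<rightarrow> carrier M" using is_basis_closed[OF bas] F by auto
  then have x: "?x \<in> carrier M" using c by (intro M.finsum_closed) (auto simp: Pi_def)
  have S: "{i \<in> I. ?c i \<noteq> \<zero>} = {i \<in> F. c i \<noteq> \<zero>}" using F by auto
  have "?x = (\<Oplus>\<^bsub>M\<^esub>i\<in>{i \<in> F. c i \<noteq> \<zero>}. c i \<odot>\<^bsub>M\<^esub> b i)"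
    by (rule finsum_superset[symmetric]) (use F c bF in auto)
  also have "\<dots> = (\<Oplus>\<^bsub>M\<^esub>i\<in>{i \<in> I. ?c i \<noteq> \<zero>}. ?c i \<odot>\<^bsub>M\<^esub> b i)"
    unfolding S by (rule M.finsum_cong') (use F c bF in \<open>auto simp: Pi_def subset_iff\<close>)
  finally have "?c \<in> I \<rightarrow>\<^sub>E carrier R \<and> finite {i \<in> I. ?c i \<noteq> \<zero>} \<and>
      ?x = (\<Oplus>\<^bsub>M\<^esub>i\<in>{i \<in> I. ?c i \<noteq> \<zero>}. ?c i \<odot>\<^bsub>M\<^esub> b i)"
    using F c S by auto
  moreover have "\<exists>!c. c \<in> I \<rightarrow>\<^sub>E carrier R \<and> finite {i \<in> I. c i \<noteq> \<zero>} \<and>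
      ?x = (\<Oplus>\<^bsub>M\<^esub>i\<in>{i \<in> I. c i \<noteq> \<zero>}. c i \<odot>\<^bsub>M\<^esub> b i)"
    using bas x by (auto simp: is_basis_def)
  ultimately have "basis_coord R M b I ?x = ?c"
    unfolding basis_coord_def by (intro the1_equality)
  then show ?thesis using i by simp
qed

context
  fixes b :: "'i \<Rightarrow> 'c" and I
  assumes bas: "is_basis R M b I"
begin

abbreviation (input) "cd \<equiv> basis_coord R M b I"

lemma basis_coord_closed: "x \<in> carrier M \<Longrightarrow> i \<in> I \<Longrightarrow> cd x i \<in> carrier R"
  using basis_coord(1)[OF bas] by blast

lemma basis_coord_expand:
  assumes "x \<in> carrier M" "finite F" "F \<subseteq> I" "{i \<in> I. cd x i \<noteq> \<zero>} \<subseteq> F"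
  shows "x = (\<Oplus>\<^bsub>M\<^esub>i\<in>F. cd x i \<odot>\<^bsub>M\<^esub> b i)"
proof -
  have "x = (\<Oplus>\<^bsub>M\<^esub>i\<in>{i \<in> I. cd x i \<noteq> \<zero>}. cd x i \<odot>\<^bsub>M\<^esub> b i)" by (rule basis_coord(3)[OF bas assms(1)])
  also have "\<dots> = (\<Oplus>\<^bsub>M\<^esub>i\<in>F. cd x i \<odot>\<^bsub>M\<^esub> b i)"
    by (rule finsum_superset)
      (use assms basis_coord_closed is_basis_closed[OF bas] in \<open>auto simp: Pi_def subset_iff\<close>)
  finally show ?thesis .
qed

lemma basis_coord_add:
  assumes x: "x \<in> carrier M" and y: "y \<in> carrier M" and i: "i \<in> I"
  shows "cd (x \<oplus>\<^bsub>M\<^esub> y) i = cd x i \<oplus> cd y i"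
proof -
  let ?F = "{i \<in> I. cd x i \<noteq> \<zero>} \<union> {i \<in> I. cd y i \<noteq> \<zero>}"
  have F: "finite ?F" "?F \<subseteq> I" using basis_coord(2)[OF bas] x y by auto
  note cl = basis_coord_closed[OF x] basis_coord_closed[OF y] is_basis_closed[OF bas]
  have "x \<oplus>\<^bsub>M\<^esub> y = (\<Oplus>\<^bsub>M\<^esub>i\<in>?F. cd x i \<odot>\<^bsub>M\<^esub> b i) \<oplus>\<^bsub>M\<^esub> (\<Oplus>\<^bsub>M\<^esub>i\<in>?F. cd y i \<odot>\<^bsub>M\<^esub> b i)"
    by (intro arg_cong2[where f = "add M"] basis_coord_expand[OF x F] basis_coord_expand[OF y F])
      auto
  also have "\<dots> = (\<Oplus>\<^bsub>M\<^esub>i\<in>?F. cd x i \<odot>\<^bsub>M\<^esub> b i \<oplus>\<^bsub>M\<^esub> cd y i \<odot>\<^bsub>M\<^esub> b i)"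
    by (rule M.finsum_addf[symmetric]) (use cl in auto)
  also have "\<dots> = (\<Oplus>\<^bsub>M\<^esub>i\<in>?F. (cd x i \<oplus> cd y i) \<odot>\<^bsub>M\<^esub> b i)"
    by (rule M.finsum_cong') (use cl in \<open>auto simp: smult_l_distr\<close>)
  finally have "cd (x \<oplus>\<^bsub>M\<^esub> y) i = (if i \<in> ?F then cd x i \<oplus> cd y i else \<zero>)"
    using basis_coord_finsum[OF bas F _ i, of "\<lambda>i. cd x i \<oplus> cd y i"] cl by auto
  then show ?thesis using i by auto
qed

lemma basis_coord_smult:
  assumes x: "x \<in> carrier M" and a: "a \<in> carrier R" and i: "i \<in> I"
  shows "cd (a \<odot>\<^bsub>M\<^esub> x) i = a \<otimes> cd x i"
proof -
  let ?F = "{i \<in> I. cd x i \<noteq> \<zero>}"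
  have F: "finite ?F" "?F \<subseteq> I" using basis_coord(2)[OF bas] x by auto
  note cl = basis_coord_closed[OF x] is_basis_closed[OF bas]
  have "a \<odot>\<^bsub>M\<^esub> x = a \<odot>\<^bsub>M\<^esub> (\<Oplus>\<^bsub>M\<^esub>i\<in>?F. cd x i \<odot>\<^bsub>M\<^esub> b i)"
    by (rule arg_cong[OF basis_coord_expand[OF x F subset_refl]])
  also have "\<dots> = (\<Oplus>\<^bsub>M\<^esub>i\<in>?F. a \<odot>\<^bsub>M\<^esub> (cd x i \<odot>\<^bsub>M\<^esub> b i))"
    by (rule finsum_smult_ldistr) (use F a cl in auto)
  also have "\<dots> = (\<Oplus>\<^bsub>M\<^esub>i\<in>?F. (a \<otimes> cd x i) \<odot>\<^bsub>M\<^esub> b i)"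
    by (rule M.finsum_cong') (use cl a in \<open>auto simp: smult_assoc1\<close>)
  finally have "cd (a \<odot>\<^bsub>M\<^esub> x) i = (if i \<in> ?F then a \<otimes> cd x i else \<zero>)"
    using basis_coord_finsum[OF bas F _ i, of "\<lambda>i. a \<otimes> cd x i"] cl a by auto
  then show ?thesis using i a by auto
qed

lemma basis_coord_basis:
  assumes "j \<in> I" "i \<in> I" shows "cd (b j) i = (if i = j then \<one> else \<zero>)"
proof -
  have "b j \<in> carrier M" using assms is_basis_closed[OF bas] by blast
  then have "(\<Oplus>\<^bsub>M\<^esub>i\<in>{j}. \<one> \<odot>\<^bsub>M\<^esub> b i) = b j" by simp
  then show ?thesis using basis_coord_finsum[OF bas, of "{j}" "\<lambda>_. \<one>" i] assms by simp
qed

lemma basis_coord_eqI: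
  assumes "x \<in> carrier M" "y \<in> carrier M" "\<And>i. i \<in> I \<Longrightarrow> cd x i = cd y i"
  shows "x = y"
proof -
  have "{i \<in> I. cd x i \<noteq> \<zero>} = {i \<in> I. cd y i \<noteq> \<zero>}" using assms(3) by auto
  moreover note basis_coord(3)[OF bas assms(1)]
  moreover have "(\<Oplus>\<^bsub>M\<^esub>i\<in>{i \<in> I. cd y i \<noteq> \<zero>}. cd x i \<odot>\<^bsub>M\<^esub> b i) =
      (\<Oplus>\<^bsub>M\<^esub>i\<in>{i \<in> I. cd y i \<noteq> \<zero>}. cd y i \<odot>\<^bsub>M\<^esub> b i)"
    by (rule M.finsum_cong')
      (use assms basis_coord_closed[OF assms(2)] is_basis_closed[OF bas] in auto)
  ultimately show ?thesis using basis_coord(3)[OF bas assms(2)] by simp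
qed

lemma basis_induct [consumes 1, case_names zero add]:
  assumes x: "x \<in> carrier M" and "P \<zero>\<^bsub>M\<^esub>"
    and add: "\<And>a i y. a \<in> carrier R \<Longrightarrow> i \<in> I \<Longrightarrow> y \<in> carrier M \<Longrightarrow> P y \<Longrightarrow> P (a \<odot>\<^bsub>M\<^esub> b i \<oplus>\<^bsub>M\<^esub> y)"
  shows "P x"
proof -
  have *: "P (\<Oplus>\<^bsub>M\<^esub>i\<in>F. cd x i \<odot>\<^bsub>M\<^esub> b i)" if "finite F" "F \<subseteq> I" for F
    using that
  proof (induction F)
    case empty
    then show ?case using assms by simp
  next
    case (insert i F)
    have cl: "\<And>j. j \<in> I \<Longrightarrow> cd x j \<in> carrier R \<and> b j \<in> carrier M"
      using basis_coord_closed[OF x] is_basis_closed[OF bas] by blast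
    then have "(\<lambda>i. cd x i \<odot>\<^bsub>M\<^esub> b i) \<in> F \<rightarrow> carrier M" using insert.prems by auto
    then have "(\<Oplus>\<^bsub>M\<^esub>i\<in>insert i F. cd x i \<odot>\<^bsub>M\<^esub> b i) =
        cd x i \<odot>\<^bsub>M\<^esub> b i \<oplus>\<^bsub>M\<^esub> (\<Oplus>\<^bsub>M\<^esub>i\<in>F. cd x i \<odot>\<^bsub>M\<^esub> b i)"
        "(\<Oplus>\<^bsub>M\<^esub>i\<in>F. cd x i \<odot>\<^bsub>M\<^esub> b i) \<in> carrier M"
      using insert cl by auto
    then show ?case using add insert cl by simp
  qed
  have "P (\<Oplus>\<^bsub>M\<^esub>i\<in>{i \<in> I. cd x i \<noteq> \<zero>}. cd x i \<odot>\<^bsub>M\<^esub> b i)"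
    by (rule *) (use basis_coord(2)[OF bas x] in auto)
  then show ?thesis using basis_coord(3)[OF bas x] by simp
qed

end

end

section \<open>Laurent polynomials in the coefficient field\<close>

abbreviation qi :: coeff where "qi \<equiv> inverse qv"
abbreviation K :: "coeff ring" where "K \<equiv> ring_of_type_algebra"

interpretation K: cring K
  by (rule cring_from_type_algebra)

lemma K_simps [simp]:
  "carrier K = UNIV" "x \<otimes>\<^bsub>K\<^esub> y = x * y" "x \<oplus>\<^bsub>K\<^esub> y = x + y" "\<zero>\<^bsub>K\<^esub> = 0" "\<one>\<^bsub>K\<^esub> = 1"
  by (simp_all add: ring_of_type_algebra_def)

lemma K_uminus [simp]: "\<ominus>\<^bsub>K\<^esub> x = - x"
  by (rule K.minus_equality) simp_all

lemma qv_nonzero [simp]: "qv \<noteq> 0"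
  by (simp add: qv_def)

definition Zqi :: "coeff set" where
  "Zqi = generate_ring K {qi}"

lemma Zqi_qi: "qi \<in> Zqi"
  unfolding Zqi_def by (rule generate_ring.incl) simp

lemma Zqi_one: "1 \<in> Zqi" and Zqi_uminus: "a \<in> Zqi \<Longrightarrow> - a \<in> Zqi"
  and Zqi_add: "a \<in> Zqi \<Longrightarrow> b \<in> Zqi \<Longrightarrow> a + b \<in> Zqi"
  and Zqi_mult: "a \<in> Zqi \<Longrightarrow> b \<in> Zqi \<Longrightarrow> a * b \<in> Zqi"
  using generate_ring.one[of K] generate_ring.a_inv[of _ K] generate_ring.eng_add[of _ K]
    generate_ring.eng_mult[of _ K]
  by (auto simp: Zqi_def)

lemma Zqi_zero: "0 \<in> Zqi"
  using Zqi_add[OF Zqi_one Zqi_uminus[OF Zqi_one]] by simp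

lemma Zqi_power: "qi ^ n \<in> Zqi"
  by (induction n) (auto intro: Zqi_one Zqi_mult Zqi_qi)

lemma qinv_ideal_iff: "a \<in> qinv_ideal \<longleftrightarrow> (\<exists>b\<in>Zqi. a = qi * b)"
  by (auto simp: qinv_ideal_def Zqi_def)

lemma qinv_ideal_Zqi: "a \<in> qinv_ideal \<Longrightarrow> a \<in> Zqi"
  unfolding qinv_ideal_iff using Zqi_qi Zqi_mult by blast

lemma qinv_ideal_zero: "0 \<in> qinv_ideal"
  unfolding qinv_ideal_iff using Zqi_zero by force

lemma qinv_ideal_diff: "a \<in> qinv_ideal \<Longrightarrow> b \<in> qinv_ideal \<Longrightarrow> a - b \<in> qinv_ideal"
  unfolding qinv_ideal_iff using Zqi_add Zqi_uminus by (metis right_diff_distrib diff_conv_add_uminus)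

lemma qinv_ideal_mult: "a \<in> qinv_ideal \<Longrightarrow> b \<in> Zqi \<Longrightarrow> a * b \<in> qinv_ideal"
  unfolding qinv_ideal_iff using Zqi_mult by (metis mult.assoc)

lemma qi_Zqi_qinv_ideal: "b \<in> Zqi \<Longrightarrow> qi * b \<in> qinv_ideal"
  unfolding qinv_ideal_iff by blast

lemma qv_powi_nonpos: "k \<le> 0 \<Longrightarrow> qv powi k \<in> Zqi"
  using Zqi_power[of "nat (- k)"] by (auto simp: power_int_def)

text \<open>A pair consists of a Laurent polynomial \<open>a\<close> and its image under \<open>q \<mapsto> q\<^sup>-\<^sup>1\<close>.\<close>

inductive bar_pair :: "coeff \<Rightarrow> coeff \<Rightarrow> bool" where
  one: "bar_pair 1 1"
| q: "bar_pair qv qi"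
| qi: "bar_pair qi qv"
| uminus: "bar_pair a b \<Longrightarrow> bar_pair (- a) (- b)"
| add: "bar_pair a b \<Longrightarrow> bar_pair a' b' \<Longrightarrow> bar_pair (a + a') (b + b')"
| mult: "bar_pair a b \<Longrightarrow> bar_pair a' b' \<Longrightarrow> bar_pair (a * a') (b * b')"

lemma bar_pair_zero: "bar_pair 0 0"
  using bar_pair.add[OF bar_pair.one bar_pair.uminus[OF bar_pair.one]] by simp

lemma bar_pair_diff: "bar_pair a b \<Longrightarrow> bar_pair a' b' \<Longrightarrow> bar_pair (a - a') (b - b')"
  using bar_pair.add[OF _ bar_pair.uminus] by fastforce

lemma bar_pair_sum: "(\<And>i. i \<in> F \<Longrightarrow> bar_pair (f i) (g i)) \<Longrightarrow> bar_pair (sum f F) (sum g F)"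
  by (induction F rule: infinite_finite_induct) (auto intro: bar_pair_zero bar_pair.add)

lemma bar_pair_power: "bar_pair a b \<Longrightarrow> bar_pair (a ^ n) (b ^ n)"
  by (induction n) (auto intro: bar_pair.one bar_pair.mult)

lemma bar_pair_of_int: "bar_pair (of_int k) (of_int k)"
proof -
  have "bar_pair (of_nat n) (of_nat n)" for n
    by (induction n) (auto intro: bar_pair_zero bar_pair.add bar_pair.one)
  then show ?thesis by (cases k rule: int_cases2) (auto intro: bar_pair.uminus)
qed

text \<open>Integrality is imposed on polynomials over the coefficient field, so that
  \<open>poly\<close> evaluates the same polynomial at both \<open>qv\<close> and
  \<open>qi\<close>.\<close>

definition int_poly :: "coeff poly \<Rightarrow> bool" where
  "int_poly P \<longleftrightarrow> (\<forall>i. coeff P i \<in> \<int>)"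

lemma Zqi_poly:
  assumes "a \<in> Zqi" shows "\<exists>P. int_poly P \<and> a = poly P qi"
  using assms unfolding Zqi_def
proof (induction rule: generate_ring.induct)
  case one
  show ?case by (rule exI[of _ 1]) (auto simp: int_poly_def coeff_1)
next
  case (incl h)
  then show ?case by (intro exI[of _ "[:0, 1:]"]) (auto simp: int_poly_def coeff_pCons split: nat.split)
next
  case (a_inv h)
  then obtain P where "int_poly P" "h = poly P qi" by blast
  then show ?case by (intro exI[of _ "- P"]) (auto simp: int_poly_def)
next
  case (eng_add h1 h2)
  then obtain P Q where "int_poly P" "h1 = poly P qi" "int_poly Q" "h2 = poly Q qi" by blast
  then show ?case by (intro exI[of _ "P + Q"]) (auto simp: int_poly_def)
next
  case (eng_mult h1 h2)
  then obtain P Q where "int_poly P" "h1 = poly P qi" "int_poly Q" "h2 = poly Q qi" by blast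
  then show ?case by (intro exI[of _ "P * Q"]) (auto simp: int_poly_def coeff_mult)
qed

lemma bar_pair_poly:
  assumes "int_poly P" shows "bar_pair (poly P qi) (poly P qv)"
  unfolding poly_altdef
proof (intro bar_pair_sum bar_pair.mult bar_pair_power bar_pair.qi)
  fix i
  obtain k where "coeff P i = of_int k" using assms Ints_cases unfolding int_poly_def by metis
  then show "bar_pair (coeff P i) (coeff P i)" using bar_pair_of_int by simp
qed

lemma Zqi_bar_pair: "a \<in> Zqi \<Longrightarrow> \<exists>b. bar_pair a b"
  using Zqi_poly bar_pair_poly by blast

lemma of_int_fract: "(of_int k :: coeff) = to_fract [:k:]"
proof -
  have nat: "(of_nat n :: coeff) = to_fract [:int n:]" for n
  proof (induction n)
    case (Suc n)
    have "[:int (Suc n):] = 1 + [:int n:]" by (simp add: one_pCons)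
    then show ?case using Suc by simp
  qed simp
  show ?thesis
  proof (cases k rule: int_cases2)
    case (nonpos n)
    have "[:- int n:] = - [:int n:]" by simp
    then show ?thesis using nonpos nat[of n] by (metis of_int_minus of_int_of_nat_eq to_fract_uminus)
  qed (use nat in simp)
qed

lemma to_fract_power: "to_fract (x ^ n) = to_fract x ^ n"
  by (induction n) auto

lemma q_monom: "of_int k * qv ^ n = to_fract (monom k n)"
proof -
  have "monom k n = [:k:] * [:0, 1:] ^ n" by (simp add: monom_altdef)
  then show ?thesis by (simp only: of_int_fract qv_def to_fract_power to_fract_mult)
qed

text \<open>An element of the ideal has only negative exponents and its image only positive ones, so
  the two agree only at zero. The image is quantified existentially because \<open>bar_pair\<close>
  is at this point merely a relation.\<close>

lemma qinv_ideal_bar_fixed: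
  assumes a: "a \<in> qinv_ideal"
  shows "\<exists>b. bar_pair a b \<and> (a = b \<longrightarrow> a = 0)"
proof -
  obtain P where P: "int_poly P" "a = qi * poly P qi" using a Zqi_poly qinv_ideal_iff by blast
  let ?b = "qv * poly P qv"
  have "a = 0" if eq: "a = ?b"
  proof -
    define n where "n = degree P"
    obtain k where k: "\<And>i. coeff P i = of_int (k i)"
      using P(1) unfolding int_poly_def Ints_def by (auto simp: image_iff) metis
    \<comment> \<open>Multiplication by \<open>qv ^ Suc n\<close> makes both sides polynomial and
      keeps their exponents apart: at least \<open>n + 2\<close> for the image, at most
      \<open>n\<close> for \<open>a\<close>.\<close>
    have "(\<Sum>i\<le>n. of_int (k i) * qv ^ (n + 2 + i)) = qv ^ Suc n * ?b"
      by (simp add: poly_altdef n_def k sum_distrib_left power_add mult_ac)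
    also have "\<dots> = qv ^ Suc n * a" by (simp only: eq)
    also have "\<dots> = (\<Sum>i\<le>n. of_int (k i) * qv ^ (n - i))"
    proof -
      have "qv ^ Suc n * (qi * (of_int (k i) * qi ^ i)) = of_int (k i) * qv ^ (n - i)" if "i \<le> n" for i
        using that by (simp add: power_diff field_simps)
      then have "(\<Sum>i\<le>n. qv ^ Suc n * (qi * (of_int (k i) * qi ^ i))) =
          (\<Sum>i\<le>n. of_int (k i) * qv ^ (n - i))"
        by (intro sum.cong) auto
      then show ?thesis
        by (simp only: P(2) poly_altdef k sum_distrib_left n_def)
    qed
    finally have "to_fract (\<Sum>i\<le>n. monom (k i) (n + 2 + i)) = to_fract (\<Sum>i\<le>n. monom (k i) (n - i))"
      by (simp only: q_monom to_fract_sum)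
    then have e: "(\<Sum>i\<le>n. monom (k i) (n + 2 + i)) = (\<Sum>i\<le>n. monom (k i) (n - i))"
      by (simp only: to_fract_eq_iff)
    have "k j = 0" if "j \<le> n" for j
    proof -
      have "k j = coeff (\<Sum>i\<le>n. monom (k i) (n + 2 + i)) (n + 2 + j)"
        using that by (simp add: coeff_sum)
      also have "\<dots> = 0" unfolding e by (simp add: coeff_sum) (rule sum.neutral, auto)
      finally show ?thesis .
    qed
    then have "poly P qi = 0" by (simp add: poly_altdef k n_def)
    then show ?thesis using P by simp
  qed
  moreover have "bar_pair a ?b" using P bar_pair_poly by (auto intro: bar_pair.mult bar_pair.qi)
  ultimately show ?thesis by blast
qed

text \<open>At \<open>q = 1\<close> the integer polynomial takes the value
  \<open>card (parabolic G J)\<close>, which is positive for a finite group.\<close>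

lemma parabolic_poincare_nonzero:
  assumes "finite (parabolic G J)" shows "parabolic_poincare G S J \<noteq> 0"
proof -
  have one: "\<one>\<^bsub>G\<^esub> \<in> parabolic G J" by (rule generate.one)
  let ?f = "\<Sum>w\<in>parabolic G J. [:0, 1:] ^ (2 * cox_len G S w) :: int poly"
  have "poly ?f 1 = int (card (parabolic G J))" by (simp add: poly_sum)
  moreover have "card (parabolic G J) \<noteq> 0" using one assms by auto
  ultimately have "?f \<noteq> 0" by auto
  moreover have "parabolic_poincare G S J = to_fract ?f"
    by (simp add: parabolic_poincare_def qv_def to_fract_power)
  ultimately show ?thesis by (simp del: to_fract_sum)
qed


section \<open>The bar involution on the Hecke algebra\<close>

locale parabolic_hecke_bar = W: parabolic_coxeter G S J + hecke_algebra "coeff_ring G S J" G S H T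
  for G :: "('w, 'b) monoid_scheme" (structure) and S J :: "'w set"
    and H :: "(coeff, 'h, 'c) module_scheme" and T :: "'w \<Rightarrow> 'h" +
  fixes bar :: "'h \<Rightarrow> 'h"
  assumes bar_inv: "bar_involution S H T bar"
begin

abbreviation A where "A \<equiv> coeff_ring G S J"
abbreviation cf where "cf \<equiv> basis_coord A H T (carrier G)"

lemma A_simps [simp]:
  "x \<otimes>\<^bsub>A\<^esub> y = x * y" "x \<oplus>\<^bsub>A\<^esub> y = x + y" "\<zero>\<^bsub>A\<^esub> = 0" "\<one>\<^bsub>A\<^esub> = 1"
  by (simp_all add: coeff_ring_def ring_of_type_algebra_def)

lemma carrier_A: "carrier A = generate_ring K {qv, qi, inverse (parabolic_poincare G S J)}"
  by (simp add: coeff_ring_def)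

lemma A_one [simp]: "1 \<in> carrier A" and A_zero [simp]: "0 \<in> carrier A"
  and A_add [simp]: "a \<in> carrier A \<Longrightarrow> b \<in> carrier A \<Longrightarrow> a + b \<in> carrier A"
  and A_mult [simp]: "a \<in> carrier A \<Longrightarrow> b \<in> carrier A \<Longrightarrow> a * b \<in> carrier A"
  using R.one_closed R.zero_closed R.add.m_closed[of a b] R.m_closed[of a b] by simp_all

lemma A_uminus [simp]: assumes "a \<in> carrier A" shows "- a \<in> carrier A"
  using generate_ring.a_inv[of a K] assms unfolding carrier_A by simp

lemma A_diff [simp]: "a \<in> carrier A \<Longrightarrow> b \<in> carrier A \<Longrightarrow> a - b \<in> carrier A"
  using A_add[of a "- b"] by simp

lemma A_qv [simp]: "qv \<in> carrier A" and A_qi [simp]: "qi \<in> carrier A"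
  and A_poincare: "inverse (parabolic_poincare G S J) \<in> carrier A"
  unfolding carrier_A by (auto intro: generate_ring.incl)

lemma A_power [simp]: "a \<in> carrier A \<Longrightarrow> a ^ n \<in> carrier A"
  by (induction n) auto

lemma A_powi [simp]: "qv powi k \<in> carrier A"
  by (auto simp: power_int_def)

lemma A_Zqi: "a \<in> Zqi \<Longrightarrow> a \<in> carrier A"
  unfolding Zqi_def
  by (induction rule: generate_ring.induct) (auto simp: K_simps(2-5))

lemma A_bar_pair: "bar_pair a b \<Longrightarrow> a \<in> carrier A \<and> b \<in> carrier A"
  by (induction rule: bar_pair.induct) auto

section \<open>Standard coordinates and multiplication by generators\<close>

lemma T_closed [simp]: "w \<in> carrier G \<Longrightarrow> T w \<in> carrier H"
  by (rule is_basis_closed[OF T_basis])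

lemma cf_closed [simp]: "h \<in> carrier H \<Longrightarrow> w \<in> carrier G \<Longrightarrow> cf h w \<in> carrier A"
  by (rule basis_coord_closed[OF T_basis])

lemma cf_add [simp]: "h \<in> carrier H \<Longrightarrow> h' \<in> carrier H \<Longrightarrow> w \<in> carrier G \<Longrightarrow>
    cf (h \<oplus>\<^bsub>H\<^esub> h') w = cf h w + cf h' w"
  using basis_coord_add[OF T_basis] by simp

lemma cf_smult [simp]: "h \<in> carrier H \<Longrightarrow> a \<in> carrier A \<Longrightarrow> w \<in> carrier G \<Longrightarrow>
    cf (a \<odot>\<^bsub>H\<^esub> h) w = a * cf h w"
  using basis_coord_smult[OF T_basis] by simp

lemma cf_T [simp]: "v \<in> carrier G \<Longrightarrow> w \<in> carrier G \<Longrightarrow> cf (T v) w = (if w = v then 1 else 0)"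
  using basis_coord_basis[OF T_basis] by simp

lemma smult_1 [simp]: "h \<in> carrier H \<Longrightarrow> 1 \<odot>\<^bsub>H\<^esub> h = h"
  and smult_0 [simp]: "h \<in> carrier H \<Longrightarrow> 0 \<odot>\<^bsub>H\<^esub> h = \<zero>\<^bsub>H\<^esub>"
  using smult_one[of h] smult_l_null[of h] by simp_all

lemma cf_zero [simp]: "w \<in> carrier G \<Longrightarrow> cf \<zero>\<^bsub>H\<^esub> w = 0"
  using cf_smult[of "\<zero>\<^bsub>H\<^esub>" 0 w] by simp

lemma cf_finsum:
  "finite F \<Longrightarrow> f \<in> F \<rightarrow> carrier H \<Longrightarrow> w \<in> carrier G \<Longrightarrow>
    cf (\<Oplus>\<^bsub>H\<^esub>i\<in>F. f i) w = (\<Sum>i\<in>F. cf (f i) w)"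
proof (induction F rule: finite_induct)
  case (insert i F)
  then have "f i \<in> carrier H" "f \<in> F \<rightarrow> carrier H" by auto
  with insert show ?case by (simp add: M.finsum_closed)
qed simp

lemmas cf_eqI = basis_coord_eqI[OF T_basis]
lemmas T_induct = basis_induct[OF T_basis, consumes 1, case_names zero add]

lemma minus_one_smult: "h \<in> carrier H \<Longrightarrow> \<ominus>\<^bsub>H\<^esub> h = (- 1) \<odot>\<^bsub>H\<^esub> h"
proof -
  assume h: "h \<in> carrier H"
  have "(- 1) \<odot>\<^bsub>H\<^esub> h \<oplus>\<^bsub>H\<^esub> h = (- 1 + 1) \<odot>\<^bsub>H\<^esub> h"
    using smult_l_distr[of "- 1" 1 h] h by simp
  then show ?thesis using h by (intro M.minus_equality) auto
qed

lemma cf_minus [simp]: "h \<in> carrier H \<Longrightarrow> h' \<in> carrier H \<Longrightarrow> w \<in> carrier G \<Longrightarrow>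
    cf (h \<ominus>\<^bsub>H\<^esub> h') w = cf h w - cf h' w"
  by (simp add: a_minus_def minus_one_smult)

lemma T_mult:
  assumes "s \<in> S" "w \<in> carrier G"
  shows "T s \<otimes>\<^bsub>H\<^esub> T w = (if W.len (s \<otimes> w) < W.len w
    then ((qv - qi) \<odot>\<^bsub>H\<^esub> T w) \<oplus>\<^bsub>H\<^esub> T (s \<otimes> w) else T (s \<otimes> w))"
  using W.len_mult_left[OF assms] T_mult_up[OF assms] T_mult_down[OF assms] by auto

text \<open>Only \<open>T w\<close> and \<open>T (s w)\<close> contribute to the coefficient at
  \<open>w\<close>. This turns equations in \<open>H\<close> that involve \<open>T s\<close> into
  pointwise identities between coefficients.\<close>

lemma cf_T_mult:
  assumes s: "s \<in> S" and h: "h \<in> carrier H" and w: "w \<in> carrier G"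
  shows "cf (T s \<otimes>\<^bsub>H\<^esub> h) w = cf h (s \<otimes> w) + (if W.len (s \<otimes> w) < W.len w then (qv - qi) * cf h w else 0)"
  using h
proof (induction rule: T_induct)
  case zero
  then show ?case using s w by simp
next
  case (add a v h)
  have iff: "w = s \<otimes> v \<longleftrightarrow> s \<otimes> w = v" using s w add by auto
  have sc: "T s \<in> carrier H" "s \<otimes> v \<in> carrier G" "s \<otimes> w \<in> carrier G" using s w add by auto
  have "T s \<otimes>\<^bsub>H\<^esub> (a \<odot>\<^bsub>H\<^esub> T v \<oplus>\<^bsub>H\<^esub> h) = a \<odot>\<^bsub>H\<^esub> (T s \<otimes>\<^bsub>H\<^esub> T v) \<oplus>\<^bsub>H\<^esub> T s \<otimes>\<^bsub>H\<^esub> h"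
    using s add by (simp add: r_distr smult_mult_right)
  then have "cf (T s \<otimes>\<^bsub>H\<^esub> (a \<odot>\<^bsub>H\<^esub> T v \<oplus>\<^bsub>H\<^esub> h)) w = a * cf (T s \<otimes>\<^bsub>H\<^esub> T v) w + cf (T s \<otimes>\<^bsub>H\<^esub> h) w"
    using sc w add by simp
  also have "cf (T s \<otimes>\<^bsub>H\<^esub> T v) w = cf (T v) (s \<otimes> w) + (if W.len (s \<otimes> w) < W.len w then (qv - qi) * cf (T v) w else 0)"
    unfolding T_mult[OF s add(2)] using sc w s add(2) iff by auto
  finally show ?case using add s w sc by (simp add: algebra_simps)
qed

text \<open>The multiplication rules do not mention \<open>T\<^sub>1\<close> as a left factor; \<open>T\<^sub>1 = T\<^sub>s T\<^sub>s - (q - q\<^sup>-\<^sup>1) T\<^sub>s\<close>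
  for some \<open>s \<in> J\<close> reduces to them.\<close>

lemma T_one: "T \<one> = \<one>\<^bsub>H\<^esub>"
proof -
  obtain s where "s \<in> J" using W.J_nonempty by blast
  then have s: "s \<in> S" by simp
  have sc: "T s \<in> carrier H" using s by simp
  have ss: "T s \<otimes>\<^bsub>H\<^esub> T s = (qv - qi) \<odot>\<^bsub>H\<^esub> T s \<oplus>\<^bsub>H\<^esub> T \<one>"
    using T_mult[of s s] s by simp
  have "cf (T \<one> \<otimes>\<^bsub>H\<^esub> h) w = cf h w" if h: "h \<in> carrier H" and w: "w \<in> carrier G" for h w
  proof -
    have "T s \<otimes>\<^bsub>H\<^esub> (T s \<otimes>\<^bsub>H\<^esub> h) = (qv - qi) \<odot>\<^bsub>H\<^esub> (T s \<otimes>\<^bsub>H\<^esub> h) \<oplus>\<^bsub>H\<^esub> T \<one> \<otimes>\<^bsub>H\<^esub> h"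
      using sc h by (simp add: ss l_distr smult_mult_left flip: m_assoc)
    then have "cf (T s \<otimes>\<^bsub>H\<^esub> (T s \<otimes>\<^bsub>H\<^esub> h)) w = (qv - qi) * cf (T s \<otimes>\<^bsub>H\<^esub> h) w + cf (T \<one> \<otimes>\<^bsub>H\<^esub> h) w"
      using sc h w by simp
    then show ?thesis
      using s sc h w W.len_mult_left[OF s w] by (simp add: cf_T_mult algebra_simps split: if_splits)
  qed
  then have "T \<one> \<otimes>\<^bsub>H\<^esub> h = h" if "h \<in> carrier H" for h
    using that by (intro cf_eqI) auto
  from this[of "\<one>\<^bsub>H\<^esub>"] show ?thesis by simp
qed

text \<open>The multiplication rules describe left factors only. Peeling left descents off
  \<open>x\<close> extends them to all products with additive length, and this gives access to
  multiplication from the right.\<close>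

lemma T_mult_additive:
  assumes "x \<in> carrier G" "y \<in> carrier G" "W.len (x \<otimes> y) = W.len x + W.len y"
  shows "T x \<otimes>\<^bsub>H\<^esub> T y = T (x \<otimes> y)"
  using assms
proof (induction "W.len x" arbitrary: x rule: less_induct)
  case less
  show ?case
  proof (cases "x = \<one>")
    case True
    then show ?thesis using less.prems by (simp add: T_one)
  next
    case False
    then obtain s v where sv: "s \<in> S" "v \<in> carrier G" "x = s \<otimes> v" "W.len x = Suc (W.len v)"
      using W.left_descent_exists less.prems(1) by metis
    then have xy: "x \<otimes> y = s \<otimes> (v \<otimes> y)" using less.prems by (simp add: W.m_assoc)
    have "W.len (v \<otimes> y) \<le> W.len v + W.len y"
      using W.len_mult_le sv less.prems by blast
    then have l: "W.len (v \<otimes> y) = W.len v + W.len y" "W.len (v \<otimes> y) < W.len (s \<otimes> (v \<otimes> y))"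
      using W.len_mult_left[of s "v \<otimes> y"] sv less.prems xy by auto
    have "T x = T s \<otimes>\<^bsub>H\<^esub> T v" using T_mult_up[of s v] sv by simp
    then have "T x \<otimes>\<^bsub>H\<^esub> T y = T s \<otimes>\<^bsub>H\<^esub> (T v \<otimes>\<^bsub>H\<^esub> T y)"
      using sv less.prems by (simp add: m_assoc)
    also have "T v \<otimes>\<^bsub>H\<^esub> T y = T (v \<otimes> y)" using less.hyps[of v] sv l less.prems by simp
    also have "T s \<otimes>\<^bsub>H\<^esub> T (v \<otimes> y) = T (x \<otimes> y)"
      using T_mult_up[of s "v \<otimes> y"] sv l less.prems xy by simp
    finally show ?thesis .
  qed
qed

text \<open>In the descent case \<open>T w = T (w s) T s\<close>, and the quadratic relation for
  \<open>T s\<close> is applied at the right end.\<close>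

lemma T_mult_right:
  assumes s: "s \<in> S" and w: "w \<in> carrier G"
  shows "T w \<otimes>\<^bsub>H\<^esub> T s = (if W.len (w \<otimes> s) < W.len w
    then ((qv - qi) \<odot>\<^bsub>H\<^esub> T w) \<oplus>\<^bsub>H\<^esub> T (w \<otimes> s) else T (w \<otimes> s))"
proof (cases "W.len (w \<otimes> s) < W.len w")
  case True
  then have l: "W.len w = Suc (W.len (w \<otimes> s))" using W.len_mult_right[OF s w] by auto
  have w': "w \<otimes> s \<in> carrier G" using s w by simp
  have Tw: "T (w \<otimes> s) \<otimes>\<^bsub>H\<^esub> T s = T w"
    using T_mult_additive[OF w', of s] s w l by simp
  have ss: "T s \<otimes>\<^bsub>H\<^esub> T s = (qv - qi) \<odot>\<^bsub>H\<^esub> T s \<oplus>\<^bsub>H\<^esub> \<one>\<^bsub>H\<^esub>"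
    using T_mult[of s s] s by (simp add: T_one)
  have "T w \<otimes>\<^bsub>H\<^esub> T s = T (w \<otimes> s) \<otimes>\<^bsub>H\<^esub> (T s \<otimes>\<^bsub>H\<^esub> T s)"
    using s w' by (simp flip: Tw add: m_assoc)
  also have "\<dots> = (qv - qi) \<odot>\<^bsub>H\<^esub> T w \<oplus>\<^bsub>H\<^esub> T (w \<otimes> s)"
    using s w' by (simp add: ss r_distr smult_mult_right Tw)
  finally show ?thesis using True by simp
next
  case False
  then have "W.len (w \<otimes> s) = W.len w + W.len s" using W.len_mult_right[OF s w] s by auto
  then show ?thesis using T_mult_additive[of w s] s w False by simp
qed

lemma cf_mult_T:
  assumes s: "s \<in> S" and h: "h \<in> carrier H" and w: "w \<in> carrier G"
  shows "cf (h \<otimes>\<^bsub>H\<^esub> T s) w = cf h (w \<otimes> s) + (if W.len (w \<otimes> s) < W.len w then (qv - qi) * cf h w else 0)"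
  using h
proof (induction rule: T_induct)
  case zero
  then show ?case using s w by simp
next
  case (add a v h)
  have iff: "w = v \<otimes> s \<longleftrightarrow> w \<otimes> s = v" using s w add by auto
  have sc: "T s \<in> carrier H" "v \<otimes> s \<in> carrier G" "w \<otimes> s \<in> carrier G" using s w add by auto
  have "(a \<odot>\<^bsub>H\<^esub> T v \<oplus>\<^bsub>H\<^esub> h) \<otimes>\<^bsub>H\<^esub> T s = a \<odot>\<^bsub>H\<^esub> (T v \<otimes>\<^bsub>H\<^esub> T s) \<oplus>\<^bsub>H\<^esub> h \<otimes>\<^bsub>H\<^esub> T s"
    using s add by (simp add: l_distr smult_mult_left)
  then have "cf ((a \<odot>\<^bsub>H\<^esub> T v \<oplus>\<^bsub>H\<^esub> h) \<otimes>\<^bsub>H\<^esub> T s) w = a * cf (T v \<otimes>\<^bsub>H\<^esub> T s) w + cf (h \<otimes>\<^bsub>H\<^esub> T s) w"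
    using sc w add by simp
  also have "cf (T v \<otimes>\<^bsub>H\<^esub> T s) w = cf (T v) (w \<otimes> s) + (if W.len (w \<otimes> s) < W.len w then (qv - qi) * cf (T v) w else 0)"
    unfolding T_mult_right[OF s add(2)] using sc w s add(2) iff by auto
  finally show ?case using add s w sc by (simp add: algebra_simps)
qed

section \<open>The bar involution on Laurent polynomial coefficients and on the standard
  basis\<close>

lemma bar_hom: "bar \<in> ring_hom H H"
  using bar_inv by (auto simp: bar_involution_def ring_iso_def)

lemma bar_closed [simp]: "h \<in> carrier H \<Longrightarrow> bar h \<in> carrier H"
  by (rule ring_hom_closed[OF bar_hom])

lemma bar_mult: "h \<in> carrier H \<Longrightarrow> h' \<in> carrier H \<Longrightarrow> bar (h \<otimes>\<^bsub>H\<^esub> h') = bar h \<otimes>\<^bsub>H\<^esub> bar h'"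
  by (rule ring_hom_mult[OF bar_hom])

lemma bar_add: "h \<in> carrier H \<Longrightarrow> h' \<in> carrier H \<Longrightarrow> bar (h \<oplus>\<^bsub>H\<^esub> h') = bar h \<oplus>\<^bsub>H\<^esub> bar h'"
  by (rule ring_hom_add[OF bar_hom])

lemma bar_one: "bar \<one>\<^bsub>H\<^esub> = \<one>\<^bsub>H\<^esub>"
  by (rule ring_hom_one[OF bar_hom])

lemma bar_zero: "bar \<zero>\<^bsub>H\<^esub> = \<zero>\<^bsub>H\<^esub>"
  by (rule ring_hom_zero[OF bar_hom]) unfold_locales

lemma bar_uminus: assumes h: "h \<in> carrier H" shows "bar (\<ominus>\<^bsub>H\<^esub> h) = \<ominus>\<^bsub>H\<^esub> bar h"
proof -
  have "bar (\<ominus>\<^bsub>H\<^esub> h) \<oplus>\<^bsub>H\<^esub> bar h = \<zero>\<^bsub>H\<^esub>"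
    using h by (simp add: M.l_neg bar_zero flip: bar_add)
  then show ?thesis using h by (simp add: M.minus_equality)
qed

lemma bar_minus: "h \<in> carrier H \<Longrightarrow> h' \<in> carrier H \<Longrightarrow> bar (h \<ominus>\<^bsub>H\<^esub> h') = bar h \<ominus>\<^bsub>H\<^esub> bar h'"
  by (simp add: a_minus_def bar_add bar_uminus)

lemma bar_finsum:
  "finite F \<Longrightarrow> f \<in> F \<rightarrow> carrier H \<Longrightarrow> bar (\<Oplus>\<^bsub>H\<^esub>i\<in>F. f i) = (\<Oplus>\<^bsub>H\<^esub>i\<in>F. bar (f i))"
proof (induction F rule: finite_induct)
  case (insert i F)
  then have "f i \<in> carrier H" "f \<in> F \<rightarrow> carrier H" "bar (f i) \<in> carrier H" "(\<lambda>i. bar (f i)) \<in> F \<rightarrow> carrier H"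
    by (auto simp: Pi_def)
  with insert show ?case by (simp add: M.finsum_closed bar_add)
qed (simp add: bar_zero)

lemma smult_one_mult: "a \<in> carrier A \<Longrightarrow> h \<in> carrier H \<Longrightarrow> (a \<odot>\<^bsub>H\<^esub> \<one>\<^bsub>H\<^esub>) \<otimes>\<^bsub>H\<^esub> h = a \<odot>\<^bsub>H\<^esub> h"
  by (simp add: smult_mult_left)

text \<open>Only the image of \<open>qv\<close> is prescribed. The image of \<open>qi\<close> is
  forced, since the product of the two images must be one; the remaining cases are the ring
  homomorphism laws.\<close>

lemma bar_pair_bar: "bar_pair a b \<Longrightarrow> bar (a \<odot>\<^bsub>H\<^esub> \<one>\<^bsub>H\<^esub>) = b \<odot>\<^bsub>H\<^esub> \<one>\<^bsub>H\<^esub>"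
proof (induction rule: bar_pair.induct)
  case one
  show ?case using bar_one smult_one by simp
next
  case q
  show ?case using bar_inv by (simp add: bar_involution_def)
next
  case qi
  let ?b = "bar (qi \<odot>\<^bsub>H\<^esub> \<one>\<^bsub>H\<^esub>)"
  have assoc: "qv \<odot>\<^bsub>H\<^esub> (qi \<odot>\<^bsub>H\<^esub> h) = h" if "h \<in> carrier H" for h
    using that smult_assoc1[of qv qi h] smult_one[of h] by simp
  have "bar (qv \<odot>\<^bsub>H\<^esub> \<one>\<^bsub>H\<^esub>) \<otimes>\<^bsub>H\<^esub> ?b = \<one>\<^bsub>H\<^esub>"
    using assoc by (simp add: smult_one_mult bar_one flip: bar_mult)
  then have "qi \<odot>\<^bsub>H\<^esub> ?b = \<one>\<^bsub>H\<^esub>"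
    using bar_inv by (simp add: bar_involution_def smult_one_mult)
  then have "qv \<odot>\<^bsub>H\<^esub> (qi \<odot>\<^bsub>H\<^esub> ?b) = qv \<odot>\<^bsub>H\<^esub> \<one>\<^bsub>H\<^esub>" by simp
  then show ?case using assoc by simp
next
  case (uminus a b)
  have m: "(- a) \<odot>\<^bsub>H\<^esub> \<one>\<^bsub>H\<^esub> = \<ominus>\<^bsub>H\<^esub> (a \<odot>\<^bsub>H\<^esub> \<one>\<^bsub>H\<^esub>)" if "a \<in> carrier A" for a
    using that smult_assoc1[of "- 1" a "\<one>\<^bsub>H\<^esub>"] by (simp add: minus_one_smult)
  show ?case using A_bar_pair[OF uminus.hyps] uminus.IH by (simp add: m bar_uminus)
next
  case (add a b a' b')
  then show ?case
    using A_bar_pair[OF add.hyps(1)] A_bar_pair[OF add.hyps(2)]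
      smult_l_distr[of a a' "\<one>\<^bsub>H\<^esub>"] smult_l_distr[of b b' "\<one>\<^bsub>H\<^esub>"] by (simp add: bar_add)
next
  case (mult a b a' b')
  have m: "(x * y) \<odot>\<^bsub>H\<^esub> \<one>\<^bsub>H\<^esub> = (x \<odot>\<^bsub>H\<^esub> \<one>\<^bsub>H\<^esub>) \<otimes>\<^bsub>H\<^esub> (y \<odot>\<^bsub>H\<^esub> \<one>\<^bsub>H\<^esub>)"
    if "x \<in> carrier A" "y \<in> carrier A" for x y
    using that smult_assoc1[of x y "\<one>\<^bsub>H\<^esub>"] by (simp add: smult_one_mult)
  show ?case
    using A_bar_pair[OF mult.hyps(1)] A_bar_pair[OF mult.hyps(2)] mult.IH by (simp add: m bar_mult)
qed

lemma bar_smult: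
  assumes "bar_pair a b" "h \<in> carrier H" shows "bar (a \<odot>\<^bsub>H\<^esub> h) = b \<odot>\<^bsub>H\<^esub> bar h"
  using A_bar_pair[OF assms(1)] assms bar_mult[of "a \<odot>\<^bsub>H\<^esub> \<one>\<^bsub>H\<^esub>" h] bar_pair_bar[OF assms(1)]
  by (simp add: smult_one_mult)

lemma cf_one: "w \<in> carrier G \<Longrightarrow> cf \<one>\<^bsub>H\<^esub> w = (if w = \<one> then 1 else 0)"
  using cf_T[of \<one> w] by (simp add: T_one)

text \<open>The substitution of \<open>q^-1\<close> for \<open>q\<close> is well defined because
  \<open>bar\<close> realises it on multiples of the unit, from which the scalar is recovered as the
  coefficient of \<open>T \<one>\<close>.\<close>

lemma bar_pair_unique:
  assumes "bar_pair a b" "bar_pair a b'" shows "b = b'"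
proof -
  have "b \<odot>\<^bsub>H\<^esub> \<one>\<^bsub>H\<^esub> = b' \<odot>\<^bsub>H\<^esub> \<one>\<^bsub>H\<^esub>" using assms bar_pair_bar by metis
  then have "cf (b \<odot>\<^bsub>H\<^esub> \<one>\<^bsub>H\<^esub>) \<one> = cf (b' \<odot>\<^bsub>H\<^esub> \<one>\<^bsub>H\<^esub>) \<one>" by simp
  then show ?thesis using A_bar_pair[OF assms(1)] A_bar_pair[OF assms(2)] by (simp add: cf_one)
qed

text \<open>The quadratic relation reads \<open>T s (T s - (q - q^-1)) = 1\<close>, and the factors
  commute.\<close>

lemma bar_T_gen:
  assumes s: "s \<in> S" shows "bar (T s) = T s \<ominus>\<^bsub>H\<^esub> (qv - qi) \<odot>\<^bsub>H\<^esub> \<one>\<^bsub>H\<^esub>"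
proof -
  let ?y = "T s \<ominus>\<^bsub>H\<^esub> (qv - qi) \<odot>\<^bsub>H\<^esub> \<one>\<^bsub>H\<^esub>"
  have sc: "T s \<in> carrier H" "?y \<in> carrier H" using s by auto
  have ss: "T s \<otimes>\<^bsub>H\<^esub> T s = (qv - qi) \<odot>\<^bsub>H\<^esub> T s \<oplus>\<^bsub>H\<^esub> \<one>\<^bsub>H\<^esub>"
    using T_mult[of s s] s by (simp add: T_one)
  have mone: "(- 1) \<odot>\<^bsub>H\<^esub> ((qv - qi) \<odot>\<^bsub>H\<^esub> h) = (- 1 * (qv - qi)) \<odot>\<^bsub>H\<^esub> h" if "h \<in> carrier H" for h
    using that smult_assoc1[of "- 1" "qv - qi" h] by simp
  have "T s \<otimes>\<^bsub>H\<^esub> ?y = \<one>\<^bsub>H\<^esub>" "?y \<otimes>\<^bsub>H\<^esub> T s = \<one>\<^bsub>H\<^esub>"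
    using sc(1) by (intro cf_eqI; simp add: a_minus_def minus_one_smult mone r_distr l_distr
      smult_mult_left smult_mult_right ss algebra_simps)+
  then have "inv\<^bsub>H\<^esub> (T s) = ?y" using sc by (intro inv_char) auto
  then show ?thesis using bar_inv s by (simp add: bar_involution_def)
qed

lemma cf_bar_T_gen_mult:
  assumes s: "s \<in> S" and h: "h \<in> carrier H" and w: "w \<in> carrier G"
  shows "cf (bar (T s) \<otimes>\<^bsub>H\<^esub> h) w = cf h (s \<otimes> w) - (if W.len (s \<otimes> w) < W.len w then 0 else (qv - qi) * cf h w)"
proof -
  have "bar (T s) \<otimes>\<^bsub>H\<^esub> h = T s \<otimes>\<^bsub>H\<^esub> h \<ominus>\<^bsub>H\<^esub> (qv - qi) \<odot>\<^bsub>H\<^esub> h"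
    using s h by (simp add: bar_T_gen a_minus_def l_distr M.l_neg l_minus smult_one_mult)
  then show ?thesis using s h w by (simp add: cf_T_mult)
qed

lemma cf_mult_bar_T_gen:
  assumes s: "s \<in> S" and h: "h \<in> carrier H" and w: "w \<in> carrier G"
  shows "cf (h \<otimes>\<^bsub>H\<^esub> bar (T s)) w = cf h (w \<otimes> s) - (if W.len (w \<otimes> s) < W.len w then 0 else (qv - qi) * cf h w)"
proof -
  have "h \<otimes>\<^bsub>H\<^esub> bar (T s) = h \<otimes>\<^bsub>H\<^esub> T s \<ominus>\<^bsub>H\<^esub> (qv - qi) \<odot>\<^bsub>H\<^esub> h"
    using s h by (simp add: bar_T_gen a_minus_def r_distr r_minus smult_mult_right)
  then show ?thesis using s h w by (simp add: cf_mult_T)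
qed

text \<open>Write \<open>T w = T s T v\<close> with \<open>v\<close> shorter by one. The coefficient
  at \<open>x\<close> then involves \<open>bar (T v)\<close> only at \<open>x\<close> and
  \<open>s x\<close>. It vanishes at \<open>x\<close>, which is longer than \<open>v\<close>, and at
  \<open>s x\<close>, which is at least as long as \<open>v\<close>, it detects whether
  \<open>s x = v\<close>.\<close>

lemma cf_bar_T:
  assumes "w \<in> carrier G" "x \<in> carrier G" "W.len w \<le> W.len x"
  shows "cf (bar (T w)) x = (if x = w then 1 else 0)"
  using assms
proof (induction "W.len w" arbitrary: w x)
  case 0
  then have "w = \<one>" using W.len_zero by simp
  with 0 show ?case by (simp add: T_one bar_one cf_one)
next
  case (Suc n)
  then have "w \<noteq> \<one>" by auto
  then obtain s v where sv: "s \<in> S" "v \<in> carrier G" "w = s \<otimes> v" "W.len w = Suc (W.len v)"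
    using W.left_descent_exists Suc.prems(1) by metis
  have x: "s \<otimes> x \<in> carrier G" using sv Suc.prems by simp
  have "T w = T s \<otimes>\<^bsub>H\<^esub> T v" using T_mult_up[of s v] sv by simp
  then have "bar (T w) = bar (T s) \<otimes>\<^bsub>H\<^esub> bar (T v)" using sv by (simp add: bar_mult)
  then have "cf (bar (T w)) x = cf (bar (T v)) (s \<otimes> x) -
      (if W.len (s \<otimes> x) < W.len x then 0 else (qv - qi) * cf (bar (T v)) x)"
    using sv Suc.prems by (simp add: cf_bar_T_gen_mult)
  moreover have "cf (bar (T v)) x = 0"
    using Suc.hyps(1)[of v x] Suc.hyps(2) Suc.prems sv by fastforce
  moreover have "cf (bar (T v)) (s \<otimes> x) = (if s \<otimes> x = v then 1 else 0)"
    using Suc.hyps(1)[of v "s \<otimes> x"] Suc.hyps(2) Suc.prems sv x W.len_mult_left[of s x] by fastforce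
  moreover have "s \<otimes> x = v \<longleftrightarrow> x = w" using sv Suc.prems by auto
  ultimately show ?case by simp
qed

text \<open>The coefficient ring also contains the inverse of \<open>parabolic_poincare\<close>, for
  which no image under \<open>bar\<close> is at hand; hence the assumption that all coefficients are
  Laurent polynomials.\<close>

lemma bar_fixed_top:
  assumes h: "h \<in> carrier H" and fixed: "bar h = h"
    and laurent: "\<And>w. w \<in> carrier G \<Longrightarrow> \<exists>b. bar_pair (cf h w) b"
    and x: "x \<in> carrier G" and top: "\<And>y. y \<in> carrier G \<Longrightarrow> cf h y \<noteq> 0 \<Longrightarrow> W.len y \<le> W.len x"
    and ideal: "cf h x \<in> qinv_ideal"
  shows "cf h x = 0"
proof -
  \<comment> \<open>Inserting \<open>x\<close> makes the sum below collapse to the term at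
    \<open>x\<close> even when the coefficient there is zero.\<close>
  let ?F = "insert x {w \<in> carrier G. cf h w \<noteq> 0}"
  obtain b where b: "\<And>w. w \<in> carrier G \<Longrightarrow> bar_pair (cf h w) (b w)" using laurent by metis
  have F: "finite ?F" "?F \<subseteq> carrier G" using basis_coord(2)[OF T_basis h] x by auto
  have bA: "b w \<in> carrier A" if "w \<in> carrier G" for w using b A_bar_pair that by blast
  have "h = (\<Oplus>\<^bsub>H\<^esub>w\<in>?F. cf h w \<odot>\<^bsub>H\<^esub> T w)"
    by (rule basis_coord_expand[OF T_basis h F]) auto
  then have "bar h = bar (\<Oplus>\<^bsub>H\<^esub>w\<in>?F. cf h w \<odot>\<^bsub>H\<^esub> T w)" by (rule arg_cong)
  also have "\<dots> = (\<Oplus>\<^bsub>H\<^esub>w\<in>?F. bar (cf h w \<odot>\<^bsub>H\<^esub> T w))"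
    by (rule bar_finsum) (use F h in auto)
  also have "\<dots> = (\<Oplus>\<^bsub>H\<^esub>w\<in>?F. b w \<odot>\<^bsub>H\<^esub> bar (T w))"
    by (rule M.finsum_cong') (use F h b bA x in \<open>auto intro!: bar_smult\<close>)
  finally have "cf (bar h) x = (\<Sum>w\<in>?F. cf (b w \<odot>\<^bsub>H\<^esub> bar (T w)) x)"
    using cf_finsum[OF F(1), of "\<lambda>w. b w \<odot>\<^bsub>H\<^esub> bar (T w)" x] F bA x by auto
  also have "\<dots> = (\<Sum>w\<in>?F. if w = x then b x else 0)"
    by (rule sum.cong) (use F bA x top in \<open>auto simp: cf_bar_T\<close>)
  also have "\<dots> = b x" using F(1) by simp
  finally have "cf h x = b x" using fixed by simp
  with qinv_ideal_bar_fixed[OF ideal] b[OF x] bar_pair_unique show ?thesis by metis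
qed

lemma exists_top:
  assumes h: "h \<in> carrier H" and "h \<noteq> \<zero>\<^bsub>H\<^esub>"
  obtains x where "x \<in> carrier G" "cf h x \<noteq> 0"
    "\<And>y. y \<in> carrier G \<Longrightarrow> cf h y \<noteq> 0 \<Longrightarrow> W.len y \<le> W.len x"
proof -
  let ?F = "{w \<in> carrier G. cf h w \<noteq> 0}"
  have F: "finite ?F" using basis_coord(2)[OF T_basis h] by simp
  have "?F \<noteq> {}" using cf_eqI[OF h M.zero_closed] assms by auto
  with F have "Max (W.len ` ?F) \<in> W.len ` ?F" by (intro Max_in) auto
  then obtain x where x: "x \<in> ?F" "W.len x = Max (W.len ` ?F)" by auto
  have "W.len y \<le> W.len x" if "y \<in> ?F" for y unfolding x(2) using F that by (intro Max_ge) auto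
  with x that show ?thesis by blast
qed

lemma bar_fixed_zero:
  assumes h: "h \<in> carrier H" and fixed: "bar h = h"
    and ideal: "\<And>w. w \<in> carrier G \<Longrightarrow> cf h w \<in> qinv_ideal"
  shows "h = \<zero>\<^bsub>H\<^esub>"
proof (rule ccontr)
  assume "h \<noteq> \<zero>\<^bsub>H\<^esub>"
  then obtain x where x: "x \<in> carrier G" "cf h x \<noteq> 0"
    "\<And>y. y \<in> carrier G \<Longrightarrow> cf h y \<noteq> 0 \<Longrightarrow> W.len y \<le> W.len x"
    using exists_top[OF h] by metis
  moreover have "\<exists>b. bar_pair (cf h w) b" if "w \<in> carrier G" for w
    using ideal[OF that] qinv_ideal_bar_fixed by blast
  ultimately show False using bar_fixed_top[OF h fixed] ideal by blast
qed

end


section \<open>The parabolic Hecke algebra\<close>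

context parabolic_hecke_bar
begin

text \<open>The elements on which both sides of the parabolic subalgebra act by the index
  representation \<open>T\<^sub>s \<mapsto> q\<close>; this turns out to be the carrier of the parabolic Hecke algebra.\<close>

definition index_elts :: "'h set" where
  "index_elts = {h \<in> carrier H. \<forall>s\<in>J. T s \<otimes>\<^bsub>H\<^esub> h = qv \<odot>\<^bsub>H\<^esub> h \<and> h \<otimes>\<^bsub>H\<^esub> T s = qv \<odot>\<^bsub>H\<^esub> h}"

lemma index_elts_carrier: "h \<in> index_elts \<Longrightarrow> h \<in> carrier H"
  by (simp add: index_elts_def)

lemma index_elts_zero: "\<zero>\<^bsub>H\<^esub> \<in> index_elts"
  by (simp add: index_elts_def)

lemma index_elts_add: "h \<in> index_elts \<Longrightarrow> h' \<in> index_elts \<Longrightarrow> h \<oplus>\<^bsub>H\<^esub> h' \<in> index_elts"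
  by (auto simp: index_elts_def l_distr r_distr smult_r_distr)

lemma smult_commute:
  assumes "a \<in> carrier A" "b \<in> carrier A" "h \<in> carrier H"
  shows "a \<odot>\<^bsub>H\<^esub> (b \<odot>\<^bsub>H\<^esub> h) = b \<odot>\<^bsub>H\<^esub> (a \<odot>\<^bsub>H\<^esub> h)"
  using smult_assoc1[OF assms] smult_assoc1[OF assms(2,1,3)] by (simp add: mult.commute)

lemma index_elts_smult:
  assumes "a \<in> carrier A" "h \<in> index_elts" shows "a \<odot>\<^bsub>H\<^esub> h \<in> index_elts"
  using assms by (auto simp: index_elts_def smult_mult_left smult_mult_right smult_commute[of a qv])

lemma index_elts_finsum:
  "finite F \<Longrightarrow> f \<in> F \<rightarrow> index_elts \<Longrightarrow> (\<Oplus>\<^bsub>H\<^esub>i\<in>F. f i) \<in> index_elts"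
proof (induction F rule: finite_induct)
  case (insert i F)
  then have "f i \<in> carrier H" "f \<in> F \<rightarrow> carrier H" using index_elts_carrier by (auto simp: Pi_def)
  with insert show ?case by (simp add: index_elts_add)
qed (simp add: index_elts_zero)

text \<open>Reading the eigenvector equation at \<open>x\<close> gives the factor \<open>q\<close>
  when the length goes up, and \<open>q - (q - q^-1) = q^-1\<close> when it goes down.\<close>

lemma index_elts_cf:
  assumes h: "h \<in> index_elts" and s: "s \<in> J" and x: "x \<in> carrier G"
  shows "cf h (s \<otimes> x) = qv powi (int (W.len (s \<otimes> x)) - int (W.len x)) * cf h x"
    and "cf h (x \<otimes> s) = qv powi (int (W.len (x \<otimes> s)) - int (W.len x)) * cf h x"
proof -
  have hc: "h \<in> carrier H" using h index_elts_carrier by blast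
  have "cf (T s \<otimes>\<^bsub>H\<^esub> h) x = qv * cf h x" "cf (h \<otimes>\<^bsub>H\<^esub> T s) x = qv * cf h x"
    using h s x hc by (auto simp: index_elts_def)
  then have 1: "cf h (s \<otimes> x) + (if W.len (s \<otimes> x) < W.len x then (qv - qi) * cf h x else 0) = qv * cf h x"
    and 2: "cf h (x \<otimes> s) + (if W.len (x \<otimes> s) < W.len x then (qv - qi) * cf h x else 0) = qv * cf h x"
    using s x hc cf_T_mult[of s h x] cf_mult_T[of s h x] by simp_all
  have m: "a = (qv powi (int n - int k)) * b"
    if "n = Suc k \<or> Suc n = k" "a + (if n < k then (qv - qi) * b else 0) = qv * b" for a b n k
  proof -
    have "int n - int k = (if n < k then - 1 else 1)" using that(1) by auto
    then show ?thesis using that by (auto simp: algebra_simps power_int_minus split: if_splits)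
  qed
  show "cf h (s \<otimes> x) = qv powi (int (W.len (s \<otimes> x)) - int (W.len x)) * cf h x"
    by (rule m[OF _ 1]) (use W.len_mult_left[of s x] s x in auto)
  show "cf h (x \<otimes> s) = qv powi (int (W.len (x \<otimes> s)) - int (W.len x)) * cf h x"
    by (rule m[OF _ 2]) (use W.len_mult_right[of s x] s x in auto)
qed

text \<open>The exponents, being differences of lengths, telescope along a path of letters inside
  the double coset.\<close>

lemma index_elts_cf_dcoset:
  assumes h: "h \<in> index_elts" and D: "D \<in> W.DC" "y \<in> D" "x \<in> D"
  shows "cf h x = qv powi (int (W.len x) - int (W.len y)) * cf h y"
  using D
proof (induction rule: W.DC_induct)
  case base
  show ?case by simp
next
  case (left x s)
  have "x \<in> carrier G" using left(1) W.DC_carrier D by blast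
  then show ?case using index_elts_cf(1)[OF h left(2), of x]
    by (simp add: left(3) flip: mult.assoc power_int_add)
next
  case (right x s)
  have "x \<in> carrier G" using right(1) W.DC_carrier D by blast
  then show ?case using index_elts_cf(2)[OF h right(2), of x]
    by (simp add: right(3) flip: mult.assoc power_int_add)
qed

text \<open>The coefficients at \<open>s x\<close> and \<open>x s\<close> are those at
  \<open>x\<close> times a power of \<open>q\<close>, hence nonzero, so a longest element of the
  support cannot be lengthened by a letter of \<open>J\<close>.\<close>

lemma index_elts_top:
  assumes h: "h \<in> index_elts" and x: "x \<in> carrier G" "cf h x \<noteq> 0"
    and top: "\<And>y. y \<in> carrier G \<Longrightarrow> cf h y \<noteq> 0 \<Longrightarrow> W.len y \<le> W.len x"
  shows "x = W.rp (W.dcos x)"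
proof -
  have "W.J_max x"
    unfolding W.J_max_def
  proof
    fix s assume s: "s \<in> J"
    have "cf h (s \<otimes> x) \<noteq> 0" "cf h (x \<otimes> s) \<noteq> 0"
      using index_elts_cf[OF h s x(1)] x(2) by simp_all
    with top[of "s \<otimes> x"] top[of "x \<otimes> s"] have "W.len (s \<otimes> x) \<le> W.len x" "W.len (x \<otimes> s) \<le> W.len x"
      using s x by auto
    then show "W.len (s \<otimes> x) < W.len x \<and> W.len (x \<otimes> s) < W.len x"
      using W.len_mult_left[of s x] W.len_mult_right[of s x] s x by fastforce
  qed
  then show ?thesis using W.J_max_eq_rp W.dcos_DC W.mem_dcos_self x by blast
qed

text \<open>The descent has to lie in \<open>J\<close>, not merely in \<open>S\<close>. If every
  letter of \<open>J\<close> lengthened \<open>w\<close>, lifting would keep \<open>w\<close> below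
  \<open>v w\<close> for all products \<open>v\<close> of letters in \<open>J\<close>; taking
  \<open>v = inv w\<close> puts \<open>w\<close> below the unit.\<close>

lemma WJ_left_descent:
  assumes w: "w \<in> W.WJ" "w \<noteq> \<one>"
  obtains s where "s \<in> J" "W.len (s \<otimes> w) < W.len w"
proof -
  have wc: "w \<in> carrier G" using w W.WJ_carrier by blast
  have "\<exists>s\<in>J. W.len (s \<otimes> w) < W.len w"
  proof (rule ccontr)
    assume "\<not> ?thesis"
    then have up: "W.len w < W.len (s \<otimes> w)" if "s \<in> J" for s
      using that W.len_mult_left[of s w] wc by fastforce
    obtain us where us: "us \<in> lists J" "W.wprod us = inv w"
      using W.word_exists_sub[OF W.J_sub, of "inv w"] w subgroup.m_inv_closed[OF W.subgroup_WJ]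
      by blast
    have "W.ble w (W.wprod vs \<otimes> w)" if "vs \<in> lists J" for vs
      using that
    proof (induction vs)
      case Nil
      show ?case using wc W.ble_refl by simp
    next
      case (Cons s vs)
      then have "s \<in> J" "vs \<in> lists J" by auto
      moreover from this have "W.wprod vs \<in> carrier G"
        using W.wprod_generate W.J_sub W.WJ_carrier by blast
      ultimately show ?case
        using Cons.IH W.ble_left_min[of w "W.wprod vs \<otimes> w" s] up wc by (simp add: W.m_assoc)
    qed
    from this[OF us(1)] have "W.ble w \<one>" using us wc by simp
    then show False using W.ble_len[of w \<one>] w by auto
  qed
  with that show ?thesis by blast
qed

lemma T_WJ_index:
  assumes h: "h \<in> index_elts" and w: "w \<in> W.WJ"
  shows "T w \<otimes>\<^bsub>H\<^esub> h = (qv ^ W.len w) \<odot>\<^bsub>H\<^esub> h \<and> h \<otimes>\<^bsub>H\<^esub> T w = (qv ^ W.len w) \<odot>\<^bsub>H\<^esub> h"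
  using w
proof (induction "W.len w" arbitrary: w rule: less_induct)
  case less
  have hc: "h \<in> carrier H" using h index_elts_carrier by blast
  show ?case
  proof (cases "w = \<one>")
    case True
    then show ?thesis using hc by (simp add: T_one)
  next
    case False
    then obtain s where s: "s \<in> J" "W.len (s \<otimes> w) < W.len w" using WJ_left_descent less.prems by blast
    define v where "v = s \<otimes> w"
    have vJ: "v \<in> W.WJ"
      using subgroup.m_closed[OF W.subgroup_WJ] W.J_WJ s less.prems by (simp add: v_def)
    have wc: "w \<in> carrier G" using less.prems W.WJ_carrier by blast
    then have v: "v \<in> carrier G" "s \<otimes> v = w" "W.len w = Suc (W.len v)"
      using s W.len_mult_left[of s w] by (auto simp: v_def)
    have Tw: "T w = T s \<otimes>\<^bsub>H\<^esub> T v" using T_mult_up[of s v] s v by simp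
    have IH: "T v \<otimes>\<^bsub>H\<^esub> h = (qv ^ W.len v) \<odot>\<^bsub>H\<^esub> h" "h \<otimes>\<^bsub>H\<^esub> T v = (qv ^ W.len v) \<odot>\<^bsub>H\<^esub> h"
      using less.hyps[OF _ vJ] v by auto
    have sh: "T s \<otimes>\<^bsub>H\<^esub> h = qv \<odot>\<^bsub>H\<^esub> h" "h \<otimes>\<^bsub>H\<^esub> T s = qv \<odot>\<^bsub>H\<^esub> h"
      using h s by (auto simp: index_elts_def)
    have q: "qv \<odot>\<^bsub>H\<^esub> ((qv ^ W.len v) \<odot>\<^bsub>H\<^esub> h) = (qv ^ W.len w) \<odot>\<^bsub>H\<^esub> h"
      "(qv ^ W.len v) \<odot>\<^bsub>H\<^esub> (qv \<odot>\<^bsub>H\<^esub> h) = (qv ^ W.len w) \<odot>\<^bsub>H\<^esub> h"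
      using smult_assoc1[of qv "qv ^ W.len v" h] smult_assoc1[of "qv ^ W.len v" qv h] hc v
      by (simp_all add: mult.commute)
    have "T w \<otimes>\<^bsub>H\<^esub> h = T s \<otimes>\<^bsub>H\<^esub> (T v \<otimes>\<^bsub>H\<^esub> h)" using Tw s v hc by (simp add: m_assoc)
    also have "\<dots> = (qv ^ W.len w) \<odot>\<^bsub>H\<^esub> h"
      using s v hc by (simp add: IH smult_mult_right sh q)
    finally have 1: "T w \<otimes>\<^bsub>H\<^esub> h = (qv ^ W.len w) \<odot>\<^bsub>H\<^esub> h" .
    have "h \<otimes>\<^bsub>H\<^esub> T w = (h \<otimes>\<^bsub>H\<^esub> T s) \<otimes>\<^bsub>H\<^esub> T v" using Tw s v hc by (simp add: m_assoc)
    also have "\<dots> = (qv ^ W.len w) \<odot>\<^bsub>H\<^esub> h"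
      using s v hc by (simp add: IH smult_mult_left sh q)
    finally show ?thesis using 1 by blast
  qed
qed

section \<open>The idempotent, and its corner as the space of common eigenvectors\<close>

abbreviation idem :: 'h where "idem \<equiv> parabolic_idem G S J H T"
abbreviation HJ where "HJ \<equiv> parabolic_hecke G S J H T"

definition idem_sum :: 'h where
  "idem_sum = (\<Oplus>\<^bsub>H\<^esub>w\<in>W.WJ. (qv ^ W.len w) \<odot>\<^bsub>H\<^esub> T w)"

lemma idem_eq: "idem = inverse (parabolic_poincare G S J) \<odot>\<^bsub>H\<^esub> idem_sum"
  by (simp add: parabolic_idem_def idem_sum_def)

lemma idem_sum_carrier: "idem_sum \<in> carrier H"
  unfolding idem_sum_def by (rule M.finsum_closed) (auto simp: W.WJ_carrier)

lemma cf_idem_sum: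
  assumes "x \<in> carrier G" shows "cf idem_sum x = (if x \<in> W.WJ then qv ^ W.len x else 0)"
proof -
  have "cf idem_sum x = (\<Sum>w\<in>W.WJ. cf ((qv ^ W.len w) \<odot>\<^bsub>H\<^esub> T w) x)"
    unfolding idem_sum_def using W.finite_parabolic assms by (intro cf_finsum) (auto simp: W.WJ_carrier)
  also have "\<dots> = (\<Sum>w\<in>W.WJ. if w = x then qv ^ W.len x else 0)"
    by (rule sum.cong) (use assms in \<open>auto simp: W.WJ_carrier\<close>)
  finally show ?thesis using W.finite_parabolic by simp
qed

lemma idem_sum_index: "idem_sum \<in> index_elts"
proof -
  have "T s \<otimes>\<^bsub>H\<^esub> idem_sum = qv \<odot>\<^bsub>H\<^esub> idem_sum \<and> idem_sum \<otimes>\<^bsub>H\<^esub> T s = qv \<odot>\<^bsub>H\<^esub> idem_sum" if s: "s \<in> J" for s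
  proof -
    note Wm = subgroup.m_closed[OF W.subgroup_WJ]
    have mem: "s \<otimes> x \<in> W.WJ \<longleftrightarrow> x \<in> W.WJ" "x \<otimes> s \<in> W.WJ \<longleftrightarrow> x \<in> W.WJ" if x: "x \<in> carrier G" for x
    proof -
      have "s \<otimes> (s \<otimes> x) = x" "x \<otimes> s \<otimes> s = x" using s x by simp_all
      then show "s \<otimes> x \<in> W.WJ \<longleftrightarrow> x \<in> W.WJ" "x \<otimes> s \<in> W.WJ \<longleftrightarrow> x \<in> W.WJ"
        using Wm[OF W.J_WJ[OF s], of x] Wm[OF W.J_WJ[OF s], of "s \<otimes> x"]
          Wm[OF _ W.J_WJ[OF s], of x] Wm[OF _ W.J_WJ[OF s], of "x \<otimes> s"] by metis+
    qed
    have sc: "T s \<in> carrier H" using s by simp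
    \<comment> \<open>The coefficients of \<open>idem_sum\<close> at \<open>x\<close> and at its
      neighbour are \<open>q^k\<close> and \<open>q^n\<close>; this identity is the eigenvector
      equation at \<open>x\<close>, for either direction of the length change.\<close>
    have pw: "qv ^ n + (if n < k then (qv - qi) * qv ^ k else 0) = qv * qv ^ k"
      if "n = Suc k \<or> Suc n = k" for n k
      using that by (auto simp: algebra_simps)
    have "cf (T s \<otimes>\<^bsub>H\<^esub> idem_sum) x = cf (qv \<odot>\<^bsub>H\<^esub> idem_sum) x"
      and "cf (idem_sum \<otimes>\<^bsub>H\<^esub> T s) x = cf (qv \<odot>\<^bsub>H\<^esub> idem_sum) x" if x: "x \<in> carrier G" for x
      using pw[OF W.len_mult_left[of s x]] pw[OF W.len_mult_right[of s x]] mem[OF x] s x idem_sum_carrier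
      by (auto simp: cf_T_mult cf_mult_T cf_idem_sum)
    then show ?thesis using idem_sum_carrier sc by (intro conjI cf_eqI) auto
  qed
  then show ?thesis using idem_sum_carrier by (simp add: index_elts_def)
qed

lemma idem_index: "idem \<in> index_elts"
  unfolding idem_eq using idem_sum_index A_poincare index_elts_smult by blast

lemma idem_carrier: "idem \<in> carrier H"
  using idem_index index_elts_carrier by blast

text \<open>On an eigenvector \<open>T w\<close> acts as \<open>q^(len w)\<close>, and the weight in
  \<open>idem_sum\<close> doubles this exponent; this is the origin of \<open>q^2\<close> in the
  Poincare polynomial.\<close>

lemma idem_sum_mult:
  assumes h: "h \<in> index_elts"
  shows "idem_sum \<otimes>\<^bsub>H\<^esub> h = parabolic_poincare G S J \<odot>\<^bsub>H\<^esub> h"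
    and "h \<otimes>\<^bsub>H\<^esub> idem_sum = parabolic_poincare G S J \<odot>\<^bsub>H\<^esub> h"
proof -
  have hc: "h \<in> carrier H" using h index_elts_carrier by blast
  \<comment> \<open>Closure of the partial sums is carried along, so that distributivity is
    available in the induction step.\<close>
  have P: "(\<Sum>w\<in>F. qv ^ (2 * W.len w)) \<in> carrier A \<and>
      (\<Oplus>\<^bsub>H\<^esub>w\<in>F. (qv ^ W.len w) \<odot>\<^bsub>H\<^esub> T w) \<in> carrier H \<and>
      (\<Oplus>\<^bsub>H\<^esub>w\<in>F. (qv ^ W.len w) \<odot>\<^bsub>H\<^esub> T w) \<otimes>\<^bsub>H\<^esub> h = (\<Sum>w\<in>F. qv ^ (2 * W.len w)) \<odot>\<^bsub>H\<^esub> h \<and>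
      h \<otimes>\<^bsub>H\<^esub> (\<Oplus>\<^bsub>H\<^esub>w\<in>F. (qv ^ W.len w) \<odot>\<^bsub>H\<^esub> T w) = (\<Sum>w\<in>F. qv ^ (2 * W.len w)) \<odot>\<^bsub>H\<^esub> h"
    if "finite F" "F \<subseteq> W.WJ" for F
    using that
  proof (induction F rule: finite_induct)
    case empty
    then show ?case using hc by simp
  next
    case (insert w F)
    then have w: "w \<in> W.WJ" "w \<in> carrier G" and IH: "(\<Sum>w\<in>F. qv ^ (2 * W.len w)) \<in> carrier A"
      "(\<Oplus>\<^bsub>H\<^esub>w\<in>F. (qv ^ W.len w) \<odot>\<^bsub>H\<^esub> T w) \<in> carrier H"
      "(\<Oplus>\<^bsub>H\<^esub>w\<in>F. (qv ^ W.len w) \<odot>\<^bsub>H\<^esub> T w) \<otimes>\<^bsub>H\<^esub> h = (\<Sum>w\<in>F. qv ^ (2 * W.len w)) \<odot>\<^bsub>H\<^esub> h"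
      "h \<otimes>\<^bsub>H\<^esub> (\<Oplus>\<^bsub>H\<^esub>w\<in>F. (qv ^ W.len w) \<odot>\<^bsub>H\<^esub> T w) = (\<Sum>w\<in>F. qv ^ (2 * W.len w)) \<odot>\<^bsub>H\<^esub> h"
      using W.WJ_carrier by auto
    have f: "(\<lambda>w. (qv ^ W.len w) \<odot>\<^bsub>H\<^esub> T w) \<in> F \<rightarrow> carrier H" using insert.prems W.WJ_carrier by auto
    have step: "(\<Oplus>\<^bsub>H\<^esub>w\<in>insert w F. (qv ^ W.len w) \<odot>\<^bsub>H\<^esub> T w) =
        (qv ^ W.len w) \<odot>\<^bsub>H\<^esub> T w \<oplus>\<^bsub>H\<^esub> (\<Oplus>\<^bsub>H\<^esub>w\<in>F. (qv ^ W.len w) \<odot>\<^bsub>H\<^esub> T w)"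
      using insert w f by simp
    have sq: "(qv ^ W.len w) \<odot>\<^bsub>H\<^esub> ((qv ^ W.len w) \<odot>\<^bsub>H\<^esub> h) = (qv ^ (2 * W.len w)) \<odot>\<^bsub>H\<^esub> h"
      using smult_assoc1[of "qv ^ W.len w" "qv ^ W.len w" h] hc
      by (simp add: mult_2 power_add)
    have ad: "(qv ^ (2 * W.len w)) \<odot>\<^bsub>H\<^esub> h \<oplus>\<^bsub>H\<^esub> (\<Sum>w\<in>F. qv ^ (2 * W.len w)) \<odot>\<^bsub>H\<^esub> h =
        (\<Sum>w\<in>insert w F. qv ^ (2 * W.len w)) \<odot>\<^bsub>H\<^esub> h"
      using smult_l_distr[of "qv ^ (2 * W.len w)" "\<Sum>w\<in>F. qv ^ (2 * W.len w)" h] IH(1) hc insert(1,2)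
      by simp
    show ?case
      unfolding step ad[symmetric]
      using w hc IH T_WJ_index[OF h w(1)] insert(1,2)
      by (simp add: l_distr r_distr smult_mult_left smult_mult_right sq)
  qed
  show "idem_sum \<otimes>\<^bsub>H\<^esub> h = parabolic_poincare G S J \<odot>\<^bsub>H\<^esub> h"
    and "h \<otimes>\<^bsub>H\<^esub> idem_sum = parabolic_poincare G S J \<odot>\<^bsub>H\<^esub> h"
    using P[OF W.finite_parabolic] by (simp_all add: idem_sum_def parabolic_poincare_def)
qed

lemma A_poincare_self: "parabolic_poincare G S J \<in> carrier A"
proof -
  have "(\<Sum>w\<in>F. qv ^ (2 * W.len w)) \<in> carrier A" for F
    by (induction F rule: infinite_finite_induct) auto
  then show ?thesis by (simp add: parabolic_poincare_def)
qed

lemma idem_mult: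
  assumes h: "h \<in> index_elts" shows "idem \<otimes>\<^bsub>H\<^esub> h = h" and "h \<otimes>\<^bsub>H\<^esub> idem = h"
proof -
  let ?P = "parabolic_poincare G S J"
  have hc: "h \<in> carrier H" using h index_elts_carrier by blast
  have nz: "?P \<noteq> 0" by (rule parabolic_poincare_nonzero[OF W.finite_parabolic])
  have "inverse ?P \<odot>\<^bsub>H\<^esub> (?P \<odot>\<^bsub>H\<^esub> h) = h"
    using smult_assoc1[OF A_poincare A_poincare_self hc] nz hc by simp
  then show "idem \<otimes>\<^bsub>H\<^esub> h = h" "h \<otimes>\<^bsub>H\<^esub> idem = h"
    using A_poincare idem_sum_carrier hc
    by (simp_all add: idem_eq smult_mult_left smult_mult_right idem_sum_mult[OF h])
qed

text \<open>Products \<open>e h e\<close> inherit the eigenvector equations from the outer factors.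
  Conversely an eigenvector \<open>h\<close> equals \<open>e h e\<close>, because \<open>e\<close>
  acts on it as the identity.\<close>

lemma carrier_HJ: "carrier HJ = index_elts"
proof -
  have "idem \<otimes>\<^bsub>H\<^esub> h \<otimes>\<^bsub>H\<^esub> idem \<in> index_elts" if h: "h \<in> carrier H" for h
  proof -
    have "T s \<otimes>\<^bsub>H\<^esub> (idem \<otimes>\<^bsub>H\<^esub> h \<otimes>\<^bsub>H\<^esub> idem) = qv \<odot>\<^bsub>H\<^esub> (idem \<otimes>\<^bsub>H\<^esub> h \<otimes>\<^bsub>H\<^esub> idem)"
      "(idem \<otimes>\<^bsub>H\<^esub> h \<otimes>\<^bsub>H\<^esub> idem) \<otimes>\<^bsub>H\<^esub> T s = qv \<odot>\<^bsub>H\<^esub> (idem \<otimes>\<^bsub>H\<^esub> h \<otimes>\<^bsub>H\<^esub> idem)" if s: "s \<in> J" for s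
    proof -
      have e: "T s \<otimes>\<^bsub>H\<^esub> idem = qv \<odot>\<^bsub>H\<^esub> idem" "idem \<otimes>\<^bsub>H\<^esub> T s = qv \<odot>\<^bsub>H\<^esub> idem"
        using idem_index s by (auto simp: index_elts_def)
      have "T s \<otimes>\<^bsub>H\<^esub> (idem \<otimes>\<^bsub>H\<^esub> h \<otimes>\<^bsub>H\<^esub> idem) = (T s \<otimes>\<^bsub>H\<^esub> idem) \<otimes>\<^bsub>H\<^esub> (h \<otimes>\<^bsub>H\<^esub> idem)"
        using s h idem_carrier by (simp add: m_assoc)
      then show "T s \<otimes>\<^bsub>H\<^esub> (idem \<otimes>\<^bsub>H\<^esub> h \<otimes>\<^bsub>H\<^esub> idem) = qv \<odot>\<^bsub>H\<^esub> (idem \<otimes>\<^bsub>H\<^esub> h \<otimes>\<^bsub>H\<^esub> idem)"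
        using h idem_carrier by (simp add: e smult_mult_left m_assoc)
      have "(idem \<otimes>\<^bsub>H\<^esub> h \<otimes>\<^bsub>H\<^esub> idem) \<otimes>\<^bsub>H\<^esub> T s = (idem \<otimes>\<^bsub>H\<^esub> h) \<otimes>\<^bsub>H\<^esub> (idem \<otimes>\<^bsub>H\<^esub> T s)"
        using s h idem_carrier by (simp add: m_assoc)
      then show "(idem \<otimes>\<^bsub>H\<^esub> h \<otimes>\<^bsub>H\<^esub> idem) \<otimes>\<^bsub>H\<^esub> T s = qv \<odot>\<^bsub>H\<^esub> (idem \<otimes>\<^bsub>H\<^esub> h \<otimes>\<^bsub>H\<^esub> idem)"
        using h idem_carrier by (simp add: e smult_mult_right)
    qed
    then show ?thesis using h idem_carrier by (simp add: index_elts_def)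
  qed
  moreover have "\<exists>h'\<in>carrier H. h = idem \<otimes>\<^bsub>H\<^esub> h' \<otimes>\<^bsub>H\<^esub> idem" if "h \<in> index_elts" for h
    using idem_mult[OF that] index_elts_carrier[OF that] by metis
  ultimately show ?thesis by (auto simp: parabolic_hecke_def Let_def)
qed

lemma HJ_simps: "(\<oplus>\<^bsub>HJ\<^esub>) = (\<oplus>\<^bsub>H\<^esub>)" "\<zero>\<^bsub>HJ\<^esub> = \<zero>\<^bsub>H\<^esub>" "(\<odot>\<^bsub>HJ\<^esub>) = (\<odot>\<^bsub>H\<^esub>)"
  by (simp_all add: parabolic_hecke_def Let_def)

text \<open>The corner is a separate record with a smaller carrier, so its \<open>finsum\<close> is
  formally a different operation and has to be identified with that of \<open>H\<close>.\<close>

lemma finsum_HJ: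
  assumes "finite F" "f \<in> F \<rightarrow> index_elts"
  shows "(\<Oplus>\<^bsub>HJ\<^esub>i\<in>F. f i) = (\<Oplus>\<^bsub>H\<^esub>i\<in>F. f i)"
proof -
  have ab: "abelian_monoid HJ"
    by (rule abelian_monoidI)
      (auto simp: carrier_HJ HJ_simps index_elts_zero index_elts_add
        index_elts_carrier M.a_assoc intro: M.a_comm)
  show ?thesis
    using assms
  proof (induction F rule: finite_induct)
    case empty
    then show ?case by (simp add: abelian_monoid.finsum_empty[OF ab] HJ_simps)
  next
    case (insert i F)
    then have f: "f \<in> F \<rightarrow> index_elts" "f i \<in> index_elts" "f \<in> F \<rightarrow> carrier H" "f i \<in> carrier H"
      using index_elts_carrier by (auto simp: Pi_def)
    then show ?case
      using insert abelian_monoid.finsum_insert[OF ab, of F i f]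
      by (simp add: carrier_HJ HJ_simps)
  qed
qed

section \<open>Standard elements attached to double cosets\<close>

abbreviation TD where "TD \<equiv> T_dcoset G S H T"
abbreviation dle where "dle \<equiv> dcoset_le G S"

lemma TD_carrier: assumes "D \<in> W.DC" shows "TD D \<in> carrier H"
  unfolding T_dcoset_def by (rule M.finsum_closed) (use assms W.DC_carrier in auto)

lemma cf_TD:
  assumes D: "D \<in> W.DC" and x: "x \<in> carrier G"
  shows "cf (TD D) x = (if x \<in> D then qv powi (int (W.len x) - int (W.len (W.rp D))) else 0)"
proof -
  have "cf (TD D) x = (\<Sum>w\<in>D. cf ((qv powi (int (W.len w) - int (W.len (W.rp D)))) \<odot>\<^bsub>H\<^esub> T w) x)"
    unfolding T_dcoset_def
    by (rule cf_finsum) (use W.DC_finite[OF D] W.DC_carrier[OF D] x in auto)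
  also have "\<dots> = (\<Sum>w\<in>D. if w = x then qv powi (int (W.len x) - int (W.len (W.rp D))) else 0)"
    by (rule sum.cong) (use W.DC_carrier[OF D] x in auto)
  finally show ?thesis using W.DC_finite[OF D] by simp
qed

text \<open>Double cosets are disjoint, so the coefficient at \<open>x\<close> sees only the summand
  of its own coset.\<close>

lemma cf_finsum_TD:
  assumes F: "finite F" "F \<subseteq> W.DC" and a: "\<And>D. D \<in> F \<Longrightarrow> a D \<in> carrier A"
    and D: "D \<in> W.DC" "x \<in> D"
  shows "cf (\<Oplus>\<^bsub>H\<^esub>D'\<in>F. a D' \<odot>\<^bsub>H\<^esub> TD D') x =
    (if D \<in> F then a D * qv powi (int (W.len x) - int (W.len (W.rp D))) else 0)"
proof -
  have x: "x \<in> carrier G" using D W.DC_carrier by blast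
  have cl: "a D' \<in> carrier A" "TD D' \<in> carrier H" if "D' \<in> F" for D'
    using that F a TD_carrier by auto
  have "cf (\<Oplus>\<^bsub>H\<^esub>D'\<in>F. a D' \<odot>\<^bsub>H\<^esub> TD D') x = (\<Sum>D'\<in>F. cf (a D' \<odot>\<^bsub>H\<^esub> TD D') x)"
    by (rule cf_finsum) (use F cl x in auto)
  also have "\<dots> = (\<Sum>D'\<in>F. if D' = D then a D * qv powi (int (W.len x) - int (W.len (W.rp D))) else 0)"
  proof (rule sum.cong)
    fix D' assume "D' \<in> F"
    then have D': "D' \<in> W.DC" using F by blast
    then have "x \<in> D' \<longleftrightarrow> D' = D" using D W.DC_disjoint[of D' D x] by auto
    then show "cf (a D' \<odot>\<^bsub>H\<^esub> TD D') x =
        (if D' = D then a D * qv powi (int (W.len x) - int (W.len (W.rp D))) else 0)"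
      using cl[OF \<open>D' \<in> F\<close>] x D' by (simp add: cf_TD)
  qed simp
  finally show ?thesis using F by simp
qed

end

section \<open>Kazhdan-Lusztig elements at the longest elements of double cosets\<close>

locale parabolic_kazhdan_lusztig = parabolic_hecke_bar +
  fixes C :: "'a \<Rightarrow> 'c" and p :: "'a \<Rightarrow> 'a \<Rightarrow> coeff"
  assumes kl: "kazhdan_lusztig (coeff_ring G S J) G S H T bar C p"
begin

lemma C_basis: "is_basis A H C (carrier G)"
  using kl by (simp add: kazhdan_lusztig_def)

lemma C_closed [simp]: "w \<in> carrier G \<Longrightarrow> C w \<in> carrier H"
  by (rule is_basis_closed[OF C_basis])

lemma bar_C: "w \<in> carrier G \<Longrightarrow> bar (C w) = C w"
  using kl unfolding kazhdan_lusztig_def by blast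

text \<open>For \<open>x\<close> not below \<open>w\<close> the coefficient is zero, which also lies
  in the ideal; so the off-diagonal case needs no Bruhat hypothesis.\<close>

lemma p_ideal: "w \<in> carrier G \<Longrightarrow> x \<in> carrier G \<Longrightarrow> x \<noteq> w \<Longrightarrow> p x w \<in> qinv_ideal"
  using kl qinv_ideal_zero by (cases "W.ble x w") (auto simp: kazhdan_lusztig_def bruhat_less_def)

lemma p_diag: "w \<in> carrier G \<Longrightarrow> p w w = 1"
  using kl by (simp add: kazhdan_lusztig_def)

lemma p_nonzero_ble: "w \<in> carrier G \<Longrightarrow> x \<in> carrier G \<Longrightarrow> p x w \<noteq> 0 \<Longrightarrow> W.ble x w"
  using kl by (auto simp: kazhdan_lusztig_def)

lemma p_Zqi: "w \<in> carrier G \<Longrightarrow> x \<in> carrier G \<Longrightarrow> p x w \<in> Zqi"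
  using p_ideal qinv_ideal_Zqi p_diag Zqi_one by metis

lemma p_A: "w \<in> carrier G \<Longrightarrow> x \<in> carrier G \<Longrightarrow> p x w \<in> carrier A"
  using p_Zqi A_Zqi by blast

lemma cf_C:
  assumes w: "w \<in> carrier G" and x: "x \<in> carrier G" shows "cf (C w) x = p x w"
proof -
  let ?F = "{x. bruhat_less G S x w}"
  \<comment> \<open>Finiteness matters: a \<open>finsum\<close> over an infinite index set is zero
    by default, and the defining expansion would lose its lower terms.\<close>
  have F: "finite ?F" "\<And>y. y \<in> ?F \<Longrightarrow> y \<in> carrier G"
    using finite_subset[OF _ W.finite_ble[OF w], of ?F] W.ble_closed by (auto simp: bruhat_less_def)
  have cl: "p y w \<odot>\<^bsub>H\<^esub> T y \<in> carrier H" if "y \<in> ?F" for y using F(2)[OF that] p_A w by simp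
  have "C w = T w \<oplus>\<^bsub>H\<^esub> (\<Oplus>\<^bsub>H\<^esub>x\<in>?F. p x w \<odot>\<^bsub>H\<^esub> T x)"
    using kl w by (simp add: kazhdan_lusztig_def)
  then have "cf (C w) x = cf (T w) x + cf (\<Oplus>\<^bsub>H\<^esub>x\<in>?F. p x w \<odot>\<^bsub>H\<^esub> T x) x"
    using w x cl by (simp add: M.finsum_closed)
  also have "cf (\<Oplus>\<^bsub>H\<^esub>x\<in>?F. p x w \<odot>\<^bsub>H\<^esub> T x) x = (\<Sum>y\<in>?F. cf (p y w \<odot>\<^bsub>H\<^esub> T y) x)"
    by (rule cf_finsum) (use F(1) cl x in auto)
  also have "\<dots> = (\<Sum>y\<in>?F. if y = x then p x w else 0)"
    by (rule sum.cong) (use F p_A w x in auto)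
  also have "\<dots> = (if x \<in> ?F then p x w else 0)" using F(1) by simp
  finally show ?thesis
    using p_nonzero_ble[OF w x] p_diag[OF w] w x by (auto simp: bruhat_less_def)
qed

text \<open>\<open>h\<close> stands for \<open>(T\<^sub>s - q) C\<^sub>w\<close> or \<open>C\<^sub>w (T\<^sub>s - q)\<close>, where \<open>f\<close> is multiplication by the
  descent \<open>s\<close> of \<open>w\<close>. At a longest element \<open>x\<close> of its support, either \<open>f x\<close> is longer and its
  coefficient is \<open>- q\<^sup>-\<^sup>1\<close> times that of \<open>x\<close>, or the coefficient at \<open>x\<close> is bar invariant and
  in \<open>q\<^sup>-\<^sup>1 \<int>[q\<^sup>-\<^sup>1]\<close>.\<close>

lemma descent_zero:
  assumes w: "w \<in> carrier G" and f: "\<And>x. x \<in> carrier G \<Longrightarrow> f x \<in> carrier G \<and> f (f x) = x \<and> W.len (f x) \<noteq> W.len x"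
    and desc: "W.len (f w) < W.len w"
    and h: "h \<in> carrier H" "bar h = h"
    and cfh: "\<And>x. x \<in> carrier G \<Longrightarrow> cf h x =
      p (f x) w + (if W.len (f x) < W.len x then (qv - qi) * p x w else 0) - qv * p x w"
  shows "h = \<zero>\<^bsub>H\<^esub>"
proof (rule ccontr)
  assume "h \<noteq> \<zero>\<^bsub>H\<^esub>"
  then obtain x where x: "x \<in> carrier G" "cf h x \<noteq> 0"
    and top: "\<And>y. y \<in> carrier G \<Longrightarrow> cf h y \<noteq> 0 \<Longrightarrow> W.len y \<le> W.len x"
    using exists_top[OF h(1)] by metis
  have laurent: "\<exists>b. bar_pair (cf h y) b" if y: "y \<in> carrier G" for y
  proof -
    obtain a b where "bar_pair (p (f y) w) a" "bar_pair (p y w) b"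
      using p_Zqi Zqi_bar_pair w y f by metis
    then show ?thesis
      unfolding cfh[OF y]
      by (auto intro!: exI bar_pair_diff bar_pair.add bar_pair.mult bar_pair.q bar_pair.qi bar_pair_zero)
  qed
  show False
  proof (cases "W.len (f x) < W.len x")
    case True
    \<comment> \<open>The descent hypothesis enters here: it excludes the diagonal coefficient
      \<open>p w w = 1\<close>, the only one outside the ideal.\<close>
    have "f x \<noteq> w" using True desc f[OF x(1)] by auto
    then have "p (f x) w - qi * p x w \<in> qinv_ideal"
      using p_ideal[OF w, of "f x"] p_Zqi[OF w x(1)] f[OF x(1)]
      by (intro qinv_ideal_diff qi_Zqi_qinv_ideal) auto
    moreover have "cf h x = p (f x) w - qi * p x w" using cfh[OF x(1)] True by (simp add: algebra_simps)
    ultimately show False using bar_fixed_top[OF h laurent x(1) top] x(2) by simp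
  next
    case False
    then have lt: "W.len x < W.len (f x)" using f[OF x(1)] by fastforce
    then have "cf h x = p (f x) w - qv * p x w" "cf h (f x) = p x w - qi * p (f x) w"
      using cfh[of x] cfh[of "f x"] f[OF x(1)] x(1) by (simp_all add: algebra_simps)
    then have "cf h (f x) = - qi * cf h x" by (simp add: right_diff_distrib flip: mult.assoc)
    then have "cf h (f x) \<noteq> 0" using x(2) by simp
    with top[of "f x"] lt f[OF x(1)] show False by simp
  qed
qed

lemma minus_eq_zero:
  assumes "h \<in> carrier H" "h' \<in> carrier H" "h \<ominus>\<^bsub>H\<^esub> h' = \<zero>\<^bsub>H\<^esub>" shows "h = h'"
proof (rule cf_eqI)
  fix w assume "w \<in> carrier G"
  then show "cf h w = cf h' w" using cf_minus[OF assms(1,2), of w] assms(3) by simp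
qed (use assms in auto)

text \<open>The factor \<open>T s - q\<close> is bar invariant, since
  \<open>bar (T s) - q^-1 = T s - (q - q^-1) - q^-1 = T s - q\<close>. Hence its product with
  \<open>C w\<close> is bar invariant and \<open>descent_zero\<close> applies.\<close>

lemma C_left_descent:
  assumes s: "s \<in> S" and w: "w \<in> carrier G" and desc: "W.len (s \<otimes> w) < W.len w"
  shows "T s \<otimes>\<^bsub>H\<^esub> C w = qv \<odot>\<^bsub>H\<^esub> C w"
proof (rule minus_eq_zero)
  let ?h = "T s \<otimes>\<^bsub>H\<^esub> C w \<ominus>\<^bsub>H\<^esub> qv \<odot>\<^bsub>H\<^esub> C w"
  have sc: "T s \<in> carrier H" "C w \<in> carrier H" using s w by auto
  show "?h = \<zero>\<^bsub>H\<^esub>"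
  proof (rule descent_zero[OF w, of "\<lambda>x. s \<otimes> x"])
    fix x assume x: "x \<in> carrier G"
    show "s \<otimes> x \<in> carrier G \<and> s \<otimes> (s \<otimes> x) = x \<and> W.len (s \<otimes> x) \<noteq> W.len x"
      using s x W.len_mult_left[of s x] by auto
    show "cf ?h x = p (s \<otimes> x) w + (if W.len (s \<otimes> x) < W.len x then (qv - qi) * p x w else 0) - qv * p x w"
      using s x w sc by (simp add: cf_T_mult cf_C)
  next
    have "bar ?h = bar (T s) \<otimes>\<^bsub>H\<^esub> C w \<ominus>\<^bsub>H\<^esub> qi \<odot>\<^bsub>H\<^esub> C w"
      using sc w by (simp add: bar_minus bar_mult bar_smult[OF bar_pair.q] bar_C)
    also have "\<dots> = ?h"
      by (rule cf_eqI) (use sc s w in \<open>auto simp: cf_bar_T_gen_mult cf_T_mult algebra_simps\<close>)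
    finally show "bar ?h = ?h" .
  qed (use sc desc in auto)
qed (use s w in auto)

lemma C_right_descent:
  assumes s: "s \<in> S" and w: "w \<in> carrier G" and desc: "W.len (w \<otimes> s) < W.len w"
  shows "C w \<otimes>\<^bsub>H\<^esub> T s = qv \<odot>\<^bsub>H\<^esub> C w"
proof (rule minus_eq_zero)
  let ?h = "C w \<otimes>\<^bsub>H\<^esub> T s \<ominus>\<^bsub>H\<^esub> qv \<odot>\<^bsub>H\<^esub> C w"
  have sc: "T s \<in> carrier H" "C w \<in> carrier H" using s w by auto
  show "?h = \<zero>\<^bsub>H\<^esub>"
  proof (rule descent_zero[OF w, of "\<lambda>x. x \<otimes> s"])
    fix x assume x: "x \<in> carrier G"
    show "x \<otimes> s \<in> carrier G \<and> x \<otimes> s \<otimes> s = x \<and> W.len (x \<otimes> s) \<noteq> W.len x"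
      using s x W.len_mult_right[of s x] by auto
    show "cf ?h x = p (x \<otimes> s) w + (if W.len (x \<otimes> s) < W.len x then (qv - qi) * p x w else 0) - qv * p x w"
      using s x w sc by (simp add: cf_mult_T cf_C)
  next
    have "bar ?h = C w \<otimes>\<^bsub>H\<^esub> bar (T s) \<ominus>\<^bsub>H\<^esub> qi \<odot>\<^bsub>H\<^esub> C w"
      using sc w by (simp add: bar_minus bar_mult bar_smult[OF bar_pair.q] bar_C)
    also have "\<dots> = ?h"
      by (rule cf_eqI) (use sc s w in \<open>auto simp: cf_mult_bar_T_gen cf_mult_T algebra_simps\<close>)
    finally show "bar ?h = ?h" .
  qed (use sc desc in auto)
qed (use s w in auto)

lemma C_rp_index: assumes "D \<in> W.DC" shows "C (W.rp D) \<in> index_elts"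
  using W.rplus_J_max(2)[OF assms] W.rp_carrier[OF assms] C_left_descent C_right_descent
  by (auto simp: index_elts_def W.J_max_def)

lemma p_dcoset:
  assumes "D \<in> W.DC" "D' \<in> W.DC" "x \<in> D'"
  shows "p x (W.rp D) = qv powi (int (W.len x) - int (W.len (W.rp D'))) * p (W.rp D') (W.rp D)"
  using index_elts_cf_dcoset[OF C_rp_index[OF assms(1)] assms(2) W.rplus_J_max(1)[OF assms(2)] assms(3)]
    W.rp_carrier assms W.DC_carrier by (simp add: cf_C)

text \<open>On each double coset the coefficients are the one at its longest element times those of
  \<open>TD\<close>. A coset carrying a nonzero coefficient meets the Bruhat interval below
  \<open>rp D\<close>, hence lies below \<open>D\<close>.\<close>

lemma C_rp_expansion:
  assumes D: "D \<in> W.DC"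
  shows "C (W.rp D) = (\<Oplus>\<^bsub>H\<^esub>D'\<in>{D' \<in> W.DC. dle D' D}. p (W.rp D') (W.rp D) \<odot>\<^bsub>H\<^esub> TD D')"
    (is "_ = ?R")
proof (rule cf_eqI)
  let ?F = "{D' \<in> W.DC. dle D' D}"
  have w: "W.rp D \<in> carrier G" using W.rp_carrier D by blast
  show "C (W.rp D) \<in> carrier H" using w by simp
  show "?R \<in> carrier H"
    by (rule M.finsum_closed) (use w p_A W.rp_carrier TD_carrier in auto)
  fix x assume x: "x \<in> carrier G"
  let ?D = "W.dcos x"
  have Dx: "?D \<in> W.DC" "x \<in> ?D" using x W.dcos_DC W.mem_dcos_self by auto
  have "cf ?R x = (if ?D \<in> ?F then p (W.rp ?D) (W.rp D) * qv powi (int (W.len x) - int (W.len (W.rp ?D))) else 0)"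
    by (rule cf_finsum_TD) (use W.finite_dcoset_le[OF D] w p_A W.rp_carrier Dx in auto)
  also have "\<dots> = p x (W.rp D)"
  proof (cases "p x (W.rp D) = 0")
    case True
    then show ?thesis using p_dcoset[OF D Dx] by auto
  next
    case False
    then have "dle ?D D" using p_nonzero_ble[OF w x] W.ble_rp_dcoset_le[OF D Dx] by blast
    then show ?thesis using p_dcoset[OF D Dx] Dx by simp
  qed
  finally show "cf (C (W.rp D)) x = cf ?R x" using cf_C[OF w x] by simp
qed

lemma C_rp_unitriangular:
  assumes D: "D \<in> W.DC"
  shows "C (W.rp D) = TD D \<oplus>\<^bsub>H\<^esub>
    (\<Oplus>\<^bsub>H\<^esub>D'\<in>{D' \<in> W.DC. dcoset_less G S D' D}. p (W.rp D') (W.rp D) \<odot>\<^bsub>H\<^esub> TD D')"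
proof -
  have w: "W.rp D \<in> carrier G" using W.rp_carrier D by blast
  have F: "{D' \<in> W.DC. dle D' D} = insert D {D' \<in> W.DC. dcoset_less G S D' D}"
    using D W.dcoset_le_refl by (auto simp: dcoset_less_def)
  have "finite {D' \<in> W.DC. dcoset_less G S D' D}"
    using W.finite_dcoset_le[OF D] F by simp
  moreover have "D \<notin> {D' \<in> W.DC. dcoset_less G S D' D}" by (simp add: dcoset_less_def)
  moreover have "p (W.rp D') (W.rp D) \<odot>\<^bsub>H\<^esub> TD D' \<in> carrier H" if "D' \<in> W.DC" for D'
    using that w p_A W.rp_carrier TD_carrier by simp
  ultimately show ?thesis
    using C_rp_expansion[OF D] D TD_carrier[OF D] p_diag[OF w] unfolding F
    by (simp add: Pi_def)
qed

text \<open>The difference of \<open>B\<close> and \<open>C (rp D)\<close> is bar invariant. On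
  \<open>D\<close> the leading terms cancel; on any other coset its coefficients lie in the ideal,
  so \<open>bar_fixed_zero\<close> applies.\<close>

lemma C_rp_unique:
  assumes D: "D \<in> W.DC" and bar: "bar B = B"
    and a: "\<And>D'. D' \<in> W.DC \<Longrightarrow> dcoset_less G S D' D \<Longrightarrow> a D' \<in> qinv_ideal"
    and B: "B = TD D \<oplus>\<^bsub>H\<^esub> (\<Oplus>\<^bsub>H\<^esub>D'\<in>{D' \<in> W.DC. dcoset_less G S D' D}. a D' \<odot>\<^bsub>H\<^esub> TD D')"
  shows "B = C (W.rp D)"
proof (rule minus_eq_zero)
  let ?F = "{D' \<in> W.DC. dcoset_less G S D' D}"
  have w: "W.rp D \<in> carrier G" using W.rp_carrier D by blast
  have F: "finite ?F" "?F \<subseteq> W.DC" "D \<notin> ?F"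
    using finite_subset[OF _ W.finite_dcoset_le[OF D], of ?F] by (auto simp: dcoset_less_def)
  have aA: "a D' \<in> carrier A" if "D' \<in> ?F" for D' using that a qinv_ideal_Zqi A_Zqi by blast
  have sum: "(\<Oplus>\<^bsub>H\<^esub>D'\<in>?F. a D' \<odot>\<^bsub>H\<^esub> TD D') \<in> carrier H"
    by (rule M.finsum_closed) (use aA TD_carrier in auto)
  show Bc: "B \<in> carrier H" unfolding B using sum TD_carrier[OF D] by simp
  show Cc: "C (W.rp D) \<in> carrier H" using w by simp
  show "B \<ominus>\<^bsub>H\<^esub> C (W.rp D) = \<zero>\<^bsub>H\<^esub>"
  proof (rule bar_fixed_zero)
    show "B \<ominus>\<^bsub>H\<^esub> C (W.rp D) \<in> carrier H" using Bc Cc by simp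
    show "bar (B \<ominus>\<^bsub>H\<^esub> C (W.rp D)) = B \<ominus>\<^bsub>H\<^esub> C (W.rp D)"
      using Bc Cc bar bar_C[OF w] by (simp add: bar_minus)
    fix x assume x: "x \<in> carrier G"
    let ?D = "W.dcos x"
    let ?q = "qv powi (int (W.len x) - int (W.len (W.rp ?D)))"
    have Dx: "?D \<in> W.DC" "x \<in> ?D" using x W.dcos_DC W.mem_dcos_self by auto
    \<comment> \<open>The longest element normalises \<open>TD\<close>, so the exponent is
      nonpositive and multiplication by this power keeps coefficients in the ideal.\<close>
    have q: "?q \<in> Zqi"
      by (rule qv_powi_nonpos) (use W.ble_len[OF W.ble_rp[OF Dx]] in auto)
    have cfB: "cf B x = (if x \<in> D then qv powi (int (W.len x) - int (W.len (W.rp D))) else 0) +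
        (if ?D \<in> ?F then a ?D * ?q else 0)"
      unfolding B using cf_finsum_TD[OF F(1,2) aA Dx] cf_TD[OF D x] sum TD_carrier[OF D] x by simp
    have cfC: "cf (C (W.rp D)) x = ?q * p (W.rp ?D) (W.rp D)"
      using cf_C[OF w x] p_dcoset[OF D Dx] by simp
    show "cf (B \<ominus>\<^bsub>H\<^esub> C (W.rp D)) x \<in> qinv_ideal"
    proof (cases "x \<in> D")
      case True
      then have "?D = D" using W.DC_mem_eq[OF D] by blast
      then have "cf (B \<ominus>\<^bsub>H\<^esub> C (W.rp D)) x = 0"
        using Bc Cc x True p_diag[OF w] by (simp add: cfB cfC dcoset_less_def)
      then show ?thesis using qinv_ideal_zero by simp
    next
      case False
      then have "?D \<noteq> D" using Dx by blast
      then have "W.rp ?D \<noteq> W.rp D" using W.rp_inj[OF Dx(1) D] by blast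
      then have "p (W.rp ?D) (W.rp D) \<in> qinv_ideal" using p_ideal w W.rp_carrier Dx by blast
      then have "(if ?D \<in> ?F then a ?D else 0) - p (W.rp ?D) (W.rp D) \<in> qinv_ideal"
        using a Dx qinv_ideal_zero by (intro qinv_ideal_diff) auto
      then have "((if ?D \<in> ?F then a ?D else 0) - p (W.rp ?D) (W.rp D)) * ?q \<in> qinv_ideal"
        using q by (rule qinv_ideal_mult)
      moreover have "cf (B \<ominus>\<^bsub>H\<^esub> C (W.rp D)) x =
          ((if ?D \<in> ?F then a ?D else 0) - p (W.rp ?D) (W.rp D)) * ?q"
        using Bc Cc x False by (auto simp: cfB cfC algebra_simps)
      ultimately show ?thesis by simp
    qed
  qed
qed

text \<open>A longest element \<open>w\<close>, not of the form \<open>r\<^sup>+(D)\<close>, in the Kazhdan--Lusztig support would be a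
  longest element of the standard support after the terms at the \<open>r\<^sup>+(D)\<close> are subtracted.\<close>

lemma index_elts_C_support:
  assumes x: "x \<in> index_elts" and w: "w \<in> carrier G" "basis_coord A H C (carrier G) x w \<noteq> 0"
  shows "w \<in> W.rp ` W.DC"
proof (rule ccontr)
  let ?d = "basis_coord A H C (carrier G) x"
  assume "w \<notin> W.rp ` W.DC"
  have xc: "x \<in> carrier H" using x index_elts_carrier by blast
  let ?X = "{w \<in> carrier G. ?d w \<noteq> 0}"
  let ?B = "?X - W.rp ` W.DC" and ?R = "?X \<inter> W.rp ` W.DC"
  have X: "finite ?X" using basis_coord(2)[OF C_basis xc] by simp
  have dA: "?d v \<in> carrier A" if "v \<in> carrier G" for v
    using basis_coord_closed[OF C_basis xc that] .
  have cl: "(\<lambda>v. ?d v \<odot>\<^bsub>H\<^esub> C v) \<in> carrier G \<rightarrow> carrier H" using dA by auto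
  define y where "y = (\<Oplus>\<^bsub>H\<^esub>v\<in>?B. ?d v \<odot>\<^bsub>H\<^esub> C v)"
  define z where "z = (\<Oplus>\<^bsub>H\<^esub>v\<in>?R. ?d v \<odot>\<^bsub>H\<^esub> C v)"
  have yc: "y \<in> carrier H" unfolding y_def by (rule M.finsum_closed) (use cl in auto)
  have zI: "z \<in> index_elts"
    unfolding z_def
    by (rule index_elts_finsum) (use X dA C_rp_index index_elts_smult in auto)
  have "x = (\<Oplus>\<^bsub>H\<^esub>v\<in>?B \<union> ?R. ?d v \<odot>\<^bsub>H\<^esub> C v)"
    by (rule basis_coord_expand[OF C_basis xc]) (use X in auto)
  also have "\<dots> = y \<oplus>\<^bsub>H\<^esub> z"
    unfolding y_def z_def by (rule M.finsum_Un_disjoint) (use X cl in auto)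
  finally have xyz: "x = y \<oplus>\<^bsub>H\<^esub> z" .
  have "x \<oplus>\<^bsub>H\<^esub> (- 1) \<odot>\<^bsub>H\<^esub> z = y"
    by (rule cf_eqI) (use xyz yc zI index_elts_carrier in auto)
  then have yI: "y \<in> index_elts"
    using index_elts_add[OF x index_elts_smult[OF _ zI, of "- 1"]] by simp
  have "w \<in> ?B" using w \<open>w \<notin> W.rp ` W.DC\<close> by blast
  then have "Max (W.len ` ?B) \<in> W.len ` ?B" using X by (intro Max_in) auto
  then obtain u where u: "u \<in> ?B" "W.len u = Max (W.len ` ?B)" by auto
  have umax: "W.len v \<le> W.len u" if "v \<in> ?B" for v
    unfolding u(2) using X that by (intro Max_ge) auto
  have uc: "u \<in> carrier G" using u by blast
  have cfy: "cf y v = (\<Sum>v'\<in>?B. ?d v' * p v v')" if v: "v \<in> carrier G" for v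
  proof -
    have "cf y v = (\<Sum>v'\<in>?B. cf (?d v' \<odot>\<^bsub>H\<^esub> C v') v)"
      unfolding y_def by (rule cf_finsum) (use X cl v in auto)
    also have "\<dots> = (\<Sum>v'\<in>?B. ?d v' * p v v')"
      by (rule sum.cong) (use dA v in \<open>auto simp: cf_C\<close>)
    finally show ?thesis .
  qed
  \<comment> \<open>Unitriangularity: \<open>u\<close> is longest in the Kazhdan-Lusztig support, so
    among these \<open>C v\<close> only \<open>C u\<close> involves \<open>T u\<close>, and does so
    with coefficient one.\<close>
  have "cf y u = (\<Sum>v\<in>?B. if v = u then ?d u else 0)"
    unfolding cfy[OF uc]
  proof (rule sum.cong)
    fix v assume v: "v \<in> ?B"
    show "?d v * p u v = (if v = u then ?d u else 0)"
    proof (cases "v = u")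
      case True
      then show ?thesis using p_diag uc by simp
    next
      case False
      have "p u v = 0"
        using p_nonzero_ble[of v u] W.ble_len[of u v] umax[OF v] False v uc by fastforce
      then show ?thesis using False by simp
    qed
  qed simp
  then have "cf y u = ?d u" using u X by simp
  then have "cf y u \<noteq> 0" using u by simp
  moreover have "W.len v \<le> W.len u" if v: "v \<in> carrier G" "cf y v \<noteq> 0" for v
  proof -
    obtain v' where v': "v' \<in> ?B" "p v v' \<noteq> 0"
      using v unfolding cfy[OF v(1)] by (metis (no_types, lifting) mult_zero_right sum.neutral)
    then have "W.ble v v'" using p_nonzero_ble v by blast
    then show ?thesis using W.ble_len[of v v'] umax[OF v'(1)] by auto
  qed
  ultimately have "u = W.rp (W.dcos u)" using index_elts_top[OF yI uc] by blast
  then show False using u W.dcos_DC[OF uc] by blast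
qed

text \<open>Existence and uniqueness are both inherited from the basis \<open>C\<close> of
  \<open>H\<close>: the support lemma confines the expansion to longest elements, and injectivity of
  \<open>rp\<close> translates between families indexed by cosets and by group elements.\<close>

lemma C_rp_basis: "is_basis A HJ (\<lambda>D. C (W.rp D)) W.DC"
  unfolding is_basis_def carrier_HJ
proof (intro conjI ballI)
  show "(\<lambda>D. C (W.rp D)) \<in> W.DC \<rightarrow> index_elts" using C_rp_index by blast
  fix x assume x: "x \<in> index_elts"
  have xc: "x \<in> carrier H" using x index_elts_carrier by blast
  let ?d = "basis_coord A H C (carrier G) x"
  let ?c = "\<lambda>D\<in>W.DC. ?d (W.rp D)"
  have inj: "inj_on W.rp F" if "F \<subseteq> W.DC" for F
    using W.rp_inj that by (intro inj_onI) blast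
  have dA: "?d v \<in> carrier A" if "v \<in> carrier G" for v
    using basis_coord_closed[OF C_basis xc that] .
  let ?F = "{D \<in> W.DC. ?c D \<noteq> \<zero>\<^bsub>A\<^esub>}"
  have im: "W.rp ` ?F = {w \<in> carrier G. ?d w \<noteq> 0}"
    using index_elts_C_support[OF x] W.rp_carrier by auto
  have fin: "finite ?F"
    by (rule finite_imageD[of W.rp]) (use im basis_coord(2)[OF C_basis xc] inj in auto)
  have eq: "(\<Oplus>\<^bsub>HJ\<^esub>D\<in>F. c D \<odot>\<^bsub>HJ\<^esub> C (W.rp D)) = (\<Oplus>\<^bsub>H\<^esub>D\<in>F. c D \<odot>\<^bsub>H\<^esub> C (W.rp D))"
    if "finite F" "F \<subseteq> W.DC" "\<And>D. D \<in> F \<Longrightarrow> c D \<in> carrier A" for F c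
    unfolding HJ_simps by (rule finsum_HJ) (use that C_rp_index index_elts_smult in auto)
  have "x = (\<Oplus>\<^bsub>H\<^esub>w\<in>W.rp ` ?F. ?d w \<odot>\<^bsub>H\<^esub> C w)"
    unfolding im using basis_coord(3)[OF C_basis xc] by simp
  also have "\<dots> = (\<Oplus>\<^bsub>H\<^esub>D\<in>?F. ?d (W.rp D) \<odot>\<^bsub>H\<^esub> C (W.rp D))"
    by (rule M.finsum_reindex) (use inj W.rp_carrier dA in auto)
  also have "\<dots> = (\<Oplus>\<^bsub>H\<^esub>D\<in>?F. ?c D \<odot>\<^bsub>H\<^esub> C (W.rp D))"
    by (rule M.finsum_cong') (use W.rp_carrier dA in auto)
  also have "\<dots> = (\<Oplus>\<^bsub>HJ\<^esub>D\<in>?F. ?c D \<odot>\<^bsub>HJ\<^esub> C (W.rp D))"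
    by (rule eq[symmetric]) (use fin W.rp_carrier dA in auto)
  finally have expand: "x = (\<Oplus>\<^bsub>HJ\<^esub>D\<in>?F. ?c D \<odot>\<^bsub>HJ\<^esub> C (W.rp D))" .
  show "\<exists>!c. c \<in> W.DC \<rightarrow>\<^sub>E carrier A \<and> finite {D \<in> W.DC. c D \<noteq> \<zero>\<^bsub>A\<^esub>} \<and>
      x = (\<Oplus>\<^bsub>HJ\<^esub>D\<in>{D \<in> W.DC. c D \<noteq> \<zero>\<^bsub>A\<^esub>}. c D \<odot>\<^bsub>HJ\<^esub> C (W.rp D))"
  proof (rule ex1I[of _ ?c])
    show "?c \<in> W.DC \<rightarrow>\<^sub>E carrier A \<and> finite ?F \<and> x = (\<Oplus>\<^bsub>HJ\<^esub>D\<in>?F. ?c D \<odot>\<^bsub>HJ\<^esub> C (W.rp D))"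
      using fin expand W.rp_carrier dA by auto
  next
    fix c
    let ?E = "{D \<in> W.DC. c D \<noteq> \<zero>\<^bsub>A\<^esub>}"
    assume c: "c \<in> W.DC \<rightarrow>\<^sub>E carrier A \<and> finite ?E \<and> x = (\<Oplus>\<^bsub>HJ\<^esub>D\<in>?E. c D \<odot>\<^bsub>HJ\<^esub> C (W.rp D))"
    have cA: "c D \<in> carrier A" if "D \<in> W.DC" for D using c that by auto
    \<comment> \<open>The competing family \<open>c\<close>, reindexed by longest elements, so that
      it can be compared with coordinates in \<open>H\<close>.\<close>
    define e where "e = (\<lambda>w. c (the_inv_into W.DC W.rp w))"
    have e: "e (W.rp D) = c D" if "D \<in> W.DC" for D
      using the_inv_into_f_f[OF inj[OF subset_refl] that] by (simp add: e_def)
    have "x = (\<Oplus>\<^bsub>H\<^esub>D\<in>?E. c D \<odot>\<^bsub>H\<^esub> C (W.rp D))"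
      using c eq[of ?E c] by auto
    also have "\<dots> = (\<Oplus>\<^bsub>H\<^esub>D\<in>?E. e (W.rp D) \<odot>\<^bsub>H\<^esub> C (W.rp D))"
      by (rule M.finsum_cong') (use e cA W.rp_carrier in auto)
    also have "\<dots> = (\<Oplus>\<^bsub>H\<^esub>w\<in>W.rp ` ?E. e w \<odot>\<^bsub>H\<^esub> C w)"
      by (rule M.finsum_reindex[symmetric]) (use inj W.rp_carrier e cA in auto)
    finally have xe: "x = (\<Oplus>\<^bsub>H\<^esub>w\<in>W.rp ` ?E. e w \<odot>\<^bsub>H\<^esub> C w)" .
    have "?d (W.rp D) = c D" if D: "D \<in> W.DC" for D
    proof -
      have "?d (W.rp D) = (if W.rp D \<in> W.rp ` ?E then e (W.rp D) else \<zero>\<^bsub>A\<^esub>)"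
        unfolding xe
        by (rule basis_coord_finsum[OF C_basis]) (use c cA W.rp_carrier D e in auto)
      moreover have "W.rp D \<in> W.rp ` ?E \<longleftrightarrow> D \<in> ?E" using W.rp_inj D by auto
      ultimately show ?thesis using e[OF D] D by auto
    qed
    then show "c = ?c" using c by (auto simp: fun_eq_iff PiE_def extensional_def)
  qed
qed

end

theorem proposition4p1:
  fixes G :: "('w, 'b) monoid_scheme" and S J :: "'w set"
    and H :: "(coeff, 'h, 'c) module_scheme" and T C :: "'w \<Rightarrow> 'h"
    and bar :: "'h \<Rightarrow> 'h" and p :: "'w \<Rightarrow> 'w \<Rightarrow> coeff"
  assumes "coxeter_system G S"
    and "J \<subseteq> S" and "J \<noteq> {}" and "finite (parabolic G J)"
    and "hecke_algebra (coeff_ring G S J) G S H T"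
    and "bar_involution S H T bar"
    and "kazhdan_lusztig (coeff_ring G S J) G S H T bar C p"
  shows "is_basis (coeff_ring G S J) (parabolic_hecke G S J H T)
           (\<lambda>D. C (rplus G S D)) (double_cosets G J) \<and>
         (\<forall>D\<in>double_cosets G J.
           C (rplus G S D) =
             (\<Oplus>\<^bsub>H\<^esub>D'\<in>{D' \<in> double_cosets G J. dcoset_le G S D' D}.
               p (rplus G S D') (rplus G S D) \<odot>\<^bsub>H\<^esub> T_dcoset G S H T D')) \<and>
         (\<forall>D\<in>double_cosets G J. \<forall>B.
           (B \<in> carrier (parabolic_hecke G S J H T) \<and> bar B = B \<and>
            (\<exists>a. (\<forall>D'\<in>double_cosets G J. dcoset_less G S D' D \<longrightarrow> a D' \<in> qinv_ideal) \<and>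
              B = T_dcoset G S H T D \<oplus>\<^bsub>H\<^esub>
                (\<Oplus>\<^bsub>H\<^esub>D'\<in>{D' \<in> double_cosets G J. dcoset_less G S D' D}.
                  a D' \<odot>\<^bsub>H\<^esub> T_dcoset G S H T D')))
           \<longleftrightarrow> B = C (rplus G S D))"
proof -
  interpret W: coxeter_system G S by fact
  interpret P: parabolic_coxeter G S J by unfold_locales fact+
  interpret Hk: hecke_algebra "coeff_ring G S J" G S H T by fact
  interpret L: parabolic_kazhdan_lusztig G S J H T bar C p by unfold_locales fact+
  have "B \<in> carrier (parabolic_hecke G S J H T) \<and> bar B = B \<and>
      (\<exists>a. (\<forall>D'\<in>double_cosets G J. dcoset_less G S D' D \<longrightarrow> a D' \<in> qinv_ideal) \<and>
        B = T_dcoset G S H T D \<oplus>\<^bsub>H\<^esub>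
          (\<Oplus>\<^bsub>H\<^esub>D'\<in>{D' \<in> double_cosets G J. dcoset_less G S D' D}.
            a D' \<odot>\<^bsub>H\<^esub> T_dcoset G S H T D'))
      \<longleftrightarrow> B = C (rplus G S D)" (is "?L \<longleftrightarrow> ?R") if D: "D \<in> double_cosets G J" for B D
  proof
    assume ?L
    then show ?R using L.C_rp_unique[OF D] by blast
  next
    assume R: ?R
    \<comment> \<open>Distinct double cosets have distinct longest elements, so these coefficients
      are off the diagonal.\<close>
    have "p (rplus G S D') (rplus G S D) \<in> qinv_ideal"
      if "D' \<in> double_cosets G J" "dcoset_less G S D' D" for D'
      using that L.p_ideal P.rp_carrier P.rp_inj D by (metis dcoset_less_def)
    moreover have "bar B = B" "B \<in> carrier (parabolic_hecke G S J H T)"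
      using R D L.bar_C P.rp_carrier L.C_rp_index L.carrier_HJ by auto
    ultimately show ?L using L.C_rp_unitriangular[OF D] R
      by (intro conjI exI[of _ "\<lambda>D'. p (rplus G S D') (rplus G S D)"]) auto
  qed
  with L.C_rp_basis L.C_rp_expansion show ?thesis by blast
qed

end
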